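(* For a given 0-C1PVASS $\mathcal{A}$, the set $R(\mathcal{A})=\{c\in\mathbb{R}_{\ge0}\mid\mathcal{A}\text{ has a }c\text{-reaching run}\}$ of all reachable counter values is an interval, and it (its endpoints, possibly $\infty$ on the right, and whether each endpoint is included) is computable in polynomial time.
   Context: A 0-C1PVASS is a tuple $\mathcal{A}=(S,\Gamma,\delta,\bot,s_0,f)$: finite state set $S$, finite stack alphabet $\Gamma\ni\bot$, initial state $s_0$, accepting state $f$, and a partial function $\delta:S\times S\rightharpoonup\mathbb{Z}\times(\{a,\overline{a}\mid a\in\Gamma\setminus\{\bot\}\}\cup\{\epsilon\})$ giving a counter update (integer, encoded in binary) and a stack operation (push $a$, pop $a$, or none). Configurations are $(s,\alpha,c)$ with $\alpha\in\Gamma^*$ and $c\in\mathbb{R}_{\ge0}$; the initial configuration is $(s_0,\bot,0)$. A run is a sequence of configurations starting in the initial configuration where consecutive states are linked by a defined transition $(z,op)$, the stack is updated according to $op$, and $c_{i+1}=c_i+\gamma_i z$ for some $\gamma_i\in(0,1]$, with all counter values $\ge0$. A run is $k$-reaching if it ends in state $f$ with counter value exactly $k$. *)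

theory Defs
  imports
    "HOL-Analysis.Analysis"
    "HOL-Computational_Algebra.Polynomial"
    "HOL-Library.Log_Nat"
begin

section \<open>Continuous one-counter pushdown VASS without zero tests\<close>

datatype 'g stack_op = Push 'g | Pop 'g | NoOp

record ('s, 'g) c1pvass =
  states :: "'s set"
  alphabet :: "'g set"
  trans :: "('s \<times> 's) \<rightharpoonup> (int \<times> 'g stack_op)"
  stack_bottom :: 'g
  init_state :: 's
  acc_state :: 's

definition stack_ops :: "('s, 'g) c1pvass \<Rightarrow> 'g stack_op set" where
  "stack_ops A = (let G = alphabet A - {stack_bottom A} in Push ` G \<union> Pop ` G \<union> {NoOp})"

definition is_c1pvass :: "('s, 'g) c1pvass \<Rightarrow> bool" where
  "is_c1pvass A \<longleftrightarrow>
     finite (states A) \<and> finite (alphabet A) \<and> stack_bottom A \<in> alphabet A \<and>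
     init_state A \<in> states A \<and> acc_state A \<in> states A \<and>
     dom (trans A) \<subseteq> states A \<times> states A \<and>
     ran (trans A) \<subseteq> UNIV \<times> stack_ops A"

text \<open>Stacks are lists with the top at the head, so the bottom symbol is the last element.\<close>

type_synonym ('s, 'g) conf = "'s \<times> 'g list \<times> real"

definition confs :: "('s, 'g) c1pvass \<Rightarrow> ('s, 'g) conf set" where
  "confs A = states A \<times> lists (alphabet A) \<times> {0..}"

definition init_conf :: "('s, 'g) c1pvass \<Rightarrow> ('s, 'g) conf" where
  "init_conf A = (init_state A, [stack_bottom A], 0)"

fun stack_step :: "'g stack_op \<Rightarrow> 'g list \<Rightarrow> 'g list \<Rightarrow> bool" where
  "stack_step (Push a) \<alpha> \<beta> \<longleftrightarrow> \<beta> = a # \<alpha>"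
| "stack_step (Pop a) \<alpha> \<beta> \<longleftrightarrow> \<alpha> = a # \<beta>"
| "stack_step NoOp \<alpha> \<beta> \<longleftrightarrow> \<beta> = \<alpha>"

fun conf_step :: "('s, 'g) c1pvass \<Rightarrow> ('s, 'g) conf \<Rightarrow> ('s, 'g) conf \<Rightarrow> bool" where
  "conf_step A (s, \<alpha>, c) (s', \<alpha>', c') \<longleftrightarrow>
     (\<exists>z stop \<gamma>. trans A (s, s') = Some (z, stop) \<and> stack_step stop \<alpha> \<alpha>' \<and>
        0 < \<gamma> \<and> \<gamma> \<le> 1 \<and> c' = c + \<gamma> * of_int z)"

definition is_run :: "('s, 'g) c1pvass \<Rightarrow> ('s, 'g) conf list \<Rightarrow> bool" where
  "is_run A \<rho> \<longleftrightarrow>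
     \<rho> \<noteq> [] \<and> hd \<rho> = init_conf A \<and> set \<rho> \<subseteq> confs A \<and> successively (conf_step A) \<rho>"

definition reaching_run :: "('s, 'g) c1pvass \<Rightarrow> real \<Rightarrow> ('s, 'g) conf list \<Rightarrow> bool" where
  "reaching_run A k \<rho> \<longleftrightarrow> is_run A \<rho> \<and> (\<exists>\<alpha>. last \<rho> = (acc_state A, \<alpha>, k))"

definition reach_values :: "('s, 'g) c1pvass \<Rightarrow> real set" where
  "reach_values A = {c. 0 \<le> c \<and> (\<exists>\<rho>. reaching_run A c \<rho>)}"


section \<open>Polynomial time: random access machines with logarithmic cost\<close>

text \<open>
  The machine model is the random access machine of Cook and Reckhow (Time bounded random access
  machines, 1973) under the logarithmic cost criterion, which is polynomially equivalent to the
  multitape Turing machine. Registers are indexed by natural numbers, hold arbitrary integers and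
  are initially 0. The input and the output are sequences of integers.
\<close>

datatype ram_instr =
    RConst nat int        \<comment> \<open>\<open>X\<^sub>i := c\<close>\<close>
  | RAdd nat nat nat      \<comment> \<open>\<open>X\<^sub>i := X\<^sub>j + X\<^sub>k\<close>\<close>
  | RSub nat nat nat      \<comment> \<open>\<open>X\<^sub>i := X\<^sub>j - X\<^sub>k\<close>\<close>
  | RLoad nat nat         \<comment> \<open>\<open>X\<^sub>i := X[X\<^sub>j]\<close>\<close>
  | RStore nat nat        \<comment> \<open>\<open>X[X\<^sub>i] := X\<^sub>j\<close>\<close>
  | RJump nat nat         \<comment> \<open>go to instruction \<open>l\<close> if \<open>X\<^sub>j > 0\<close>\<close>
  | RRead nat             \<comment> \<open>\<open>X\<^sub>i :=\<close> next input\<close>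
  | RPrint nat            \<comment> \<open>append \<open>X\<^sub>i\<close> to the output\<close>

text \<open>Program counter, registers, remaining input, output produced so far.\<close>

type_synonym ram_conf = "nat \<times> (nat \<Rightarrow> int) \<times> int list \<times> int list"

definition bit_length :: "int \<Rightarrow> nat" where
  "bit_length z = max 1 (floorlog 2 (nat \<bar>z\<bar>))"

definition input_size :: "int list \<Rightarrow> nat" where
  "input_size xs = (\<Sum>x\<leftarrow>xs. bit_length x)"

text \<open>
  The successor configuration and the cost of the step; \<open>None\<close> if the machine is stuck, which
  happens on a negative indirect address and on reading past the end of the input.
\<close>

fun ram_step :: "ram_instr \<Rightarrow> ram_conf \<Rightarrow> (ram_conf \<times> nat) option" where
  "ram_step (RConst i c) (pc, X, inp, out) =
     Some ((Suc pc, X(i := c), inp, out), bit_length c)"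
| "ram_step (RAdd i j k) (pc, X, inp, out) =
     Some ((Suc pc, X(i := X j + X k), inp, out), bit_length (X j) + bit_length (X k))"
| "ram_step (RSub i j k) (pc, X, inp, out) =
     Some ((Suc pc, X(i := X j - X k), inp, out), bit_length (X j) + bit_length (X k))"
| "ram_step (RLoad i j) (pc, X, inp, out) =
     (if X j < 0 then None
      else Some ((Suc pc, X(i := X (nat (X j))), inp, out),
                 bit_length (X j) + bit_length (X (nat (X j)))))"
| "ram_step (RStore i j) (pc, X, inp, out) =
     (if X i < 0 then None
      else Some ((Suc pc, X(nat (X i) := X j), inp, out),
                 bit_length (X i) + bit_length (X j)))"
| "ram_step (RJump l j) (pc, X, inp, out) =
     Some ((if X j > 0 then l else Suc pc, X, inp, out), bit_length (X j))"
| "ram_step (RRead i) (pc, X, inp, out) =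
     (case inp of [] \<Rightarrow> None
      | x # xs \<Rightarrow> Some ((Suc pc, X(i := x), xs, out), bit_length x))"
| "ram_step (RPrint i) (pc, X, inp, out) =
     Some ((Suc pc, X, inp, out @ [X i]), bit_length (X i))"

inductive ram_steps :: "ram_instr list \<Rightarrow> ram_conf \<Rightarrow> nat \<Rightarrow> ram_conf \<Rightarrow> bool"
  for P where
  ram_refl: "ram_steps P C 0 C"
| ram_trans: "fst C < length P \<Longrightarrow> ram_step (P ! fst C) C = Some (C', k) \<Longrightarrow>
    ram_steps P C' t C'' \<Longrightarrow> ram_steps P C (k + t) C''"

text \<open>
  The program halts when the program counter leaves the program. The machine is deterministic, so
  output and time are determined by program and input.
\<close>

definition ram_computes :: "ram_instr list \<Rightarrow> int list \<Rightarrow> int list \<Rightarrow> nat \<Rightarrow> bool" where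
  "ram_computes P xs ys t \<longleftrightarrow>
     (\<exists>pc X rest. ram_steps P (0, (\<lambda>_. 0), xs, []) t (pc, X, rest, ys) \<and> length P \<le> pc)"


section \<open>Input: automata as sequences of integers\<close>

text \<open>
  An automaton is presented by listing its states \<open>ss\<close> and its stack symbols \<open>gs\<close> without
  repetition, in any order; states and symbols are then named by their positions. Stack symbols
  contribute one entry each, marking the bottom symbol, and the transition function is given as
  the full table over all pairs of states. The code does not depend on the types of states and symbols,
  so a program that works for automata over \<open>nat\<close> works for automata over all types.
\<close>

definition enumerates :: "'a list \<Rightarrow> 'a set \<Rightarrow> bool" where
  "enumerates xs X \<longleftrightarrow> distinct xs \<and> set xs = X"

definition position :: "'a list \<Rightarrow> 'a \<Rightarrow> int" where
  "position xs x = int (length (takeWhile (\<lambda>y. y \<noteq> x) xs))"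

fun encode_stack_op :: "'g list \<Rightarrow> 'g stack_op \<Rightarrow> int list" where
  "encode_stack_op gs NoOp = [0, 0]"
| "encode_stack_op gs (Push a) = [1, position gs a]"
| "encode_stack_op gs (Pop a) = [2, position gs a]"

fun encode_entry :: "'g list \<Rightarrow> (int \<times> 'g stack_op) option \<Rightarrow> int list" where
  "encode_entry gs None = [0, 0, 0, 0]"
| "encode_entry gs (Some (z, stop)) = 1 # z # encode_stack_op gs stop"

definition encode_c1pvass :: "'s list \<Rightarrow> 'g list \<Rightarrow> ('s, 'g) c1pvass \<Rightarrow> int list" where
  "encode_c1pvass ss gs A =
     [int (length ss), position ss (init_state A), position ss (acc_state A), int (length gs)] @
     map (\<lambda>g. of_bool (g = stack_bottom A)) gs @
     concat (map (\<lambda>s. concat (map (\<lambda>s'. encode_entry gs (trans A (s, s'))) ss)) ss)"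


section \<open>Output: intervals as sequences of integers\<close>

text \<open>
  A description is the empty interval or gives both endpoints, each finite endpoint together with
  a flag telling whether it belongs to the interval. The sets in question are bounded below by 0,
  so the left endpoint is always finite.
\<close>

datatype right_end = Unbounded | Bounded rat bool

datatype interval_desc = EmptyInt | Interval rat bool right_end

fun left_ok :: "rat \<Rightarrow> bool \<Rightarrow> real \<Rightarrow> bool" where
  "left_ok l incl x \<longleftrightarrow> (if incl then of_rat l \<le> x else of_rat l < x)"

fun right_ok :: "right_end \<Rightarrow> real \<Rightarrow> bool" where
  "right_ok Unbounded x \<longleftrightarrow> True"
| "right_ok (Bounded u incl) x \<longleftrightarrow> (if incl then x \<le> of_rat u else x < of_rat u)"

text \<open>
  Nonemptiness in the second equation makes the given endpoints the actual infimum and supremum of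
  the set, so a set has at most one description.
\<close>

fun describes :: "interval_desc \<Rightarrow> real set \<Rightarrow> bool" where
  "describes EmptyInt X \<longleftrightarrow> X = {}"
| "describes (Interval l lc r) X \<longleftrightarrow> X \<noteq> {} \<and> X = {x. left_ok l lc x \<and> right_ok r x}"

definition encode_rat :: "rat \<Rightarrow> int list" where
  "encode_rat q = (case quotient_of q of (a, b) \<Rightarrow> [a, b])"

fun encode_right_end :: "right_end \<Rightarrow> int list" where
  "encode_right_end Unbounded = [0]"
| "encode_right_end (Bounded u uc) = 1 # encode_rat u @ [of_bool uc]"

fun encode_interval :: "interval_desc \<Rightarrow> int list" where
  "encode_interval EmptyInt = [0]"
| "encode_interval (Interval l lc r) = 1 # encode_rat l @ [of_bool lc] @ encode_right_end r"

end

theory Submission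
  imports Defs
begin

text \<open>
  Along a fixed sequence of updates only signs matter. A nonempty set of final values arises iff the
  first nonzero update is positive or there is none; then it is \<open>{0}\<close> or an interval from 0 to the
  sum \<open>S\<close> of the positive updates, containing 0 iff the last nonzero update is negative and \<open>S\<close> iff
  no update is negative. With the signs recorded in the control state, the problem is to maximise
  \<open>S\<close> over the stack-respecting paths to the accepting state. These are the derivations of a
  context-free grammar with polynomially many rules and nonnegative weights. Kleene iteration over
  \<open>max\<close> and \<open>+\<close>, with as many rounds as there are nonterminals, finds every finite maximum; any
  later change exposes a nonterminal that reproduces itself with positive gain, so its maximum is
  infinite. Additions lengthen a number by at most one bit, so polynomially many machine steps
  have polynomial logarithmic cost.
\<close>

section \<open>A loop language on the random access machine\<close>

text \<open>Signs suffice because a factor in \<open>(0, 1]\<close> can be arbitrarily small: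
  decreases can be made negligible and increases scaled down, so every nonempty value set of a path
  has infimum 0. The union over all paths is thus an interval, fixed by the largest sum for each of
  four sign patterns. The patterns stay apart because whether an endpoint is included depends on
  which of them occur and which attain the maximum. The stack is the obstacle: an optimal path can
  be exponentially long, and what repeats in it is not a state but a pair of states joined by a
  balanced path. Hence nonterminals are pairs, with an extra row for paths from the initial state,
  which may leave symbols on the stack. As derivations are trees, a late change has to be traced
  down a single branch before the pigeonhole principle yields a context to pump. The time claim
  concerns a concrete machine, so a program has to be exhibited. Its analysis is split: the loop
  language bounds the number of steps, and the bit cost follows from the step count alone.\<close>

text \<open>
  The memory consists of arrays indexed by natural numbers; array 0 holds the variables. Negative
  indices are read as 0. The flag \<open>ok\<close> is cleared when the input is exhausted or when a loop is
  entered with more than \<open>L\<close> iterations, so that a run keeping it set has time polynomial in \<open>L\<close>.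
\<close>

datatype aexp = Const int | Var nat | Plus aexp aexp | Minus aexp aexp | Rd nat aexp

fun aval :: "aexp \<Rightarrow> (nat \<Rightarrow> nat \<Rightarrow> int) \<Rightarrow> int" where
  "aval (Const c) M = c"
| "aval (Var v) M = M 0 v"
| "aval (Plus a b) M = aval a M + aval b M"
| "aval (Minus a b) M = aval a M - aval b M"
| "aval (Rd k a) M = M k (nat (aval a M))"

datatype com =
    Skip
  | Assign nat aexp
  | Store nat aexp aexp
  | Read nat
  | Print aexp
  | Seq com com  (infixr ";;" 60)
  | IfPos aexp com com
  | Loop aexp com

record state =
  mem :: "nat \<Rightarrow> nat \<Rightarrow> int"
  inp :: "int list"
  out :: "int list"
  ok :: bool

definition upd :: "nat \<Rightarrow> nat \<Rightarrow> int \<Rightarrow> (nat \<Rightarrow> nat \<Rightarrow> int) \<Rightarrow> nat \<Rightarrow> nat \<Rightarrow> int" where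
  "upd k i x M = M(k := (M k)(i := x))"

fun exec :: "nat \<Rightarrow> com \<Rightarrow> state \<Rightarrow> state" where
  "exec L Skip s = s"
| "exec L (Assign v e) s = s\<lparr>mem := upd 0 v (aval e (mem s)) (mem s)\<rparr>"
| "exec L (Store k a e) s = s\<lparr>mem := upd k (nat (aval a (mem s))) (aval e (mem s)) (mem s)\<rparr>"
| "exec L (Read v) s =
     (case inp s of [] \<Rightarrow> s\<lparr>ok := False\<rparr>
      | x # xs \<Rightarrow> s\<lparr>mem := upd 0 v x (mem s), inp := xs\<rparr>)"
| "exec L (Print e) s = s\<lparr>out := out s @ [aval e (mem s)]\<rparr>"
| "exec L (c ;; d) s = exec L d (exec L c s)"
| "exec L (IfPos e c d) s = (if aval e (mem s) > 0 then exec L c s else exec L d s)"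
| "exec L (Loop e c) s =
     (let n = nat (aval e (mem s))
      in (exec L c ^^ n) (s\<lparr>ok := (ok s \<and> n \<le> L)\<rparr>))"

fun wf_exp :: "aexp \<Rightarrow> bool" where
  "wf_exp (Plus a b) = (wf_exp a \<and> wf_exp b)"
| "wf_exp (Minus a b) = (wf_exp a \<and> wf_exp b)"
| "wf_exp (Rd k a) = (k \<noteq> 1 \<and> k < 16 \<and> wf_exp a)"
| "wf_exp _ = True"

fun wf_com :: "com \<Rightarrow> bool" where
  "wf_com Skip = True"
| "wf_com (Assign v e) = wf_exp e"
| "wf_com (Store k a e) = (k \<noteq> 1 \<and> k < 16 \<and> wf_exp a \<and> wf_exp e)"
| "wf_com (Read v) = True"
| "wf_com (Print e) = wf_exp e"
| "wf_com (c ;; d) = (wf_com c \<and> wf_com d)"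
| "wf_com (IfPos e c d) = (wf_exp e \<and> wf_com c \<and> wf_com d)"
| "wf_com (Loop e c) = (wf_exp e \<and> wf_com c)"

text \<open>Sixteen unbounded arrays are interleaved with stride 16; this is the origin of the bound
  16 in \<open>wf_exp\<close> and \<open>wf_com\<close>.\<close>

definition adr :: "nat \<Rightarrow> nat \<Rightarrow> nat" where
  "adr k i = 16 * i + k"

text \<open>Array 1 holds intermediate results and loop counters, hence its exclusion in \<open>wf_com\<close>.\<close>

abbreviation tmp :: "nat \<Rightarrow> nat" where
  "tmp d \<equiv> adr (Suc 0) d"

text \<open>The machine cannot multiply, so \<open>16 * i\<close> is formed by four doublings. The
  initial jump skips a reset to 0 that catches negative indices, in agreement with
  \<open>nat\<close> in \<open>aval\<close>.\<close>

definition compile_adr :: "nat \<Rightarrow> nat \<Rightarrow> nat \<Rightarrow> ram_instr list" where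
  "compile_adr l d k =
     [RJump (l + 2) (tmp d), RConst (tmp d) 0,
      RAdd (tmp d) (tmp d) (tmp d), RAdd (tmp d) (tmp d) (tmp d),
      RAdd (tmp d) (tmp d) (tmp d), RAdd (tmp d) (tmp d) (tmp d),
      RConst (tmp (Suc d)) (int k), RAdd (tmp d) (tmp d) (tmp (Suc d))]"

text \<open>Jumps are absolute, hence the start address \<open>l\<close>. The depth \<open>d\<close>
  makes the temporaries a stack: the result goes to \<open>tmp d\<close>, and only temporaries from
  \<open>d\<close> on are overwritten. Adding to a cleared register replaces the missing copy
  instruction.\<close>

fun compile_exp :: "nat \<Rightarrow> nat \<Rightarrow> aexp \<Rightarrow> ram_instr list" where
  "compile_exp l d (Const c) = [RConst (tmp d) c]"
| "compile_exp l d (Var v) = [RConst (tmp d) 0, RAdd (tmp d) (tmp d) (adr 0 v)]"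
| "compile_exp l d (Plus a b) =
     (let is = compile_exp l d a; js = compile_exp (l + length is) (Suc d) b
      in is @ js @ [RAdd (tmp d) (tmp d) (tmp (Suc d))])"
| "compile_exp l d (Minus a b) =
     (let is = compile_exp l d a; js = compile_exp (l + length is) (Suc d) b
      in is @ js @ [RSub (tmp d) (tmp d) (tmp (Suc d))])"
| "compile_exp l d (Rd k a) =
     (let is = compile_exp l d a
      in is @ compile_adr (l + length is) d k @ [RLoad (tmp d) (tmp d)])"

text \<open>Loading 1 and testing it gives an unconditional jump. A loop keeps its counter in
  \<open>tmp d\<close> and compiles its body at depth \<open>Suc d\<close>, so nested loops cannot
  disturb it.\<close>

fun compile :: "nat \<Rightarrow> nat \<Rightarrow> com \<Rightarrow> ram_instr list" where
  "compile l d Skip = []"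
| "compile l d (Assign v e) =
     compile_exp l d e @ [RConst (tmp (Suc d)) 0, RAdd (adr 0 v) (tmp d) (tmp (Suc d))]"
| "compile l d (Store k a e) =
     (let is = compile_exp l d a @ compile_adr (l + length (compile_exp l d a)) d k
      in is @ compile_exp (l + length is) (Suc d) e @ [RStore (tmp d) (tmp (Suc d))])"
| "compile l d (Read v) = [RRead (adr 0 v)]"
| "compile l d (Print e) = compile_exp l d e @ [RPrint (tmp d)]"
| "compile l d (c\<^sub>1 ;; c\<^sub>2) =
     (let is = compile l d c\<^sub>1 in is @ compile (l + length is) d c\<^sub>2)"
| "compile l d (IfPos e c\<^sub>1 c\<^sub>2) =
     (let is = compile_exp l d e;
          l\<^sub>2 = Suc (l + length is);
          js = compile l\<^sub>2 d c\<^sub>2;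
          l\<^sub>1 = l\<^sub>2 + length js + 2;
          ks = compile l\<^sub>1 d c\<^sub>1
      in is @ [RJump l\<^sub>1 (tmp d)] @ js @ [RConst (tmp d) 1, RJump (l\<^sub>1 + length ks) (tmp d)] @ ks)"
| "compile l d (Loop e c) =
     (let is = compile_exp l d e;
          l\<^sub>1 = Suc (Suc (Suc (l + length is)));
          js = compile l\<^sub>1 (Suc d) c
      in is @ [RJump l\<^sub>1 (tmp d), RConst (tmp (Suc d)) 1,
               RJump (Suc (Suc (Suc (l\<^sub>1 + length js)))) (tmp (Suc d))] @
         js @ [RConst (tmp (Suc d)) 1, RSub (tmp d) (tmp d) (tmp (Suc d)), RJump l\<^sub>1 (tmp d)])"

section \<open>Correctness of compiled code, with time counted in steps\<close>

inductive nsteps :: "ram_instr list \<Rightarrow> ram_conf \<Rightarrow> nat \<Rightarrow> ram_conf \<Rightarrow> bool" for P where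
  nsteps_refl: "nsteps P C 0 C"
| nsteps_step: "fst C < length P \<Longrightarrow> ram_step (P ! fst C) C = Some (C', k) \<Longrightarrow>
    nsteps P C' n C'' \<Longrightarrow> nsteps P C (Suc n) C''"

lemma nsteps_trans:
  "nsteps P C m C' \<Longrightarrow> nsteps P C' n C'' \<Longrightarrow> nsteps P C (m + n) C''"
  by (induction rule: nsteps.induct) (auto intro: nsteps_step)

definition code_at :: "ram_instr list \<Rightarrow> nat \<Rightarrow> ram_instr list \<Rightarrow> bool" where
  "code_at P l is \<longleftrightarrow> (\<forall>i < length is. l + i < length P \<and> P ! (l + i) = is ! i)"

lemma code_at_Nil [simp]: "code_at P l []"
  by (simp add: code_at_def)

lemma code_at_Cons [simp]:
  "code_at P l (i # is) \<longleftrightarrow> l < length P \<and> P ! l = i \<and> code_at P (Suc l) is"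
  unfolding code_at_def by (auto simp: less_Suc_eq_0_disj nth_Cons split: nat.splits)

lemma code_at_append [simp]:
  "code_at P l (is @ js) \<longleftrightarrow> code_at P l is \<and> code_at P (l + length is) js"
  by (induction "is" arbitrary: l) auto

lemma adr_eq_iff [simp]:
  assumes "k < 16" "k' < 16"
  shows "adr k i = adr k' i' \<longleftrightarrow> k = k' \<and> i = i'"
proof -
  have "adr k i mod 16 = k" "adr k i div 16 = i" "adr k' i' mod 16 = k'" "adr k' i' div 16 = i'"
    using assms by (simp_all add: adr_def)
  then show ?thesis by metis
qed

definition rep :: "(nat \<Rightarrow> nat \<Rightarrow> int) \<Rightarrow> (nat \<Rightarrow> int) \<Rightarrow> bool" where
  "rep M X \<longleftrightarrow> (\<forall>k i. k \<noteq> 1 \<longrightarrow> k < 16 \<longrightarrow> X (adr k i) = M k i)"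

lemma rep_tmp [simp]: "rep M (X(tmp d := x)) = rep M X"
  by (auto simp: rep_def)

lemma rep_upd [simp]:
  "k \<noteq> 1 \<Longrightarrow> k < 16 \<Longrightarrow> rep M X \<Longrightarrow> rep (upd k i x M) (X(adr k i := x))"
  by (auto simp: rep_def upd_def)

text \<open>The calling convention for temporaries: code at depth \<open>d\<close> leaves the
  shallower ones intact.\<close>

definition below :: "nat \<Rightarrow> (nat \<Rightarrow> int) \<Rightarrow> (nat \<Rightarrow> int) \<Rightarrow> bool" where
  "below d X Y \<longleftrightarrow> (\<forall>j < d. Y (tmp j) = X (tmp j))"

lemma below_refl [simp]: "below d X X"
  by (simp add: below_def)

lemma below_upd [simp]: "d \<le> d' \<Longrightarrow> below d X (Y(tmp d' := x)) = below d X Y"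
  by (auto simp: below_def)

lemma below_upd' [simp]: "k \<noteq> 1 \<Longrightarrow> k < 16 \<Longrightarrow> below d X (Y(adr k i := x)) = below d X Y"
  by (auto simp: below_def)

lemma below_trans: "below d X Y \<Longrightarrow> below d' Y Z \<Longrightarrow> d \<le> d' \<Longrightarrow> below d X Z"
  by (auto simp: below_def)

lemma nsteps_0 [simp]: "nsteps P C 0 C' \<longleftrightarrow> C = C'"
  by (auto elim: nsteps.cases intro: nsteps_refl)

lemma nsteps_Cons:
  "pc < length P \<Longrightarrow> ram_step (P ! pc) (pc, R) = Some (C', k) \<Longrightarrow>
    nsteps P C' n C'' \<Longrightarrow> nsteps P (pc, R) (Suc n) C''"
  by (auto intro: nsteps_step)

lemma nsteps_compile_adr:
  assumes "code_at P l (compile_adr l d k)"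
  shows "\<exists>t X'. nsteps P (l, X, I, Out) t (l + 8, X', I, Out) \<and> t \<le> 8 \<and>
           (\<forall>M. rep M X \<longrightarrow> rep M X') \<and> below d X X' \<and> X' (tmp d) = int (adr k (nat (X (tmp d))))"
proof -
  define X' where "X' = X(tmp d := int (adr k (nat (X (tmp d)))), tmp (Suc d) := int k)"
  have "\<exists>t \<le> 8. nsteps P (l, X, I, Out) t (l + 8, X', I, Out)"
  proof (cases "X (tmp d) > 0")
    case True
    have "nsteps P (l, X, I, Out) (Suc (Suc (Suc (Suc (Suc (Suc (Suc 0))))))) (l + 8, X', I, Out)"
      using assms True
      
      apply (simp add: compile_adr_def)
      apply (rule nsteps_Cons, simp, simp)+
      apply (simp add: X'_def adr_def[of k] fun_upd_twist[of "tmp (Suc d)" "tmp d"])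
      done
    then show ?thesis by (intro exI[of _ 7]) (simp add: numeral_eq_Suc)
  next
    case False
    have "nsteps P (l, X, I, Out) (Suc (Suc (Suc (Suc (Suc (Suc (Suc (Suc 0)))))))) (l + 8, X', I, Out)"
      using assms False
      
      apply (simp add: compile_adr_def)
      apply (rule nsteps_Cons, simp, simp)+
      apply (simp add: X'_def adr_def[of k] fun_upd_twist[of "tmp (Suc d)" "tmp d"])
      done
    then show ?thesis by (intro exI[of _ 8]) (simp add: numeral_eq_Suc)
  qed
  moreover have "rep M X'" if "rep M X" for M
    using that by (simp add: X'_def)
  moreover have "below d X X'"
    by (simp add: X'_def)
  moreover have "X' (tmp d) = int (adr k (nat (X (tmp d))))"
    by (simp add: X'_def)
  ultimately show ?thesis by blast
qed

fun texp :: "aexp \<Rightarrow> nat" where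
  "texp (Const c) = 1"
| "texp (Var v) = 2"
| "texp (Plus a b) = texp a + texp b + 1"
| "texp (Minus a b) = texp a + texp b + 1"
| "texp (Rd k a) = texp a + 9"

lemma nsteps_1:
  "pc < length P \<Longrightarrow> ram_step (P ! pc) (pc, R) = Some (C', k) \<Longrightarrow> nsteps P (pc, R) (Suc 0) C'"
  by (rule nsteps_Cons) auto

text \<open>The right operand is evaluated at depth \<open>Suc d\<close>, so
  \<open>below (Suc d)\<close> keeps the left value in \<open>tmp d\<close> until the final
  instruction combines the two.\<close>

lemma sim_exp:
  assumes "code_at P l (compile_exp l d e)" "wf_exp e" "rep M X"
  shows "\<exists>t X'. nsteps P (l, X, I, Out) t (l + length (compile_exp l d e), X', I, Out) \<and>
           t \<le> texp e \<and> rep M X' \<and> below d X X' \<and> X' (tmp d) = aval e M"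
  using assms
proof (induction e arbitrary: l d X)
  case (Const c)
  define Y where Y: "Y = X(tmp d := c)"
  have "nsteps P (l, X, I, Out) (Suc 0) (Suc l, Y, I, Out)"
    using Const by (auto intro!: nsteps_1 simp: Y)
  moreover have "rep M Y" "below d X Y" "Y (tmp d) = c"
    using Const by (simp_all add: Y)
  ultimately show ?case
    by (intro exI[of _ "Suc 0"] exI[of _ Y]) auto
next
  case (Var v)
  define Y where Y: "Y = X(tmp d := M 0 v)"
  have "X (adr 0 v) = M 0 v"
    using Var by (simp add: rep_def)
  then have "nsteps P (l, X, I, Out) (Suc (Suc 0)) (Suc (Suc l), Y, I, Out)"
    using Var by (auto intro!: nsteps_Cons simp: Y)
  moreover have "rep M Y" "below d X Y" "Y (tmp d) = M 0 v"
    using Var by (simp_all add: Y)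
  ultimately show ?case
    by (intro exI[of _ "Suc (Suc 0)"] exI[of _ Y]) auto
next
  case (Plus a b)
  let ?is = "compile_exp l d a"
  let ?l = "l + length ?is"
  let ?js = "compile_exp ?l (Suc d) b"
  obtain t X1 where 1: "nsteps P (l, X, I, Out) t (?l, X1, I, Out)"
    "t \<le> texp a" "rep M X1" "below d X X1" "X1 (tmp d) = aval a M"
    using Plus.IH(1)[of l d X] Plus.prems by (auto simp: Let_def)
  obtain u X2 where 2: "nsteps P (?l, X1, I, Out) u (?l + length ?js, X2, I, Out)"
    "u \<le> texp b" "rep M X2" "below (Suc d) X1 X2" "X2 (tmp (Suc d)) = aval b M"
    using Plus.IH(2)[of ?l "Suc d" X1] Plus.prems 1 by (auto simp: Let_def)
  define Y where Y: "Y = X2(tmp d := aval a M + aval b M)"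
  have "X2 (tmp d) = aval a M"
    using 1(5) 2(4) by (simp add: below_def)
  then have "nsteps P (?l + length ?js, X2, I, Out) (Suc 0) (Suc (?l + length ?js), Y, I, Out)"
    using Plus.prems 2(5) by (intro nsteps_1) (auto simp: Let_def add.assoc Y)
  then have "nsteps P (l, X, I, Out) (t + (u + Suc 0)) (Suc (?l + length ?js), Y, I, Out)"
    by (intro nsteps_trans[OF 1(1)] nsteps_trans[OF 2(1)])
  moreover have "rep M Y" "below d X Y" "Y (tmp d) = aval a M + aval b M"
    using below_trans[OF 1(4) 2(4)] 2(3) by (simp_all add: Y)
  ultimately show ?case using 1 2
    by (intro exI[of _ "t + (u + Suc 0)"] exI[of _ Y]) (auto simp: Let_def add.assoc)
next
  case (Minus a b)
  let ?is = "compile_exp l d a"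
  let ?l = "l + length ?is"
  let ?js = "compile_exp ?l (Suc d) b"
  obtain t X1 where 1: "nsteps P (l, X, I, Out) t (?l, X1, I, Out)"
    "t \<le> texp a" "rep M X1" "below d X X1" "X1 (tmp d) = aval a M"
    using Minus.IH(1)[of l d X] Minus.prems by (auto simp: Let_def)
  obtain u X2 where 2: "nsteps P (?l, X1, I, Out) u (?l + length ?js, X2, I, Out)"
    "u \<le> texp b" "rep M X2" "below (Suc d) X1 X2" "X2 (tmp (Suc d)) = aval b M"
    using Minus.IH(2)[of ?l "Suc d" X1] Minus.prems 1 by (auto simp: Let_def)
  define Y where Y: "Y = X2(tmp d := aval a M - aval b M)"
  have "X2 (tmp d) = aval a M"
    using 1(5) 2(4) by (simp add: below_def)
  then have "nsteps P (?l + length ?js, X2, I, Out) (Suc 0) (Suc (?l + length ?js), Y, I, Out)"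
    using Minus.prems 2(5) by (intro nsteps_1) (auto simp: Let_def add.assoc Y)
  then have "nsteps P (l, X, I, Out) (t + (u + Suc 0)) (Suc (?l + length ?js), Y, I, Out)"
    by (intro nsteps_trans[OF 1(1)] nsteps_trans[OF 2(1)])
  moreover have "rep M Y" "below d X Y" "Y (tmp d) = aval a M - aval b M"
    using below_trans[OF 1(4) 2(4)] 2(3) by (simp_all add: Y)
  ultimately show ?case using 1 2
    by (intro exI[of _ "t + (u + Suc 0)"] exI[of _ Y]) (auto simp: Let_def add.assoc)
next
  case (Rd k a)
  let ?is = "compile_exp l d a"
  let ?l = "l + length ?is"
  have len: "length (compile_adr ?l d k) = 8"
    by (simp add: compile_adr_def)
  obtain t X1 where 1: "nsteps P (l, X, I, Out) t (?l, X1, I, Out)"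
    "t \<le> texp a" "rep M X1" "below d X X1" "X1 (tmp d) = aval a M"
    using Rd.IH[of l d X] Rd.prems by (auto simp: Let_def)
  have "code_at P ?l (compile_adr ?l d k)"
    using Rd.prems by (auto simp: Let_def)
  from nsteps_compile_adr[OF this, of X1 I Out]
  obtain u X2 where 2: "nsteps P (?l, X1, I, Out) u (?l + 8, X2, I, Out)" "u \<le> 8"
    "rep M X2" "below d X1 X2" "X2 (tmp d) = int (adr k (nat (aval a M)))"
    using 1 by auto
  define Y where Y: "Y = X2(tmp d := M k (nat (aval a M)))"
  have "X2 (adr k (nat (aval a M))) = M k (nat (aval a M))"
    using 2(3) Rd.prems by (simp add: rep_def)
  then have "nsteps P (?l + 8, X2, I, Out) (Suc 0) (Suc (?l + 8), Y, I, Out)"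
    using Rd.prems 2(5) by (intro nsteps_1) (auto simp: Let_def add.assoc len Y)
  then have "nsteps P (l, X, I, Out) (t + (u + Suc 0)) (Suc (?l + 8), Y, I, Out)"
    by (intro nsteps_trans[OF 1(1)] nsteps_trans[OF 2(1)])
  moreover have "rep M Y" "below d X Y" "Y (tmp d) = M k (nat (aval a M))"
    using below_trans[OF 1(4) 2(4)] 2(3) by (simp_all add: Y)
  ultimately show ?case using 1 2
    by (intro exI[of _ "t + (u + Suc 0)"] exI[of _ Y]) (auto simp: Let_def add_ac len)
qed

text \<open>No command sets \<open>ok\<close> again once it is cleared, so its final value certifies
  all intermediate states. Simulation can therefore assume it at the end only.\<close>

lemma exec_mono_ok: "ok (exec L c s) \<Longrightarrow> ok s"
proof (induction c arbitrary: s)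
  case (Read v)
  then show ?case by (cases "inp s") auto
next
  case (Seq c d)
  from Seq.prems have "ok (exec L d (exec L c s))" by simp
  from Seq.IH(1)[OF Seq.IH(2)[OF this]] show ?case .
next
  case (IfPos e c d)
  show ?case
  proof (cases "aval e (mem s) > 0")
    case True
    with IfPos.prems have "ok (exec L c s)" by (simp only: exec.simps if_True)
    from IfPos.IH(1)[OF this] show ?thesis .
  next
    case False
    with IfPos.prems have "ok (exec L d s)" by (simp only: exec.simps if_False)
    from IfPos.IH(2)[OF this] show ?thesis .
  qed
next
  case (Loop e c)
  have pow: "ok s" if "ok ((exec L c ^^ n) s)" for n s
    using that
  proof (induction n)
    case (Suc n)
    from Suc.prems have "ok (exec L c ((exec L c ^^ n) s))" by simp
    from Suc.IH[OF Loop.IH[OF this]] show ?case .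
  qed simp
  let ?n = "nat (aval e (mem s))"
  from Loop.prems have "ok ((exec L c ^^ ?n) (s\<lparr>ok := (ok s \<and> ?n \<le> L)\<rparr>))"
    by (simp only: exec.simps Let_def)
  from pow[OF this] show ?case by simp
qed simp_all

text \<open>The indeterminate stands for the iteration bound \<open>L\<close>, so the degree grows
  with the nesting depth of loops. The constants 3 at a loop count the entry sequence and the
  decrement with its jump.\<close>

fun tcom :: "com \<Rightarrow> nat poly" where
  "tcom Skip = 0"
| "tcom (Assign v e) = [:texp e + 2:]"
| "tcom (Store k a e) = [:texp a + texp e + 9:]"
| "tcom (Read v) = [:1:]"
| "tcom (Print e) = [:texp e + 1:]"
| "tcom (c ;; d) = tcom c + tcom d"
| "tcom (IfPos e c d) = [:texp e + 3:] + tcom c + tcom d"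
| "tcom (Loop e c) = [:texp e + 3:] + [:0, 1:] * (tcom c + [:3:])"

lemma sim_com:
  assumes "code_at P l (compile l d c)" "wf_com c" "rep (mem s) X" "ok (exec L c s)"
  shows "\<exists>t X'. nsteps P (l, X, inp s, out s) t
             (l + length (compile l d c), X', inp (exec L c s), out (exec L c s)) \<and>
           t \<le> poly (tcom c) L \<and> rep (mem (exec L c s)) X' \<and> below d X X'"
  using assms
proof (induction c arbitrary: l d s X)
  case Skip
  show ?case using Skip by (intro exI[of _ 0] exI[of _ X]) auto
next
  case (Assign v e)
  let ?l = "l + length (compile_exp l d e)"
  obtain t X1 where 1: "nsteps P (l, X, inp s, out s) t (?l, X1, inp s, out s)"
    "t \<le> texp e" "rep (mem s) X1" "below d X X1" "X1 (tmp d) = aval e (mem s)"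
    using sim_exp[of P l d e "mem s" X "inp s" "out s"] Assign by auto
  define Y where Y: "Y = X1(tmp (Suc d) := 0, adr 0 v := aval e (mem s))"
  have "nsteps P (?l, X1, inp s, out s) (Suc (Suc 0)) (Suc (Suc ?l), Y, inp s, out s)"
    using Assign 1(5) by (auto intro!: nsteps_Cons simp: add.assoc Y)
  from nsteps_trans[OF 1(1) this]
  have "nsteps P (l, X, inp s, out s) (t + Suc (Suc 0)) (Suc (Suc ?l), Y, inp s, out s)" .
  moreover have "rep (upd 0 v (aval e (mem s)) (mem s)) Y" "below d X Y"
    using 1(3,4) by (simp_all add: Y)
  ultimately show ?case using 1(2)
    by (intro exI[of _ "t + Suc (Suc 0)"] exI[of _ Y]) auto
next
  case (Store k a e)
  let ?l1 = "l + length (compile_exp l d a)"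
  let ?l2 = "?l1 + 8"
  let ?l3 = "?l2 + length (compile_exp ?l2 (Suc d) e)"
  have len: "length (compile_adr l d k) = 8" for l
    by (simp add: compile_adr_def)
  obtain t X1 where 1: "nsteps P (l, X, inp s, out s) t (?l1, X1, inp s, out s)"
    "t \<le> texp a" "rep (mem s) X1" "below d X X1" "X1 (tmp d) = aval a (mem s)"
    using sim_exp[of P l d a "mem s" X "inp s" "out s"] Store by (auto simp: Let_def)
  have "code_at P ?l1 (compile_adr ?l1 d k)"
    using Store.prems by (auto simp: Let_def)
  from nsteps_compile_adr[OF this, of X1 "inp s" "out s"]
  obtain u X2 where 2: "nsteps P (?l1, X1, inp s, out s) u (?l2, X2, inp s, out s)" "u \<le> 8"
    "rep (mem s) X2" "below d X1 X2" "X2 (tmp d) = int (adr k (nat (aval a (mem s))))"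
    using 1 by auto
  obtain w X3 where 3: "nsteps P (?l2, X2, inp s, out s) w (?l3, X3, inp s, out s)"
    "w \<le> texp e" "rep (mem s) X3" "below (Suc d) X2 X3" "X3 (tmp (Suc d)) = aval e (mem s)"
    using sim_exp[of P ?l2 "Suc d" e "mem s" X2 "inp s" "out s"] Store 2
    by (auto simp: Let_def len add.assoc)
  define Y where Y: "Y = X3(adr k (nat (aval a (mem s))) := aval e (mem s))"
  have "X3 (tmp d) = int (adr k (nat (aval a (mem s))))"
    using 2(5) 3(4) by (simp add: below_def)
  then have "nsteps P (?l3, X3, inp s, out s) (Suc 0) (Suc ?l3, Y, inp s, out s)"
    using Store.prems 3(5) by (intro nsteps_1) (auto simp: Let_def add.assoc len Y)
  then have "nsteps P (l, X, inp s, out s) (t + (u + (w + Suc 0))) (Suc ?l3, Y, inp s, out s)"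
    by (intro nsteps_trans[OF 1(1)] nsteps_trans[OF 2(1)] nsteps_trans[OF 3(1)])
  moreover have "rep (upd k (nat (aval a (mem s))) (aval e (mem s)) (mem s)) Y" "below d X Y"
    using below_trans[OF below_trans[OF 1(4) 2(4)] 3(4)] 3(3) Store.prems by (simp_all add: Y)
  ultimately show ?case using 1(2) 2(2) 3(2)
    by (intro exI[of _ "t + (u + (w + Suc 0))"] exI[of _ Y]) (auto simp: Let_def add_ac len)
next
  case (Read v)
  then obtain x xs where x: "inp s = x # xs"
    by (cases "inp s") auto
  define Y where Y: "Y = X(adr 0 v := x)"
  have "nsteps P (l, X, inp s, out s) (Suc 0) (Suc l, Y, xs, out s)"
    using Read x by (auto intro!: nsteps_1 simp: Y)
  moreover have "rep (upd 0 v x (mem s)) Y" "below d X Y"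
    using Read by (simp_all add: Y)
  ultimately show ?case using x
    by (intro exI[of _ "Suc 0"] exI[of _ Y]) auto
next
  case (Print e)
  let ?l = "l + length (compile_exp l d e)"
  obtain t X1 where 1: "nsteps P (l, X, inp s, out s) t (?l, X1, inp s, out s)"
    "t \<le> texp e" "rep (mem s) X1" "below d X X1" "X1 (tmp d) = aval e (mem s)"
    using sim_exp[of P l d e "mem s" X "inp s" "out s"] Print by auto
  have "nsteps P (?l, X1, inp s, out s) (Suc 0) (Suc ?l, X1, inp s, out s @ [aval e (mem s)])"
    using Print 1(5) by (auto intro!: nsteps_1)
  from nsteps_trans[OF 1(1) this] 1 show ?case
    by (intro exI[of _ "t + Suc 0"] exI[of _ X1]) auto
next
  case (Seq c1 c2)
  let ?l = "l + length (compile l d c1)"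
  let ?s = "exec L c1 s"
  have ok: "ok ?s"
    using Seq.prems by (auto intro: exec_mono_ok[of L c2])
  obtain t X1 where 1: "nsteps P (l, X, inp s, out s) t (?l, X1, inp ?s, out ?s)"
    "t \<le> poly (tcom c1) L" "rep (mem ?s) X1" "below d X X1"
    using Seq.IH(1)[of l d s X] Seq.prems ok by (auto simp: Let_def)
  obtain u X2 where 2: "nsteps P (?l, X1, inp ?s, out ?s) u
      (?l + length (compile ?l d c2), X2, inp (exec L c2 ?s), out (exec L c2 ?s))"
    "u \<le> poly (tcom c2) L" "rep (mem (exec L c2 ?s)) X2" "below d X1 X2"
    using Seq.IH(2)[of ?l d ?s X1] Seq.prems 1 by (auto simp: Let_def)
  from nsteps_trans[OF 1(1) 2(1)] 1 2 below_trans[OF 1(4) 2(4)] show ?case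
    by (intro exI[of _ "t + u"] exI[of _ X2]) (auto simp: Let_def add.assoc)
next
  case (IfPos e c1 c2)
  let ?l = "l + length (compile_exp l d e)"
  let ?l2 = "Suc ?l"
  let ?js = "compile ?l2 d c2"
  let ?l1 = "?l2 + length ?js + 2"
  let ?ks = "compile ?l1 d c1"
  let ?end = "?l1 + length ?ks"
  have endp: "l + length (compile l d (IfPos e c1 c2)) = ?end"
    by (simp add: Let_def)
  obtain t X1 where 1: "nsteps P (l, X, inp s, out s) t (?l, X1, inp s, out s)"
    "t \<le> texp e" "rep (mem s) X1" "below d X X1" "X1 (tmp d) = aval e (mem s)"
    using sim_exp[of P l d e "mem s" X "inp s" "out s"] IfPos by (auto simp: Let_def)
  show ?case
  proof (cases "aval e (mem s) > 0")
    case True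
    let ?s = "exec L c1 s"
    obtain u X2 where 2: "nsteps P (?l1, X1, inp s, out s) u (?end, X2, inp ?s, out ?s)"
      "u \<le> poly (tcom c1) L" "rep (mem ?s) X2" "below d X1 X2"
      using IfPos.IH(1)[of ?l1 d s X1] IfPos.prems 1 True by (auto simp: Let_def)
    have "nsteps P (?l, X1, inp s, out s) (Suc 0) (?l1, X1, inp s, out s)"
      using True 1(5) IfPos.prems by (intro nsteps_1) (auto simp: Let_def)
    then have "nsteps P (l, X, inp s, out s) (t + (Suc 0 + u)) (?end, X2, inp ?s, out ?s)"
      by (intro nsteps_trans[OF 1(1)] nsteps_trans[OF _ 2(1)])
    then show ?thesis using True 1(2) 2(2,3) below_trans[OF 1(4) 2(4)] unfolding endp
      by (intro exI[of _ "t + (Suc 0 + u)"] exI[of _ X2]) auto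
  next
    case False
    let ?s = "exec L c2 s"
    obtain u X2 where 2: "nsteps P (?l2, X1, inp s, out s) u (?l2 + length ?js, X2, inp ?s, out ?s)"
      "u \<le> poly (tcom c2) L" "rep (mem ?s) X2" "below d X1 X2"
      using IfPos.IH(2)[of ?l2 d s X1] IfPos.prems 1 False by (auto simp: Let_def)
    define Y where Y: "Y = X2(tmp d := 1)"
    have "nsteps P (?l, X1, inp s, out s) (Suc 0) (?l2, X1, inp s, out s)"
      using False 1(5) IfPos.prems by (intro nsteps_1) (auto simp: Let_def)
    moreover have "nsteps P (?l2 + length ?js, X2, inp ?s, out ?s) (Suc (Suc 0)) (?end, Y, inp ?s, out ?s)"
      using IfPos.prems by (auto simp: Let_def Y intro!: nsteps_Cons)
    ultimately have "nsteps P (l, X, inp s, out s) (t + (Suc 0 + (u + Suc (Suc 0)))) (?end, Y, inp ?s, out ?s)"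
      by (intro nsteps_trans[OF 1(1)] nsteps_trans[OF _ nsteps_trans[OF 2(1)]])
    moreover have "rep (mem ?s) Y" "below d X Y"
      using below_trans[OF 1(4) 2(4)] 2(3) by (simp_all add: Y)
    ultimately show ?thesis using False 1(2) 2(2) unfolding endp
      by (intro exI[of _ "t + (Suc 0 + (u + Suc (Suc 0)))"] exI[of _ Y]) auto
  qed
next
  case (Loop e c)
  let ?l = "l + length (compile_exp l d e)"
  let ?l1 = "Suc (Suc (Suc ?l))"
  let ?js = "compile ?l1 (Suc d) c"
  let ?e = "?l1 + length ?js"
  let ?end = "Suc (Suc (Suc ?e))"
  have endp: "l + length (compile l d (Loop e c)) = ?end"
    by (simp add: Let_def)
  obtain t X1 where 1: "nsteps P (l, X, inp s, out s) t (?l, X1, inp s, out s)"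
    "t \<le> texp e" "rep (mem s) X1" "below d X X1" "X1 (tmp d) = aval e (mem s)"
    using sim_exp[of P l d e "mem s" X "inp s" "out s"] Loop by (auto simp: Let_def)

  \<comment> \<open>One iteration together with the decrement: control returns to the loop head or
    leaves, depending on the new counter value.\<close>
  have body: "\<exists>t Y. nsteps P (?l1, X, inp s, out s) t
      (if n > 0 then ?l1 else ?end, Y, inp (exec L c s), out (exec L c s)) \<and>
      t \<le> poly (tcom c) L + 3 \<and> rep (mem (exec L c s)) Y \<and> below d X Y \<and> Y (tmp d) = int n"
    if 0: "X (tmp d) = int (Suc n)" "rep (mem s) X" "ok (exec L c s)" for n s X
  proof -
    let ?s = "exec L c s"
    obtain t X1 where 1: "nsteps P (?l1, X, inp s, out s) t (?e, X1, inp ?s, out ?s)"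
      "t \<le> poly (tcom c) L" "rep (mem ?s) X1" "below (Suc d) X X1"
      using Loop.IH[of ?l1 "Suc d" s X] Loop.prems 0 by (auto simp: Let_def add.assoc)
    define Y where Y: "Y = X1(tmp (Suc d) := 1, tmp d := int n)"
    have "X1 (tmp d) = int (Suc n)"
      using 1(4) 0(1) by (simp add: below_def)
    then have "nsteps P (?e, X1, inp ?s, out ?s) (Suc (Suc (Suc 0)))
        (if n > 0 then ?l1 else ?end, Y, inp ?s, out ?s)"
      using Loop.prems by (auto simp: Let_def Y add.assoc intro!: nsteps_Cons)
    from nsteps_trans[OF 1(1) this]
    have "nsteps P (?l1, X, inp s, out s) (t + Suc (Suc (Suc 0)))
        (if n > 0 then ?l1 else ?end, Y, inp ?s, out ?s)" .
    moreover have "rep (mem ?s) Y" "below d X Y" "Y (tmp d) = int n"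
      using below_trans[OF below_refl[of d] 1(4)] 1(3) by (simp_all add: Y)
    ultimately show ?thesis using 1(2)
      by (intro exI[of _ "t + Suc (Suc (Suc 0))"] exI[of _ Y]) auto
  qed
  have ok_pow: "ok s" if "ok ((exec L c ^^ n) s)" for n s
    using that
  proof (induction n)
    case (Suc n)
    from Suc.prems have "ok (exec L c ((exec L c ^^ n) s))" by simp
    from Suc.IH[OF exec_mono_ok[OF this]] show ?case .
  qed simp
  have loop: "\<exists>t Y. nsteps P (?l1, X, inp s, out s) t
        (?end, Y, inp ((exec L c ^^ Suc n) s), out ((exec L c ^^ Suc n) s)) \<and>
      t \<le> Suc n * (poly (tcom c) L + 3) \<and> rep (mem ((exec L c ^^ Suc n) s)) Y \<and> below d X Y"
    if "X (tmp d) = int (Suc n)" "rep (mem s) X" "ok ((exec L c ^^ Suc n) s)" for n s X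
    using that
  proof (induction n arbitrary: s X)
    case 0
    from body[OF 0(1,2)] 0(3) show ?case by auto
  next
    case (Suc n)
    let ?s = "exec L c s"
    have pow: "(exec L c ^^ Suc (Suc n)) s = (exec L c ^^ Suc n) ?s"
      by (simp only: funpow_Suc_right o_apply)
    have "ok ?s"
      using Suc.prems(3) ok_pow[of "Suc n" ?s] unfolding pow by blast
    from body[OF Suc.prems(1,2) this] obtain t Y where 1:
      "nsteps P (?l1, X, inp s, out s) t (?l1, Y, inp ?s, out ?s)"
      "t \<le> poly (tcom c) L + 3" "rep (mem ?s) Y" "below d X Y" "Y (tmp d) = int (Suc n)"
      by auto
    from Suc.IH[OF 1(5,3)] Suc.prems(3)[unfolded pow] obtain u Z where 2:
      "nsteps P (?l1, Y, inp ?s, out ?s) u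
        (?end, Z, inp ((exec L c ^^ Suc n) ?s), out ((exec L c ^^ Suc n) ?s))"
      "u \<le> Suc n * (poly (tcom c) L + 3)" "rep (mem ((exec L c ^^ Suc n) ?s)) Z" "below d Y Z"
      by blast
    have "t + u \<le> Suc (Suc n) * (poly (tcom c) L + 3)"
      using 1(2) 2(2) by simp
    with nsteps_trans[OF 1(1) 2(1)] 2(3) below_trans[OF 1(4) 2(4)] show ?case
      unfolding pow by blast
  qed
  define n where "n = nat (aval e (mem s))"
  define s' where "s' = s\<lparr>ok := (ok s \<and> n \<le> L)\<rparr>"
  have fin: "exec L (Loop e c) s = (exec L c ^^ n) s'"
    by (simp add: n_def s'_def Let_def)
  \<comment> \<open>Entering with more than \<open>L\<close> iterations would have cleared
    \<open>ok\<close> for good.\<close>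
  have "n \<le> L"
    using Loop.prems(4) ok_pow[of n s'] unfolding fin by (simp add: s'_def)
  show ?case
  proof (cases n)
    case 0
    \<comment> \<open>With no iterations the first jump falls through and an unconditional jump
      skips the body; its constant 1 is left in the scratch register.\<close>
    define Y where Y: "Y = X1(tmp (Suc d) := 1)"
    have "\<not> aval e (mem s) > 0"
      using 0 by (simp add: n_def)
    then have "nsteps P (?l, X1, inp s, out s) (Suc (Suc (Suc 0))) (?end, Y, inp s, out s)"
      using Loop.prems 1(5) by (auto simp: Let_def Y add.assoc intro!: nsteps_Cons)
    from nsteps_trans[OF 1(1) this]
    have "nsteps P (l, X, inp s, out s) (t + Suc (Suc (Suc 0))) (?end, Y, inp s, out s)" .
    moreover have "rep (mem s) Y" "below d X Y"
      using 1(3,4) by (simp_all add: Y)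
    ultimately show ?thesis using 1(2) unfolding endp fin 0
      by (intro exI[of _ "t + Suc (Suc (Suc 0))"] exI[of _ Y]) (auto simp: s'_def)
  next
    case (Suc k)
    have pos: "aval e (mem s) = int (Suc k)"
      using Suc by (simp add: n_def)
    have "rep (mem s') X1" "ok ((exec L c ^^ Suc k) s')" "X1 (tmp d) = int (Suc k)"
      using 1(3,5) Loop.prems(4) pos unfolding fin Suc by (simp_all add: s'_def)
    from loop[OF this(3,1,2)] obtain u Y where 2: "nsteps P (?l1, X1, inp s, out s) u
        (?end, Y, inp ((exec L c ^^ n) s'), out ((exec L c ^^ n) s'))"
      "u \<le> Suc k * (poly (tcom c) L + 3)" "rep (mem ((exec L c ^^ n) s')) Y" "below d X1 Y"
      unfolding Suc by (auto simp: s'_def)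
    have "nsteps P (?l, X1, inp s, out s) (Suc 0) (?l1, X1, inp s, out s)"
      using Loop.prems 1(5) pos by (intro nsteps_1) (auto simp: Let_def)
    then have "nsteps P (l, X, inp s, out s) (t + (Suc 0 + u))
        (?end, Y, inp ((exec L c ^^ n) s'), out ((exec L c ^^ n) s'))"
      by (intro nsteps_trans[OF 1(1)] nsteps_trans[OF _ 2(1)])
    moreover have "u \<le> L * (poly (tcom c) L + 3)"
      using 2(2) \<open>n \<le> L\<close> unfolding Suc by (meson le_trans mult_le_mono1)
    moreover have "below d X Y"
      by (rule below_trans[OF 1(4) 2(4)]) simp
    ultimately show ?thesis
      using 1(2) 2(3) unfolding endp fin
      by (intro exI[of _ "t + (Suc 0 + u)"] exI[of _ Y]) auto
  qed
qed

section \<open>From step counts to logarithmic cost\<close>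

lemma bit_length_le_iff:
  assumes "b > 0"
  shows "bit_length z \<le> b \<longleftrightarrow> \<bar>z\<bar> < 2 ^ b"
proof -
  have "bit_length z \<le> b \<longleftrightarrow> floorlog 2 (nat \<bar>z\<bar>) \<le> b"
    using assms by (auto simp: bit_length_def)
  also have "\<dots> \<longleftrightarrow> nat \<bar>z\<bar> < 2 ^ b"
    by (simp add: floorlog_le_iff)
  also have "\<dots> \<longleftrightarrow> \<bar>z\<bar> < 2 ^ b"
    by (metis abs_ge_zero nat_less_numeral_power_cancel_iff)
  finally show ?thesis .
qed

lemma bit_length_pos: "bit_length z > 0"
  by (simp add: bit_length_def)

lemma bit_length_0: "b > 0 \<Longrightarrow> bit_length 0 \<le> b"
  by (simp add: bit_length_le_iff)

lemma bit_length_add: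
  assumes "bit_length x \<le> b" "bit_length y \<le> b"
  shows "bit_length (x + y) \<le> Suc b" "bit_length (x - y) \<le> Suc b"
proof -
  have "b > 0"
    using assms(1) bit_length_pos[of x] by linarith
  then show "bit_length (x + y) \<le> Suc b" "bit_length (x - y) \<le> Suc b"
    using assms by (simp_all add: bit_length_le_iff)
qed

text \<open>Apart from arithmetic and the input, constants of the program are the only source of new
  numbers.\<close>

definition small_instr :: "nat \<Rightarrow> ram_instr \<Rightarrow> bool" where
  "small_instr b i \<longleftrightarrow> (\<forall>j c. i = RConst j c \<longrightarrow> bit_length c \<le> b)"

fun small_conf :: "nat \<Rightarrow> ram_conf \<Rightarrow> bool" where
  "small_conf b (pc, X, I, Out) \<longleftrightarrow> (\<forall>i. bit_length (X i) \<le> b) \<and> (\<forall>x \<in> set I. bit_length x \<le> b)"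

text \<open>An instruction is charged for at most two numbers, hence the factor 2. Only sums and
  differences can lengthen a number, and then by a single bit.\<close>

lemma small_step:
  assumes "ram_step i C = Some (C', k)" "small_instr b i" "small_conf b C"
  shows "k \<le> 2 * b \<and> small_conf (Suc b) C'"
proof -
  obtain pc X I Out where C: "C = (pc, X, I, Out)"
    by (cases C)
  have X: "bit_length (X j) \<le> b" "bit_length (X j) \<le> Suc b" for j
    using assms(3) by (auto simp: C intro: le_SucI)
  have I: "\<forall>x \<in> set I. bit_length x \<le> Suc b"
    using assms(3) by (auto simp: C intro: le_SucI)
  have s: "bit_length (X j + X j') \<le> Suc b" "bit_length (X j - X j') \<le> Suc b" for j j'
    using bit_length_add X by auto
  have t: "bit_length (X j) + bit_length (X j') \<le> 2 * b" for j j'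
    using X(1)[of j] X(1)[of j'] by linarith
  have u: "bit_length (X j) \<le> 2 * b" for j
    using X(1)[of j] by linarith
  show ?thesis
  proof (cases i)
    case (RConst j c)
    then have "bit_length c \<le> b"
      using assms(2) by (auto simp: small_instr_def)
    then show ?thesis
      using assms(1) RConst X I by (auto simp: C)
  next
    case (RRead j)
    then show ?thesis
      using assms(1,3) X I by (cases I) (auto simp: C)
  qed (use assms(1) X I s t u in \<open>auto simp: C split: if_splits\<close>)
qed

text \<open>The bit bound is generalised in the induction because it rises by one with every step;
  over \<open>n\<close> steps it stays within \<open>b + n\<close>.\<close>

lemma nsteps_cost:
  assumes "nsteps P C n C'" "\<forall>i \<in> set P. small_instr b i" "small_conf b C"
  shows "\<exists>t. ram_steps P C t C' \<and> t \<le> n * (2 * (b + n))"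
  using assms
proof (induction arbitrary: b rule: nsteps.induct)
  case (nsteps_refl C)
  show ?case using ram_refl[of P C] by auto
next
  case (nsteps_step C C' k n C'')
  have i: "small_instr b (P ! fst C)"
    using nsteps_step.hyps(1) nsteps_step.prems(1) by simp
  note 1 = small_step[OF nsteps_step.hyps(2) i nsteps_step.prems(2)]
  have "\<forall>i \<in> set P. small_instr (Suc b) i"
    using nsteps_step.prems(1) unfolding small_instr_def by (meson le_SucI)
  from nsteps_step.IH[OF this] 1 obtain t where
    t: "ram_steps P C' t C''" "t \<le> n * (2 * (Suc b + n))"
    by blast
  have "k + t \<le> 2 * b + n * (2 * (Suc b + n))"
    using 1 t(2) by linarith
  also have "\<dots> \<le> Suc n * (2 * (b + Suc n))"
    by (simp add: algebra_simps)
  finally show ?case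
    using ram_trans[OF nsteps_step.hyps(1,2) t(1)] by blast
qed

lemma poly_nat_mono: "poly p x \<le> poly p y" if "x \<le> y" for p :: "nat poly"
  using that by (induction p) (auto intro: add_mono mult_mono)

lemma bit_length_le_input_size: "x \<in> set xs \<Longrightarrow> bit_length x \<le> input_size xs"
  unfolding input_size_def by (induction xs) auto

definition start :: "int list \<Rightarrow> state" where
  "start xs = \<lparr>mem = (\<lambda>_ _. 0), inp = xs, out = [], ok = True\<rparr>"

text \<open>\<open>compile\<close> never sees \<open>L\<close>: one machine program serves all
  inputs, while the iteration bound may be chosen separately for each input.\<close>

theorem ram_computes_com:
  assumes "wf_com c"
  shows "\<exists>P p. \<forall>L xs. ok (exec L c (start xs)) \<longrightarrow>
    (\<exists>t. ram_computes P xs (out (exec L c (start xs))) t \<and> t \<le> poly p (L + input_size xs))"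
proof -
  define P where "P = compile 0 0 c"
  \<comment> \<open>Bounds the length of every constant in the program; the successor keeps it
    positive, since even 0 has bit length 1.\<close>
  define B where "B = Suc (\<Sum>i\<leftarrow>P. case i of RConst j x \<Rightarrow> bit_length x | _ \<Rightarrow> 0)"
  define p where "p = tcom c * (smult 2 ([:B, 1:] + tcom c))"
  have "\<exists>t. ram_computes P xs (out (exec L c (start xs))) t \<and> t \<le> poly p (L + input_size xs)"
    if ok: "ok (exec L c (start xs))" for L xs
  proof -
    let ?s = "exec L c (start xs)"
    let ?n = "L + input_size xs"
    have "code_at P 0 (compile 0 0 c)"
      by (simp add: P_def code_at_def)
    moreover have "rep (mem (start xs)) (\<lambda>_. 0)"
      by (simp add: rep_def start_def)
    ultimately obtain n X where n: "nsteps P (0, \<lambda>_. 0, xs, []) n (length P, X, inp ?s, out ?s)"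
      "n \<le> poly (tcom c) L"
      using sim_com[OF _ assms _ ok, of P 0 0 "\<lambda>_. 0"] by (auto simp: start_def P_def)
    have "small_instr B i" if "i \<in> set P" for i
    proof -
      have "bit_length x \<le> B" if "i = RConst j x" for j x
        using member_le_sum_list[of "bit_length x" "map (\<lambda>i. case i of RConst j x \<Rightarrow> bit_length x | _ \<Rightarrow> 0) P"]
          \<open>i \<in> set P\<close> that unfolding B_def by (force simp: image_iff)
      then show ?thesis by (simp add: small_instr_def)
    qed
    then have "\<forall>i \<in> set P. small_instr (B + ?n) i"
      unfolding small_instr_def by (meson trans_le_add1)
    moreover have "small_conf (B + ?n) (0, \<lambda>_. 0, xs, [])"
      using bit_length_le_input_size[of _ xs] by (force simp: B_def intro: bit_length_0)
    ultimately obtain t where t: "ram_steps P (0, \<lambda>_. 0, xs, []) t (length P, X, inp ?s, out ?s)"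
      "t \<le> n * (2 * (B + ?n + n))"
      using nsteps_cost[OF n(1)] by blast
    have "n \<le> poly (tcom c) ?n"
      using n(2) poly_nat_mono[of L ?n "tcom c"] by simp
    then have "n * (2 * (B + ?n + n)) \<le> poly (tcom c) ?n * (2 * (B + ?n + poly (tcom c) ?n))"
      by (intro mult_mono add_mono) auto
    then have "n * (2 * (B + ?n + n)) \<le> poly p ?n"
      by (simp add: p_def algebra_simps)
    with t show ?thesis
      unfolding ram_computes_def by (intro exI[of _ t]) auto
  qed
  then show ?thesis by blast
qed

section \<open>Maximal weights in a grammar\<close>

text \<open>
  Weights are shifted by one, so that 0 can stand for the absence of a derivation: the empty word
  \<open>e\<close> has value 1, and a rule \<open>x \<rightarrow> y z\<close> of weight \<open>c\<close> combines the values \<open>a\<close>, \<open>b\<close> to \<open>a + b + c - 1\<close>.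
\<close>

type_synonym rule = "nat \<times> nat \<times> nat \<times> int"

inductive der :: "rule set \<Rightarrow> nat \<Rightarrow> nat \<Rightarrow> int \<Rightarrow> bool" for R e where
  der_eps: "der R e e 1"
| der_rule: "(x, y, z, c) \<in> R \<Longrightarrow> der R e y a \<Longrightarrow> der R e z b \<Longrightarrow> der R e x (a + b + c - 1)"

text \<open>Values are read from the old vector \<open>D\<close> and written to \<open>D'\<close>. A
  sweep is thus one simultaneous step, whatever the order of the rules, and every change can be
  blamed on the preceding round.\<close>

fun relax :: "(nat \<Rightarrow> int) \<Rightarrow> rule \<Rightarrow> (nat \<Rightarrow> int) \<Rightarrow> nat \<Rightarrow> int" where
  "relax D (x, y, z, c) D' =
     (if D y > 0 \<and> D z > 0 \<and> D y + D z + c - 1 > D' x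
      then D'(x := D y + D z + c - 1) else D')"

definition kleene :: "rule list \<Rightarrow> (nat \<Rightarrow> int) \<Rightarrow> nat \<Rightarrow> int" where
  "kleene rs D = fold (relax D) rs D"

text \<open>
  With \<open>B\<close> above all finite maxima, adding \<open>B\<close> to every entry that still changes marks it as
  infinite, and the mark spreads to everything that depends on the entry.
\<close>

definition bump :: "int \<Rightarrow> (nat \<Rightarrow> int) \<Rightarrow> (nat \<Rightarrow> int) \<Rightarrow> nat \<Rightarrow> int" where
  "bump B D D' = (\<lambda>x. if D' x > D x then D' x + B else D x)"

definition bump_round :: "rule list \<Rightarrow> int \<Rightarrow> (nat \<Rightarrow> int) \<Rightarrow> nat \<Rightarrow> int" where
  "bump_round rs B D = bump B D (kleene rs D)"

lemma fold_relax_ge: "D' x \<le> fold (relax D) rs D' x"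
proof (induction rs arbitrary: D')
  case (Cons r rs)
  have "D' x \<le> relax D r D' x"
    by (cases r) auto
  also have "\<dots> \<le> fold (relax D) (r # rs) D' x"
    using Cons.IH by simp
  finally show ?case .
qed simp

lemma fold_relax_rule:
  assumes "(x, y, z, c) \<in> set rs" "D y > 0" "D z > 0"
  shows "D y + D z + c - 1 \<le> fold (relax D) rs D' x"
  using assms(1)
proof (induction rs arbitrary: D')
  case (Cons r rs)
  show ?case
  proof (cases "r = (x, y, z, c)")
    case True
    then have "D y + D z + c - 1 \<le> relax D r D' x"
      using assms(2,3) by auto
    also have "\<dots> \<le> fold (relax D) (r # rs) D' x"
      using fold_relax_ge by simp
    finally show ?thesis .
  qed (use Cons in auto)
qed simp

lemma fold_relax_cases:
  "fold (relax D) rs D' x = D' x \<or>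
   (\<exists>y z c. (x, y, z, c) \<in> set rs \<and> D y > 0 \<and> D z > 0 \<and>
      fold (relax D) rs D' x = D y + D z + c - 1)"
proof (induction rs arbitrary: D')
  case (Cons r rs)
  obtain x' y z c where r: "r = (x', y, z, c)"
    by (cases r)
  have "relax D r D' x = D' x \<or> x' = x \<and> D y > 0 \<and> D z > 0 \<and> relax D r D' x = D y + D z + c - 1"
    by (auto simp: r)
  then show ?case
  proof (elim disjE conjE)
    assume "relax D r D' x = D' x"
    with Cons[of "relax D r D'"] show ?thesis
      by (simp del: relax.simps) blast
  next
    assume "x' = x" "D y > 0" "D z > 0" "relax D r D' x = D y + D z + c - 1"
    with Cons[of "relax D r D'"] show ?thesis
      unfolding r by (simp del: relax.simps) blast
  qed
qed simp

lemma kleene_ge: "D x \<le> kleene rs D x"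
  by (simp add: kleene_def fold_relax_ge)

lemma kleene_rule:
  "(x, y, z, c) \<in> set rs \<Longrightarrow> D y > 0 \<Longrightarrow> D z > 0 \<Longrightarrow> D y + D z + c - 1 \<le> kleene rs D x"
  by (simp add: kleene_def fold_relax_rule)

lemma kleene_cases:
  assumes "kleene rs D x > D x"
  obtains y z c where "(x, y, z, c) \<in> set rs" "D y > 0" "D z > 0"
    "kleene rs D x = D y + D z + c - 1"
  using fold_relax_cases[of D rs D x] assms unfolding kleene_def by force

text \<open>With mark 0 a marking round is a plain Kleene round, so the same routine serves both
  phases.\<close>

lemma bump_round_0: "bump_round rs 0 D = kleene rs D"
proof
  fix x
  show "bump_round rs 0 D x = kleene rs D x"
    using kleene_ge[of D x rs] by (simp add: bump_round_def bump_def)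
qed

lemma bump_round_ge: "B \<ge> 0 \<Longrightarrow> D x \<le> bump_round rs B D x"
  by (simp add: bump_round_def bump_def)

locale maxplus_grammar =
  fixes rs :: "rule list" and e n :: nat
  assumes e: "e < n"
    and rules: "\<And>x y z c. (x, y, z, c) \<in> set rs \<Longrightarrow> x < n \<and> y < n \<and> z < n \<and> c \<ge> 0"
begin

abbreviation "derives \<equiv> der (set rs) e"

lemma derives_pos: "derives x v \<Longrightarrow> v > 0"
proof (induction rule: der.induct)
  case (der_rule x y z c a b)
  then show ?case using rules[of x y z c] by simp
qed simp

definition unbounded :: "nat \<Rightarrow> bool" where
  "unbounded x \<longleftrightarrow> (\<forall>b. \<exists>v > b. derives x v)"

text \<open>Abstracts a derivation tree for \<open>x\<close> with one hole at \<open>y\<close>: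
  plugging in a derivation of \<open>y\<close> adds the fixed gain \<open>c\<close>.\<close>

definition ctx :: "nat \<Rightarrow> nat \<Rightarrow> int \<Rightarrow> bool" where
  "ctx y x c \<longleftrightarrow> c \<ge> 0 \<and> (\<forall>v. derives y v \<longrightarrow> derives x (v + c))"

lemma ctx_refl: "ctx x x 0"
  by (simp add: ctx_def)

lemma ctx_trans: "ctx x y c \<Longrightarrow> ctx y z d \<Longrightarrow> ctx x z (c + d)"
  unfolding ctx_def add.assoc[symmetric] by simp

lemma ctx_unbounded:
  assumes "ctx y x c" "unbounded y"
  shows "unbounded x"
  unfolding unbounded_def
proof
  fix b
  obtain v where "v > b" "derives y v"
    using assms(2) unfolding unbounded_def by blast
  then have "v + c > b" "derives x (v + c)"
    using assms(1) by (auto simp: ctx_def)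
  then show "\<exists>v > b. derives x v" by blast
qed

text \<open>Fixing a derivation of one child turns the rule into a context for the other. The gain
  is nonnegative because shifted values are at least 1.\<close>

lemma ctx_rule:
  assumes "(x, y, z, c) \<in> set rs"
  shows "derives z b \<Longrightarrow> ctx y x (b + c - 1)" "derives y a \<Longrightarrow> ctx z x (a + c - 1)"
proof -
  show "ctx y x (b + c - 1)" if "derives z b"
    using rules[OF assms] der_rule[OF assms _ that] derives_pos[OF that]
    by (auto simp: ctx_def algebra_simps)
  show "ctx z x (a + c - 1)" if "derives y a"
    using rules[OF assms] der_rule[OF assms that] derives_pos[OF that]
    by (auto simp: ctx_def algebra_simps)
qed

text \<open>Pumping: the context can be nested in itself any number of times, and each copy gains at
  least 1.\<close>

lemma ctx_self_unbounded:
  assumes "ctx x x c" "c > 0" "derives x v"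
  shows "unbounded x"
proof -
  have "derives x (v + int k * c)" for k
  proof (induction k)
    case (Suc k)
    then have "derives x (v + int k * c + c)"
      using assms(1) by (simp add: ctx_def)
    then show ?case by (simp add: algebra_simps)
  qed (use assms in simp)
  moreover have "v + int (nat (b - v + 1)) * c > b" for b
  proof -
    have "int (nat (b - v + 1)) * 1 \<le> int (nat (b - v + 1)) * c"
      using assms(2) by (intro mult_left_mono) auto
    then show ?thesis by linarith
  qed
  ultimately show ?thesis
    unfolding unbounded_def by blast
qed

section \<open>Kleene iteration and the meaning of late changes\<close>

definition D0 :: "nat \<Rightarrow> int" where
  "D0 = (\<lambda>_. 0)(e := 1)"

text \<open>The best value among derivation trees of height at most \<open>k\<close>, and 0 if there
  is no such tree.\<close>

definition D :: "nat \<Rightarrow> nat \<Rightarrow> int" where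
  "D k = (bump_round rs 0 ^^ k) D0"

lemma D_Suc: "D (Suc k) = kleene rs (D k)"
  by (simp add: D_def bump_round_0)

lemma D_mono: "j \<le> k \<Longrightarrow> D j x \<le> D k x"
  by (rule lift_Suc_mono_le[of "\<lambda>k. D k x"]) (simp add: D_Suc kleene_ge)

lemma D_nonneg: "D k x \<ge> 0"
  using D_mono[of 0 k x] by (simp add: D_def D0_def split: if_splits)

lemma D_sound: "D k x > 0 \<Longrightarrow> derives x (D k x)"
proof (induction k arbitrary: x)
  case 0
  then show ?case by (auto simp: D_def D0_def der_eps split: if_splits)
next
  case (Suc k)
  show ?case
  proof (cases "kleene rs (D k) x > D k x")
    case True
    from kleene_cases[OF this] show ?thesis
      using Suc.IH der_rule unfolding D_Suc by metis
  next
    case False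
    then have "D (Suc k) x = D k x"
      using kleene_ge[of "D k" x rs] by (simp add: D_Suc)
    with Suc show ?thesis by simp
  qed
qed

text \<open>Had neither child of the winning rule improved in the preceding round, the same sum
  would have been available one round earlier. The sibling of the improved child supplies the
  context.\<close>

lemma D_change:
  assumes "D (Suc (Suc k)) x > D (Suc k) x"
  obtains y c where "D (Suc k) y > D k y" "ctx y x c" "D (Suc (Suc k)) x = D (Suc k) y + c"
proof -
  from assms have "kleene rs (D (Suc k)) x > D (Suc k) x"
    by (simp add: D_Suc)
  then obtain y z c where yz: "(x, y, z, c) \<in> set rs" "D (Suc k) y > 0" "D (Suc k) z > 0"
    "D (Suc (Suc k)) x = D (Suc k) y + D (Suc k) z + c - 1"
    by (metis D_Suc kleene_cases)
  show thesis
  proof (cases "D (Suc k) y > D k y")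
    case True
    then show thesis
      using that[OF True ctx_rule(1)[OF yz(1) D_sound[OF yz(3)]]] yz(4) by simp
  next
    case y: False
    show thesis
    proof (cases "D (Suc k) z > D k z")
      case True
      then show thesis
        using that[OF True ctx_rule(2)[OF yz(1) D_sound[OF yz(2)]]] yz(4) by simp
    next
      case z: False
      have "D (Suc k) y = D k y" "D (Suc k) z = D k z"
        using y z D_mono[of k "Suc k" y] D_mono[of k "Suc k" z] by auto
      then have "D (Suc (Suc k)) x \<le> D (Suc k) x"
        using yz kleene_rule[OF yz(1), of "D k"] by (simp add: D_Suc[of k])
      with assms show thesis by simp
    qed
  qed
qed

text \<open>A change in round \<open>k\<close> is caused by a change in every earlier round.\<close>

lemma D_chain:
  assumes "D (Suc k) x > D k x"
  shows "\<exists>f. f k = x \<and> (\<forall>i \<le> k. D (Suc i) (f i) > D i (f i)) \<and>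
    (\<forall>i j. i \<le> j \<longrightarrow> j \<le> k \<longrightarrow> ctx (f i) (f j) (D (Suc j) (f j) - D (Suc i) (f i)))"
  using assms
proof (induction k arbitrary: x)
  case 0
  then show ?case by (intro exI[of _ "\<lambda>_. x"]) (simp add: ctx_refl)
next
  case (Suc k)
  from D_change[OF Suc.prems] obtain y c where y: "D (Suc k) y > D k y" "ctx y x c"
    "D (Suc (Suc k)) x = D (Suc k) y + c" .
  from Suc.IH[OF y(1)] obtain f where f: "f k = y" "\<forall>i \<le> k. D (Suc i) (f i) > D i (f i)"
    "\<forall>i j. i \<le> j \<longrightarrow> j \<le> k \<longrightarrow> ctx (f i) (f j) (D (Suc j) (f j) - D (Suc i) (f i))"
    by blast
  define g where "g = f(Suc k := x)"
  have g: "g i = f i" if "i \<le> k" for i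
    using that by (simp add: g_def)
  have "ctx (g i) (g j) (D (Suc j) (g j) - D (Suc i) (g i))" if "i \<le> j" "j \<le> Suc k" for i j
  proof (cases "j = Suc k")
    case True
    show ?thesis
    proof (cases "i = Suc k")
      case True
      with \<open>j = Suc k\<close> show ?thesis by (simp add: ctx_refl)
    next
      case False
      then have "i \<le> k" using that by simp
      then have "ctx (f i) y (D (Suc k) y - D (Suc i) (f i))"
        using f(1,3) by force
      from ctx_trans[OF this y(2)] show ?thesis
        using g[OF \<open>i \<le> k\<close>] y(3) True by (simp add: g_def algebra_simps)
    qed
  next
    case False
    then show ?thesis using f(3) that g by simp
  qed
  moreover have "g (Suc k) = x" "\<forall>i \<le> Suc k. D (Suc i) (g i) > D i (g i)"
    using f(2) Suc.prems by (auto simp: g_def le_Suc_eq)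
  ultimately show ?case by blast
qed

lemma kleene_outside: "x \<ge> n \<Longrightarrow> \<not> kleene rs D' x > D' x"
  by (metis kleene_cases linorder_not_less rules)

text \<open>The chain lists \<open>k + 1 > n\<close> changing nonterminals, so one occurs in two
  different rounds. The context between its occurrences can be pumped, and the rest of the chain
  carries unboundedness up to \<open>x\<close>.\<close>

lemma D_change_unbounded:
  assumes "D (Suc k) x > D k x" "k \<ge> n"
  shows "unbounded x"
proof -
  from D_chain[OF assms(1)] obtain f where f: "f k = x" "\<And>i. i \<le> k \<Longrightarrow> D (Suc i) (f i) > D i (f i)"
    "\<And>i j. i \<le> j \<Longrightarrow> j \<le> k \<Longrightarrow> ctx (f i) (f j) (D (Suc j) (f j) - D (Suc i) (f i))"
    by blast
  have "f i < n" if "i \<le> k" for i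
  proof (rule ccontr)
    assume "\<not> f i < n"
    then show False
      using f(2)[OF that] kleene_outside[of "f i" "D i"] by (simp add: D_Suc)
  qed
  then have "f ` {..k} \<subseteq> {..<n}"
    by auto
  then have "card (f ` {..k}) < card {..k}"
    using card_mono[of "{..<n}" "f ` {..k}"] assms(2) by simp
  then have "\<not> inj_on f {..k}"
    using card_image by fastforce
  then obtain i j where ij: "i < j" "j \<le> k" "f i = f j"
    unfolding inj_on_def by (metis atMost_iff linorder_neqE_nat)
  \<comment> \<open>The later occurrence improves strictly in its own round, over a value that
    already includes the earlier improvement; hence the loop has positive gain.\<close>
  have "D (Suc i) (f i) \<le> D j (f j)"
    using D_mono[of "Suc i" j] ij by simp
  then have gain: "D (Suc j) (f j) - D (Suc i) (f i) > 0"
    using f(2)[OF ij(2)] by linarith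
  have "D (Suc i) (f i) > 0"
    using f(2)[of i] ij D_nonneg[of i "f i"] by simp
  then have "unbounded (f i)"
    using ctx_self_unbounded[OF _ gain] D_sound f(3)[of i j] ij by auto
  then show ?thesis
    using ctx_unbounded[OF f(3)[of i k]] ij f(1) by simp
qed

section \<open>Marking the infinite maxima\<close>

definition B :: int where
  "B = 1 + (\<Sum>x<n. D n x)"

definition D' :: "nat \<Rightarrow> nat \<Rightarrow> int" where
  "D' k = (bump_round rs B ^^ k) (D n)"

text \<open>The entries are nonnegative, so their sum dominates each of them. Indices from
  \<open>n\<close> on head no rule and keep the value 0.\<close>

lemma D_less_B: "D n x < B"
proof (cases "x < n")
  case True
  then have "D n x \<le> (\<Sum>x<n. D n x)"
    by (intro member_le_sum) (auto simp: D_nonneg)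
  then show ?thesis by (simp add: B_def)
next
  case False
  have "D k x = 0" for k
  proof (induction k)
    case 0
    then show ?case using e False by (auto simp: D_def D0_def)
  next
    case (Suc k)
    then show ?case
      using kleene_outside[of x "D k"] False kleene_ge[of "D k" x rs] by (simp add: D_Suc)
  qed
  moreover have "(\<Sum>x<n. D n x) \<ge> 0"
    by (intro sum_nonneg D_nonneg)
  ultimately show ?thesis by (simp add: B_def)
qed

lemma B_pos: "B > 0"
  using D_less_B[of e] D_nonneg[of n e] by simp

lemma D'_Suc: "D' (Suc k) = bump B (D' k) (kleene rs (D' k))"
  by (simp add: D'_def bump_round_def)

lemma D'_mono: "j \<le> k \<Longrightarrow> D' j x \<le> D' k x"
  by (rule lift_Suc_mono_le[of "\<lambda>k. D' k x"]) (simp_all add: D'_def bump_round_ge B_pos less_imp_le)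

lemma D'_nonneg: "D' k x \<ge> 0"
  using D'_mono[of 0 k x] D_nonneg[of n x] by (simp add: D'_def)

text \<open>When an entry rises, either a child is unbounded and passes this on through a context,
  or both children still have their values from round \<open>n\<close>. In the second case the rise
  already shows in Kleene round \<open>Suc n\<close>, so the entry is unbounded by
  \<open>D_change_unbounded\<close>.\<close>

lemma D'_sound: "D' k x \<ge> B \<and> unbounded x \<or> D' k x = D n x"
proof (induction k arbitrary: x)
  case 0
  then show ?case by (simp add: D'_def)
next
  case (Suc k)
  show ?case
  proof (cases "kleene rs (D' k) x > D' k x")
    case True
    then obtain y z c where yz: "(x, y, z, c) \<in> set rs" "D' k y > 0" "D' k z > 0"
      "kleene rs (D' k) x = D' k y + D' k z + c - 1"
      by (rule kleene_cases)
    have der: "\<exists>v. derives w v" if "D' k w > 0" for w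
      using Suc.IH[of w] D_sound[of n w] that by (auto simp: unbounded_def)
    have "unbounded x"
    proof (cases "unbounded y \<or> unbounded z")
      case True
      then show ?thesis
        using der[OF yz(2)] der[OF yz(3)] ctx_rule[OF yz(1)] ctx_unbounded by blast
    next
      case False
      then have eq: "D' k y = D n y" "D' k z = D n z"
        using Suc.IH by auto
      have "D n x \<le> D' k x"
        using D'_mono[of 0 k x] by (simp add: D'_def)
      also have "\<dots> < D n y + D n z + c - 1"
        using True yz(4) eq by simp
      also have "\<dots> \<le> D (Suc n) x"
        using kleene_rule[OF yz(1), of "D n"] yz(2,3) eq by (simp add: D_Suc)
      finally show ?thesis
        by (rule D_change_unbounded) simp
    qed
    then show ?thesis
      using True D'_nonneg[of k x] by (simp add: D'_Suc bump_def)
  next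
    case False
    then show ?thesis
      using Suc.IH[of x] by (simp add: D'_Suc bump_def)
  qed
qed

text \<open>Once the set of marked entries stops growing, the unmarked ones are stable under all
  rules. Induction on derivations then shows that their values bound everything derivable.\<close>

lemma D'_complete:
  assumes "D' (Suc n) x < B" "derives x v"
  shows "0 < D' (Suc n) x \<and> v \<le> D' (Suc n) x"
proof -
  define K where "K k = {x. D' k x \<ge> B}" for k
  have K_less: "x < n" if "x \<in> K k" for x k
  proof (rule ccontr)
    assume "\<not> x < n"
    then have "D' k x = D n x" for k
    proof (induction k)
      case (Suc k)
      then show ?case
        using kleene_outside[of x "D' k"] by (simp add: D'_Suc bump_def)
    qed (simp add: D'_def)
    then show False
      using that D_less_B[of x] by (simp add: K_def)
  qed
  have K_mono: "K k \<subseteq> K (Suc k)" for k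
    using D'_mono[of k "Suc k"] unfolding K_def by (auto intro: order_trans)
  \<comment> \<open>A strictly growing set of marks would gain at least one of the \<open>n\<close>
    nonterminals in each of \<open>n + 1\<close> rounds. This is why \<open>Suc n\<close> marking
    rounds are run.\<close>
  have "\<exists>k \<le> n. K k = K (Suc k)"
  proof (rule ccontr)
    assume "\<not> ?thesis"
    then have strict: "K k \<subset> K (Suc k)" if "k \<le> n" for k
      using K_mono[of k] that by auto
    have fin: "finite (K k)" for k
      using K_less by (intro finite_subset[of "K k" "{..<n}"]) auto
    have "k \<le> card (K k)" if "k \<le> Suc n" for k
      using that
    proof (induction k)
      case (Suc k)
      then show ?case
        using psubset_card_mono[OF fin strict[of k]] by simp
    qed simp
    moreover have "card (K (Suc n)) \<le> n"
      using card_mono[of "{..<n}" "K (Suc n)"] K_less by auto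
    ultimately show False by (metis le_refl not_less_eq_eq)
  qed
  then obtain k where k: "k \<le> n" "K k = K (Suc k)"
    by blast
  have stable: "kleene rs (D' k) w = D' k w" if "w \<notin> K k" for w
  proof (rule ccontr)
    assume "\<not> ?thesis"
    then have "kleene rs (D' k) w > D' k w"
      using kleene_ge[of "D' k" w rs] by simp
    then have "D' (Suc k) w \<ge> B"
      using D'_nonneg[of k w] by (simp add: D'_Suc bump_def)
    then have "w \<in> K (Suc k)"
      by (simp add: K_def)
    with that k(2) show False by simp
  qed
  have main: "D' k w > 0 \<and> (w \<notin> K k \<longrightarrow> a \<le> D' k w)" if "derives w a" for w a
    using that
  proof (induction rule: der.induct)
    case der_eps
    have "1 \<le> D' k e"
      using D'_mono[of 0 k e] D_mono[of 0 n e] by (simp add: D'_def D_def D0_def)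
    then show ?case by auto
  next
    case (der_rule w y z c a b)
    show ?case
    proof (cases "w \<in> K k")
      case True
      then show ?thesis using B_pos by (auto simp: K_def)
    next
      case False
      have le: "D' k y + D' k z + c - 1 \<le> D' k w"
        using kleene_rule[OF der_rule.hyps(1), of "D' k"] der_rule.IH stable[OF False] by simp
      have "c \<ge> 0"
        using rules[OF der_rule.hyps(1)] by simp
      \<comment> \<open>A marked child would lift the parent to at least \<open>B\<close>, because
        its sibling contributes at least 1 and the weight is nonnegative.\<close>
      then have "y \<notin> K k" "z \<notin> K k"
        using le False der_rule.IH by (auto simp: K_def)
      then show ?thesis
        using le \<open>c \<ge> 0\<close> der_rule.IH by auto
    qed
  qed
  have "x \<notin> K k"
    using assms(1) D'_mono[of k "Suc n" x] k(1) by (auto simp: K_def)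
  with main[OF assms(2)] D'_mono[of k "Suc n" x] k(1) show ?thesis by auto
qed

theorem maxplus:
  defines "F \<equiv> (bump_round rs B ^^ Suc n) ((bump_round rs 0 ^^ n) D0)"
  shows "F x \<ge> 0"
    and "F x = 0 \<Longrightarrow> \<not> derives x v"
    and "0 < F x \<Longrightarrow> F x < B \<Longrightarrow> derives x (F x)"
    and "F x < B \<Longrightarrow> derives x v \<Longrightarrow> v \<le> F x"
    and "F x \<ge> B \<Longrightarrow> \<exists>v > b. derives x v"
proof -
  have F: "F = D' (Suc n)"
    by (simp only: F_def D'_def D_def)
  show "F x \<ge> 0"
    by (simp add: F D'_nonneg)
  show "F x = 0 \<Longrightarrow> \<not> derives x v"
    using D'_complete[of x v] B_pos by (auto simp: F)
  show "0 < F x \<Longrightarrow> F x < B \<Longrightarrow> derives x (F x)"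
    using D'_sound[of "Suc n" x] D_sound[of n x] by (auto simp: F)
  show "F x < B \<Longrightarrow> derives x v \<Longrightarrow> v \<le> F x"
    using D'_complete[of x v] by (simp add: F)
  show "F x \<ge> B \<Longrightarrow> \<exists>v > b. derives x v"
    using D'_sound[of "Suc n" x] D_less_B[of x] by (auto simp: F unbounded_def)
qed

end

section \<open>Tracking signs\<close>

text \<open>
  Mode 0: only zero updates so far; 1: some positive and no negative one; 2: the last nonzero
  update was negative; 3: some negative update, the last nonzero one positive.
  A first nonzero update that is negative cannot be executed.
\<close>

definition modes :: "int \<Rightarrow> (nat \<times> nat) list" where
  "modes z =
     (if z > 0 then [(0, 1), (1, 1), (2, 3), (3, 3)]
      else if z < 0 then [(1, 2), (2, 2), (3, 2)]
      else [(0, 0), (1, 1), (2, 2), (3, 3)])"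

definition vals :: "nat \<Rightarrow> int \<Rightarrow> real set" where
  "vals i S =
     (if i = 0 then {0} else if i = 1 then {0<..of_int S}
      else if i = 2 then {0..<of_int S} else {0<..<of_int S})"

definition mode_ok :: "nat \<Rightarrow> int \<Rightarrow> bool" where
  "mode_ok i S \<longleftrightarrow> i < 4 \<and> (if i = 0 then S = 0 else S > 0)"

lemma mode_ok_step:
  "mode_ok i S \<Longrightarrow> (i, j) \<in> set (modes z) \<Longrightarrow> mode_ok j (S + max z 0)"
  by (auto simp: mode_ok_def modes_def split: if_splits)

lemma less_4_cases: "(i::nat) < 4 \<Longrightarrow> i = 0 \<or> i = 1 \<or> i = 2 \<or> i = 3"
  by auto

text \<open>In mode 0 the counter is 0, so a decrease is ruled out by the assumption that the new
  value is nonnegative; accordingly \<open>modes\<close> has no pair \<open>(0, 2)\<close>. A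
  decrease from any other mode makes the upper end unattainable, as some positive amount is
  lost.\<close>

lemma vals_forward:
  assumes "mode_ok i S" "c \<in> vals i S" "0 < \<gamma>" "\<gamma> \<le> 1" "c + \<gamma> * of_int z \<ge> 0"
  shows "\<exists>j. (i, j) \<in> set (modes z) \<and> c + \<gamma> * of_int z \<in> vals j (S + max z 0)"
proof -
  have i: "i = 0 \<or> i = 1 \<or> i = 2 \<or> i = 3"
    using assms(1) by (intro less_4_cases) (simp add: mode_ok_def)
  consider "z > 0" | "z < 0" | "z = 0" by linarith
  then show ?thesis
  proof cases
    case 1
    define d where "d = \<gamma> * of_int z"
    have "0 < d" "d \<le> of_int z"
      using 1 assms(3,4) by (simp_all add: d_def)
    then show ?thesis
      using i assms(1,2) 1 unfolding d_def[symmetric]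
      by (intro exI[of _ "if i \<le> 1 then 1 else 3"]) (auto simp: modes_def vals_def mode_ok_def)
  next
    case 2
    have "\<gamma> * of_int z < 0"
      using 2 assms(3) by (simp add: mult_pos_neg)
    then show ?thesis
      using i assms(1,2,5) 2
      by (intro exI[of _ 2]) (auto simp: modes_def vals_def mode_ok_def)
  next
    case 3
    then show ?thesis
      using i assms(2) by (auto simp: modes_def)
  qed
qed

text \<open>Every value promised by the mode is realised by choosing the last factor; its
  predecessor has to lie in the value set of the shorter path.\<close>

lemma vals_backward:
  assumes "mode_ok i S" "(i, j) \<in> set (modes z)" "c' \<in> vals j (S + max z 0)"
  shows "\<exists>c \<gamma>. c \<in> vals i S \<and> 0 < \<gamma> \<and> \<gamma> \<le> 1 \<and> c' = c + \<gamma> * of_int z"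
proof -
  consider "z > 0" | "z < 0" | "z = 0" by linarith
  then show ?thesis
  proof cases
    case 1
    \<comment> \<open>The target is split in the proportion of \<open>S\<close> to \<open>z\<close>:
      the last update and the predecessor are scaled by the same factor. From modes 2 and 3 the
      target stays below \<open>S + z\<close>, so the factor is below 1 and the predecessor below
      \<open>S\<close>.\<close>
    define \<gamma> where "\<gamma> = c' / of_int (S + z)"
    have S: "S \<ge> 0"
      using assms(1) by (auto simp: mode_ok_def split: if_splits)
    then have pos: "of_int (S + z) > (0::real)"
      using 1 by (simp only: of_int_0_less_iff)
    have "\<gamma> * of_int (S + z) = c'"
      using pos by (simp add: \<gamma>_def del: of_int_add)
    then have c': "c' = \<gamma> * of_int S + \<gamma> * of_int z"
      by (simp add: distrib_left)
    have c'_pos: "c' > 0" "c' \<le> of_int (S + z)"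
      using assms(2,3) 1 by (auto simp: modes_def vals_def split: if_splits)
    then have \<gamma>: "0 < \<gamma>" "\<gamma> \<le> 1"
      using pos by (simp_all add: \<gamma>_def)
    have lt: "\<gamma> < 1" if "i = 2 \<or> i = 3"
      using assms(2,3) 1 pos that by (auto simp: modes_def vals_def \<gamma>_def split: if_splits)
    have le: "\<gamma> * of_int S \<le> of_int S"
      using mult_right_mono[OF \<gamma>(2), of "of_int S"] S by simp
    have less: "\<gamma> * of_int S < of_int S" if "i = 2 \<or> i = 3"
    proof -
      have "S > 0" using assms(1) that by (auto simp: mode_ok_def)
      then show ?thesis using lt[OF that] by simp
    qed
    have "\<gamma> * of_int S \<in> vals i S"
      using assms(1) le less \<gamma> by (auto simp: vals_def mode_ok_def)
    with c' \<gamma> show ?thesis by blast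
  next
    case 2
    \<comment> \<open>The midpoint between the target and the smaller of two upper limits:
      \<open>S\<close>, imposed by the mode, and \<open>c' - z\<close>, which keeps the factor at
      most 1.\<close>
    define c where "c = (c' + min (of_int S) (c' - of_int z)) / 2"
    define \<gamma> where "\<gamma> = (c' - c) / of_int z"
    have i: "i \<noteq> 0" "j = 2"
      using assms(2) 2 by (auto simp: modes_def)
    have c': "0 \<le> c'" "c' < of_int S"
      using assms(3) 2 i by (auto simp: vals_def)
    have zr: "(of_int z :: real) < 0"
      using 2 by simp
    have c: "c' < c" "c < of_int S" "c \<le> c' - of_int z"
      using c' zr by (auto simp: c_def min_def)
    have "\<gamma> > 0"
      using c(1) zr by (simp add: \<gamma>_def divide_neg_neg)
    moreover have "\<gamma> \<le> 1"
      using c(3) zr by (simp add: \<gamma>_def divide_le_eq)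
    moreover have "c' = c + \<gamma> * of_int z"
      using zr by (simp add: \<gamma>_def)
    moreover have "c \<in> vals i S"
      using c c' i by (auto simp: vals_def)
    ultimately show ?thesis by blast
  next
    case 3
    then have "i = j"
      using assms(2) by (auto simp: modes_def)
    then show ?thesis
      using assms(3) 3 by (intro exI[of _ c'] exI[of _ 1]) auto
  qed
qed

lemma vals_nonneg: "c \<in> vals i S \<Longrightarrow> c \<ge> 0"
  by (auto simp: vals_def split: if_splits)

text \<open>Symbolic runs replace the real counter by a mode and the sum of positive updates.
  Nonnegativity of the counter survives only as the missing pair in \<open>modes\<close>.\<close>

inductive sym_reach :: "('s, 'g) c1pvass \<Rightarrow> 's \<Rightarrow> 'g list \<Rightarrow> nat \<Rightarrow> int \<Rightarrow> bool" for A where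
  sym_init: "sym_reach A (init_state A) [stack_bottom A] 0 0"
| sym_step: "sym_reach A s \<alpha> i S \<Longrightarrow> trans A (s, s') = Some (z, stop) \<Longrightarrow>
    stack_step stop \<alpha> \<beta> \<Longrightarrow> (i, j) \<in> set (modes z) \<Longrightarrow> sym_reach A s' \<beta> j (S + max z 0)"

lemma sym_reach_mode_ok: "sym_reach A s \<alpha> i S \<Longrightarrow> mode_ok i S"
proof (induction rule: sym_reach.induct)
  case sym_init
  show ?case by (simp add: mode_ok_def)
qed (rule mode_ok_step)

lemma stack_step_alphabet:
  assumes "is_c1pvass A" "trans A (s, s') = Some (z, stop)" "stack_step stop \<alpha> \<beta>"
    and "\<alpha> \<in> lists (alphabet A)"
  shows "s \<in> states A" "s' \<in> states A" "\<beta> \<in> lists (alphabet A)"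
proof -
  have "(s, s') \<in> dom (trans A)" "(z, stop) \<in> ran (trans A)"
    using assms(2) by (auto simp: ran_def)
  then have "(s, s') \<in> states A \<times> states A" "stop \<in> stack_ops A"
    using assms(1) unfolding is_c1pvass_def by blast+
  then show "s \<in> states A" "s' \<in> states A" "\<beta> \<in> lists (alphabet A)"
    using assms(3,4) by (auto simp: stack_ops_def Let_def)
qed

lemma run_snoc:
  assumes "\<rho> \<noteq> []"
  shows "is_run A (\<rho> @ [C]) \<longleftrightarrow> is_run A \<rho> \<and> C \<in> confs A \<and> conf_step A (last \<rho>) C"
  using assms by (auto simp: is_run_def successively_append_iff)

lemma run_sym_reach:
  assumes "is_run A \<rho>" "last \<rho> = (s, \<alpha>, c)"
  shows "\<exists>i S. sym_reach A s \<alpha> i S \<and> c \<in> vals i S"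
  using assms
proof (induction \<rho> arbitrary: s \<alpha> c rule: rev_induct)
  case Nil
  then show ?case by (simp add: is_run_def)
next
  case (snoc C \<rho>)
  show ?case
  proof (cases "\<rho> = []")
    case True
    then have "(s, \<alpha>, c) = init_conf A"
      using snoc.prems by (simp add: is_run_def)
    then have "sym_reach A s \<alpha> 0 0" "c \<in> vals 0 0"
      by (auto simp: init_conf_def vals_def intro: sym_init)
    then show ?thesis by blast
  next
    case False
    obtain s0 \<alpha>0 c0 where C0: "last \<rho> = (s0, \<alpha>0, c0)"
      by (cases "last \<rho>")
    have C: "C = (s, \<alpha>, c)"
      using snoc.prems by simp
    have run: "is_run A \<rho>" "c \<ge> 0" "conf_step A (s0, \<alpha>0, c0) (s, \<alpha>, c)"
      using snoc.prems(1) False by (auto simp: run_snoc C C0 confs_def)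
    obtain i S where iS: "sym_reach A s0 \<alpha>0 i S" "c0 \<in> vals i S"
      using snoc.IH[OF run(1) C0] by blast
    from run(3) obtain z stop \<gamma> where st: "trans A (s0, s) = Some (z, stop)"
      "stack_step stop \<alpha>0 \<alpha>" "0 < \<gamma>" "\<gamma> \<le> 1" "c = c0 + \<gamma> * of_int z"
      by auto
    from vals_forward[OF sym_reach_mode_ok[OF iS(1)] iS(2) st(3,4)] run(2) st(5)
    obtain j where "(i, j) \<in> set (modes z)" "c \<in> vals j (S + max z 0)"
      by auto
    with sym_step[OF iS(1) st(1,2)] show ?thesis by blast
  qed
qed

lemma sym_reach_run:
  assumes "is_c1pvass A" "sym_reach A s \<alpha> i S" "c \<in> vals i S"
  shows "\<exists>\<rho>. is_run A \<rho> \<and> last \<rho> = (s, \<alpha>, c)"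
  using assms(2,3)
proof (induction arbitrary: c rule: sym_reach.induct)
  case sym_init
  then have "is_run A [init_conf A]" "last [init_conf A] = (init_state A, [stack_bottom A], c)"
    using assms(1) by (auto simp: is_run_def init_conf_def confs_def is_c1pvass_def vals_def)
  then show ?case by blast
next
  case (sym_step s \<alpha> i S s' z stop \<beta> j)
  from vals_backward[OF sym_reach_mode_ok[OF sym_step.hyps(1)] sym_step.hyps(4) sym_step.prems]
  obtain c0 \<gamma> where c0: "c0 \<in> vals i S" "0 < \<gamma>" "\<gamma> \<le> 1" "c = c0 + \<gamma> * of_int z"
    by blast
  from sym_step.IH[OF c0(1)] obtain \<rho> where \<rho>: "is_run A \<rho>" "last \<rho> = (s, \<alpha>, c0)"
    by blast
  have "\<rho> \<noteq> []" "last \<rho> \<in> confs A"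
    using \<rho>(1) by (auto simp: is_run_def)
  then have "\<alpha> \<in> lists (alphabet A)"
    using \<rho>(2) by (simp add: confs_def)
  from stack_step_alphabet[OF assms(1) sym_step.hyps(2,3) this] vals_nonneg[OF sym_step.prems]
  have "(s', \<beta>, c) \<in> confs A"
    by (simp add: confs_def)
  moreover have "conf_step A (last \<rho>) (s', \<beta>, c)"
    using sym_step.hyps(2,3) c0 \<rho>(2) by auto
  ultimately have "is_run A (\<rho> @ [(s', \<beta>, c)])"
    using \<rho>(1) \<open>\<rho> \<noteq> []\<close> by (simp add: run_snoc)
  then show ?case by (intro exI[of _ "\<rho> @ [(s', \<beta>, c)]"]) simp
qed

lemma reach_values_sym:
  assumes "is_c1pvass A"
  shows "reach_values A = {c. \<exists>\<alpha> i S. sym_reach A (acc_state A) \<alpha> i S \<and> c \<in> vals i S}"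
proof -
  have "c \<in> reach_values A \<longleftrightarrow> (\<exists>\<alpha> i S. sym_reach A (acc_state A) \<alpha> i S \<and> c \<in> vals i S)" for c
  proof
    assume "c \<in> reach_values A"
    then obtain \<rho> \<alpha> where "is_run A \<rho>" "last \<rho> = (acc_state A, \<alpha>, c)"
      unfolding reach_values_def reaching_run_def by blast
    from run_sym_reach[OF this] show "\<exists>\<alpha> i S. sym_reach A (acc_state A) \<alpha> i S \<and> c \<in> vals i S"
      by blast
  next
    assume "\<exists>\<alpha> i S. sym_reach A (acc_state A) \<alpha> i S \<and> c \<in> vals i S"
    then obtain \<alpha> i S where *: "sym_reach A (acc_state A) \<alpha> i S" "c \<in> vals i S"
      by blast
    from sym_reach_run[OF assms *] vals_nonneg[OF *(2)] show "c \<in> reach_values A"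
      unfolding reach_values_def reaching_run_def by blast
  qed
  then show ?thesis by blast
qed

section \<open>Eliminating the stack\<close>

definition edge :: "('s, 'g) c1pvass \<Rightarrow> 's \<times> nat \<Rightarrow> 's \<times> nat \<Rightarrow> int \<Rightarrow> 'g stack_op \<Rightarrow> bool" where
  "edge A p q w stop \<longleftrightarrow> (\<exists>z. trans A (fst p, fst q) = Some (z, stop) \<and>
     (snd p, snd q) \<in> set (modes z) \<and> w = max z 0)"

definition pstates :: "('s, 'g) c1pvass \<Rightarrow> ('s \<times> nat) set" where
  "pstates A = states A \<times> {..<4}"

text \<open>
  \<open>flow A (Some p) q w\<close>: from \<open>p\<close> to \<open>q\<close> with balanced stack operations and total positive
  updates \<open>w\<close>; \<open>flow A None q w\<close>: from the initial state to \<open>q\<close>, possibly leaving symbols on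
  the stack.
\<close>

inductive flow :: "('s, 'g) c1pvass \<Rightarrow> ('s \<times> nat) option \<Rightarrow> 's \<times> nat \<Rightarrow> int \<Rightarrow> bool" for A where
  flow_refl: "p \<in> pstates A \<Longrightarrow> flow A (Some p) p 0"
| flow_init: "flow A None (init_state A, 0) 0"
| flow_noop: "flow A x r w \<Longrightarrow> edge A r q v NoOp \<Longrightarrow> flow A x q (w + v)"
| flow_push: "flow A None r w \<Longrightarrow> edge A r q v (Push a) \<Longrightarrow> flow A None q (w + v)"
| flow_call: "flow A x r w \<Longrightarrow> edge A r r' v (Push a) \<Longrightarrow> flow A (Some r') q' w' \<Longrightarrow>
    edge A q' q v' (Pop a) \<Longrightarrow> flow A x q (w + w' + (v + v'))"

lemma edge_pstates:
  assumes "is_c1pvass A" "edge A p q w stop"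
  shows "p \<in> pstates A" "q \<in> pstates A" "stop \<in> stack_ops A" "w \<ge> 0"
proof -
  obtain z where z: "trans A (fst p, fst q) = Some (z, stop)" "(snd p, snd q) \<in> set (modes z)"
    "w = max z 0"
    using assms(2) by (auto simp: edge_def)
  have "(fst p, fst q) \<in> dom (trans A)" "(z, stop) \<in> ran (trans A)"
    using z(1) by (auto simp: ran_def)
  then have "(fst p, fst q) \<in> states A \<times> states A" "stop \<in> stack_ops A"
    using assms(1) unfolding is_c1pvass_def by blast+
  moreover have "snd p < 4" "snd q < 4"
    using z(2) by (auto simp: modes_def split: if_splits)
  ultimately show "p \<in> pstates A" "q \<in> pstates A" "stop \<in> stack_ops A" "w \<ge> 0"
    using z(3) by (auto simp: pstates_def mem_Times_iff)
qed

lemma flow_pstates: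
  assumes "is_c1pvass A" "flow A x q w"
  shows "q \<in> pstates A \<and> (\<forall>p. x = Some p \<longrightarrow> p \<in> pstates A)"
  using assms(2)
proof (induction rule: flow.induct)
  case flow_init
  then show ?case using assms(1) by (simp add: pstates_def is_c1pvass_def)
qed (auto dest: edge_pstates(2)[OF assms(1)])

lemma sym_reach_edge:
  "sym_reach A s \<alpha> i S \<Longrightarrow> edge A (s, i) (s', j) w stop \<Longrightarrow> stack_step stop \<alpha> \<beta> \<Longrightarrow>
    sym_reach A s' \<beta> j (S + w)"
  unfolding edge_def by (auto intro: sym_step)

text \<open>A balanced path never looks below its starting height, so it runs over any stack. This
  generality is needed at \<open>flow_call\<close>, where the inner path runs over
  \<open>a # \<alpha>\<close>.\<close>

lemma flow_sound:
  assumes "flow A x q w"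
  shows "case x of
      None \<Rightarrow> \<exists>\<alpha>. sym_reach A (fst q) \<alpha> (snd q) w
    | Some p \<Rightarrow> \<forall>\<alpha> S. sym_reach A (fst p) \<alpha> (snd p) S \<longrightarrow> sym_reach A (fst q) \<alpha> (snd q) (S + w)"
  using assms
proof (induction rule: flow.induct)
  case (flow_init)
  show ?case using sym_init[of A] by auto
next
  case (flow_noop x r w q v)
  have step: "sym_reach A (fst q) \<alpha> (snd q) (S + v)" if "sym_reach A (fst r) \<alpha> (snd r) S" for \<alpha> S
    using sym_reach_edge[OF that, of "fst q" "snd q"] flow_noop.hyps(2) by simp
  show ?case
  proof (cases x)
    case None
    then show ?thesis using flow_noop.IH step by auto
  next
    case (Some p)
    have "sym_reach A (fst q) \<alpha> (snd q) (S + (w + v))" if "sym_reach A (fst p) \<alpha> (snd p) S" for \<alpha> S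
    proof -
      have "sym_reach A (fst r) \<alpha> (snd r) (S + w)"
        using flow_noop.IH that unfolding Some by simp
      from step[OF this] show ?thesis by (simp add: add.assoc)
    qed
    then show ?thesis unfolding Some by simp
  qed
next
  case (flow_push r w q v a)
  then obtain \<alpha> where "sym_reach A (fst r) \<alpha> (snd r) w" by auto
  from sym_reach_edge[OF this, of "fst q" "snd q" v "Push a" "a # \<alpha>"] flow_push.hyps(2)
  show ?case by auto
next
  case (flow_call x r w r' v a q' w' q v')
  have step: "sym_reach A (fst q) \<alpha> (snd q) (S + w' + (v + v'))"
    if "sym_reach A (fst r) \<alpha> (snd r) S" for \<alpha> S
  proof -
    have "sym_reach A (fst r') (a # \<alpha>) (snd r') (S + v)"
      using sym_reach_edge[OF that, of "fst r'" "snd r'" v "Push a"] flow_call.hyps(2) by simp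
    then have "sym_reach A (fst q') (a # \<alpha>) (snd q') (S + v + w')"
      using flow_call.IH(2) by simp
    then have "sym_reach A (fst q) \<alpha> (snd q) (S + v + w' + v')"
      using sym_reach_edge[of A "fst q'" "a # \<alpha>" "snd q'" _ "fst q" "snd q" v' "Pop a" \<alpha>]
        flow_call.hyps(4) by simp
    then show ?thesis by (simp add: algebra_simps)
  qed
  show ?case
  proof (cases x)
    case None
    then show ?thesis using flow_call.IH(1) step by auto
  next
    case (Some p)
    have "sym_reach A (fst q) \<alpha> (snd q) (S + (w + w' + (v + v')))"
      if "sym_reach A (fst p) \<alpha> (snd p) S" for \<alpha> S
    proof -
      have "sym_reach A (fst r) \<alpha> (snd r) (S + w)"
        using flow_call.IH(1) that unfolding Some by simp
      from step[OF this] show ?thesis by (simp add: add.assoc)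
    qed
    then show ?thesis unfolding Some by simp
  qed
qed auto

text \<open>Constructors extend a path on the right, so those of the second path can be replayed
  after the first. A path starting from \<open>Some r\<close> contains no unmatched push.\<close>

lemma flow_trans:
  assumes "flow A (Some r) q v" "flow A None r w"
  shows "flow A None q (w + v)"
  using assms
proof (induction "Some r" q v rule: flow.induct)
  case (flow_noop r' v q v')
  then show ?case using flow.flow_noop[of A None r' "w + v" q v'] by (simp add: add.assoc)
next
  case (flow_call r1 v1 r' v a q' w' q v')
  then show ?case
    using flow.flow_call[of A None r1 "w + v1" r' v a q' w' q v'] by (simp add: add.assoc)
qed simp

text \<open>Decomposes a reachable configuration at the moments its stack symbols were pushed.\<close>

fun unwind :: "('s, 'g) c1pvass \<Rightarrow> 'g list \<Rightarrow> 's \<times> nat \<Rightarrow> int \<Rightarrow> bool" where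
  "unwind A [] q S \<longleftrightarrow> False"
| "unwind A [b] q S \<longleftrightarrow> b = stack_bottom A \<and> flow A None q S"
| "unwind A (a # b # \<alpha>) q S \<longleftrightarrow> (\<exists>r r' S' v w. unwind A (b # \<alpha>) r S' \<and>
     edge A r r' v (Push a) \<and> flow A (Some r') q w \<and> S = S' + v + w)"

lemma unwind_noop: "unwind A \<alpha> r S \<Longrightarrow> edge A r q v NoOp \<Longrightarrow> unwind A \<alpha> q (S + v)"
proof (induction A \<alpha> r S rule: unwind.induct)
  case (3 A a b \<alpha> r S)
  then obtain r1 r2 S' u w where *: "unwind A (b # \<alpha>) r1 S'" "edge A r1 r2 u (Push a)"
    "flow A (Some r2) r w" "S = S' + u + w"
    unfolding unwind.simps by blast
  from flow_noop[OF *(3) 3(3)] *(1,2,4) show ?case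
    unfolding unwind.simps by (metis add.assoc)
qed (auto intro: flow_noop)

text \<open>The matched push and pop are absorbed into the flow of the topmost surviving
  level.\<close>

lemma unwind_call:
  "unwind A \<alpha> r S \<Longrightarrow> edge A r r' v (Push a) \<Longrightarrow> flow A (Some r') q' w' \<Longrightarrow>
    edge A q' q v' (Pop a) \<Longrightarrow> unwind A \<alpha> q (S + v + w' + v')"
proof (induction A \<alpha> r S rule: unwind.induct)
  case (2 A b r S)
  then show ?case using flow_call[of A None r S r' v a q' w' q v'] by (simp add: algebra_simps)
next
  case (3 A c b \<alpha> r S)
  then obtain r1 r2 S' u w where *: "unwind A (b # \<alpha>) r1 S'" "edge A r1 r2 u (Push c)"
    "flow A (Some r2) r w" "S = S' + u + w"
    unfolding unwind.simps by blast
  have "flow A (Some r2) q (w + w' + (v + v'))"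
    by (rule flow_call[OF *(3) 3(3-5)])
  with * show ?case
    unfolding unwind.simps
    by (intro exI[of _ r1] exI[of _ r2] exI[of _ S'] exI[of _ u] exI[of _ "w + w' + (v + v')"]) simp
qed simp

lemma unwind_push:
  assumes "is_c1pvass A" "unwind A \<alpha> r S" "edge A r q v (Push a)"
  shows "unwind A (a # \<alpha>) q (S + v)"
proof -
  have "flow A (Some q) q 0"
    using edge_pstates(2)[OF assms(1,3)] by (rule flow_refl)
  show ?thesis
  proof (cases \<alpha>)
    case Nil
    with assms(2) show ?thesis by simp
  next
    case (Cons b \<beta>)
    show ?thesis
      unfolding Cons unwind.simps using assms(2,3) \<open>flow A (Some q) q 0\<close> Cons
      by (intro exI[of _ r] exI[of _ q] exI[of _ S] exI[of _ v] exI[of _ 0]) simp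
  qed
qed

lemma sym_reach_unwind:
  assumes "is_c1pvass A" "sym_reach A s \<alpha> i S"
  shows "unwind A \<alpha> (s, i) S"
  using assms(2)
proof (induction rule: sym_reach.induct)
  case sym_init
  show ?case by (simp add: flow_init)
next
  case (sym_step s \<alpha> i S s' z stop \<beta> j)
  have e: "edge A (s, i) (s', j) (max z 0) stop"
    using sym_step.hyps by (auto simp: edge_def)
  show ?case
  proof (cases stop)
    case (Push a)
    then show ?thesis
      using unwind_push[OF assms(1) sym_step.IH] e sym_step.hyps(3) by simp
  next
    case (Pop a)
    then have \<alpha>: "\<alpha> = a # \<beta>"
      using sym_step.hyps(3) by simp
    \<comment> \<open>The bottom symbol is never popped, so another symbol lies below
      \<open>a\<close> and the recursive equation of \<open>unwind\<close> applies.\<close>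
    have "a \<noteq> stack_bottom A"
      using edge_pstates(3)[OF assms(1) e] Pop by (auto simp: stack_ops_def Let_def)
    then obtain b \<beta>' where "\<beta> = b # \<beta>'"
      using sym_step.IH \<alpha> by (cases \<beta>) auto
    then show ?thesis
      using sym_step.IH unwind_call[of A \<beta>] e unfolding \<alpha> Pop by auto
  next
    case NoOp
    then show ?thesis
      using unwind_noop[OF sym_step.IH] e sym_step.hyps(3) by simp
  qed
qed

text \<open>Each symbol left on the stack comes from an unmatched push, which
  \<open>flow_push\<close> admits in the row of the initial state.\<close>

lemma unwind_flow: "unwind A \<alpha> q S \<Longrightarrow> flow A None q S"
proof (induction A \<alpha> q S rule: unwind.induct)
  case (3 A a b \<alpha> q S)
  then obtain r r' S' v w where *: "flow A None r S'" "edge A r r' v (Push a)"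
    "flow A (Some r') q w" "S = S' + v + w"
    unfolding unwind.simps by blast
  show ?case
    using flow_trans[OF *(3) flow_push[OF *(1,2)]] *(4) by simp
qed auto

theorem flow_iff_sym_reach:
  assumes "is_c1pvass A"
  shows "flow A None (s, i) S \<longleftrightarrow> (\<exists>\<alpha>. sym_reach A s \<alpha> i S)"
proof
  show "flow A None (s, i) S \<Longrightarrow> \<exists>\<alpha>. sym_reach A s \<alpha> i S"
    using flow_sound[of A None "(s, i)" S] by simp
  show "\<exists>\<alpha>. sym_reach A s \<alpha> i S \<Longrightarrow> flow A None (s, i) S"
    using unwind_flow sym_reach_unwind[OF assms] by blast
qed

lemma flow_mode_ok:
  assumes "is_c1pvass A" "flow A None (s, i) S"
  shows "mode_ok i S"
  using assms flow_iff_sym_reach sym_reach_mode_ok by metis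

theorem reach_values_flow:
  assumes "is_c1pvass A"
  shows "reach_values A = {c. \<exists>i S. flow A None (acc_state A, i) S \<and> c \<in> vals i S}"
  unfolding reach_values_sym[OF assms] using flow_iff_sym_reach[OF assms] by blast

section \<open>The grammar of an automaton\<close>

text \<open>
  An edge is \<open>(p, q, w, t, y)\<close> with end points \<open>p, q < m\<close>, weight \<open>w\<close> and the code \<open>t, y\<close> of its
  stack operation. The nonterminal \<open>p * m + q\<close> stands for \<open>flow\<close> from \<open>p\<close> to \<open>q\<close>, where \<open>p = m\<close>
  represents \<open>None\<close>; the empty word is \<open>m * m + m\<close>.
\<close>

type_synonym coded_edge = "nat \<times> nat \<times> int \<times> int \<times> int"

definition entry_edges :: "nat \<Rightarrow> nat \<Rightarrow> int list \<Rightarrow> coded_edge list" where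
  "entry_edges u v xs =
     (if xs ! 0 > 0
      then map (\<lambda>(i, j). (4 * u + i, 4 * v + j, max (xs ! 1) 0, xs ! 2, xs ! 3)) (modes (xs ! 1))
      else [])"

fun call_rules :: "nat \<Rightarrow> nat \<Rightarrow> coded_edge \<Rightarrow> coded_edge \<Rightarrow> rule list" where
  "call_rules m p (p\<^sub>1, q\<^sub>1, w\<^sub>1, t\<^sub>1, y\<^sub>1) (p\<^sub>2, q\<^sub>2, w\<^sub>2, t\<^sub>2, y\<^sub>2) =
     (if t\<^sub>2 > 1 \<and> y\<^sub>1 = y\<^sub>2 then [(p * m + q\<^sub>2, p * m + p\<^sub>1, q\<^sub>1 * m + p\<^sub>2, w\<^sub>1 + w\<^sub>2)] else [])"

text \<open>The operation codes 0, 1, 2 are separated by inequalities because the program can only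
  test positivity. The empty word as second child makes unary rules binary; unmatched pushes are
  confined to row \<open>m\<close>.\<close>

fun edge_rules :: "nat \<Rightarrow> coded_edge list \<Rightarrow> nat \<Rightarrow> coded_edge \<Rightarrow> rule list" where
  "edge_rules m es p (p\<^sub>1, q\<^sub>1, w\<^sub>1, t\<^sub>1, y\<^sub>1) =
     (if t\<^sub>1 > 0
      then if t\<^sub>1 < 2
        then (if p < m then [] else [(p * m + q\<^sub>1, p * m + p\<^sub>1, m * m + m, w\<^sub>1)]) @
          concat (map (call_rules m p (p\<^sub>1, q\<^sub>1, w\<^sub>1, t\<^sub>1, y\<^sub>1)) es)
        else []
      else [(p * m + q\<^sub>1, p * m + p\<^sub>1, m * m + m, w\<^sub>1)])"

definition row_rules :: "nat \<Rightarrow> nat \<Rightarrow> coded_edge list \<Rightarrow> nat \<Rightarrow> rule list" where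
  "row_rules m st es p =
     (p * m + (if p < m then p else st), m * m + m, m * m + m, 0) # concat (map (edge_rules m es p) es)"

definition all_rules :: "nat \<Rightarrow> nat \<Rightarrow> coded_edge list \<Rightarrow> rule list" where
  "all_rules m st es = concat (map (row_rules m st es) [0..<Suc m])"

lemma set_concat_map_edges:
  fixes es :: "coded_edge list"
  shows "r \<in> set (concat (map f es)) \<longleftrightarrow>
    (\<exists>p q w t y. (p, q, w, t, y) \<in> set es \<and> r \<in> set (f (p, q, w, t, y)))"
proof -
  have "r \<in> set (concat (map f es)) \<longleftrightarrow> (\<exists>e. e \<in> set es \<and> r \<in> set (f e))"
    by (simp add: Bex_def del: split_paired_Ex)
  then show ?thesis
    by (simp only: split_paired_Ex)
qed

text \<open>The lists follow the loops of the program; this form, with its three kinds of rules, is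
  what the correspondence with \<open>flow\<close> works on.\<close>

lemma set_all_rules:
  "(x, y, z, c) \<in> set (all_rules m st es) \<longleftrightarrow> (\<exists>p \<le> m.
     x = p * m + (if p < m then p else st) \<and> y = m * m + m \<and> z = m * m + m \<and> c = 0 \<or>
     (\<exists>p\<^sub>1 q\<^sub>1 w\<^sub>1 t\<^sub>1 y\<^sub>1. (p\<^sub>1, q\<^sub>1, w\<^sub>1, t\<^sub>1, y\<^sub>1) \<in> set es \<and>
        (t\<^sub>1 \<le> 0 \<or> t\<^sub>1 = 1 \<and> p = m) \<and>
        x = p * m + q\<^sub>1 \<and> y = p * m + p\<^sub>1 \<and> z = m * m + m \<and> c = w\<^sub>1) \<or>
     (\<exists>p\<^sub>1 q\<^sub>1 w\<^sub>1 t\<^sub>1 y\<^sub>1 p\<^sub>2 q\<^sub>2 w\<^sub>2 t\<^sub>2. (p\<^sub>1, q\<^sub>1, w\<^sub>1, t\<^sub>1, y\<^sub>1) \<in> set es \<and>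
        (p\<^sub>2, q\<^sub>2, w\<^sub>2, t\<^sub>2, y\<^sub>1) \<in> set es \<and> t\<^sub>1 = 1 \<and> t\<^sub>2 > 1 \<and>
        x = p * m + q\<^sub>2 \<and> y = p * m + p\<^sub>1 \<and> z = q\<^sub>1 * m + p\<^sub>2 \<and> c = w\<^sub>1 + w\<^sub>2))"
  (is "?l \<longleftrightarrow> (\<exists>p \<le> m. ?A p \<or> ?B p \<or> ?C p)")
proof -
  have call: "(x, y, z, c) \<in> set (concat (map (call_rules m p (p\<^sub>1, q\<^sub>1, w\<^sub>1, t\<^sub>1, y\<^sub>1)) es)) \<longleftrightarrow>
     (\<exists>p\<^sub>2 q\<^sub>2 w\<^sub>2 t\<^sub>2. (p\<^sub>2, q\<^sub>2, w\<^sub>2, t\<^sub>2, y\<^sub>1) \<in> set es \<and> t\<^sub>2 > 1 \<and>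
        x = p * m + q\<^sub>2 \<and> y = p * m + p\<^sub>1 \<and> z = q\<^sub>1 * m + p\<^sub>2 \<and> c = w\<^sub>1 + w\<^sub>2)" for p p\<^sub>1 q\<^sub>1 w\<^sub>1 t\<^sub>1 y\<^sub>1
    unfolding set_concat_map_edges call_rules.simps
    by (simp split: if_split) blast
  have edge: "(x, y, z, c) \<in> set (concat (map (edge_rules m es p) es)) \<longleftrightarrow> ?B p \<or> ?C p" if "p \<le> m" for p
  proof -
    have inner: "(x, y, z, c) \<in> set (edge_rules m es p (p\<^sub>1, q\<^sub>1, w\<^sub>1, t\<^sub>1, y\<^sub>1)) \<longleftrightarrow>
        (t\<^sub>1 \<le> 0 \<or> t\<^sub>1 = 1 \<and> p = m) \<and>
          x = p * m + q\<^sub>1 \<and> y = p * m + p\<^sub>1 \<and> z = m * m + m \<and> c = w\<^sub>1 \<or>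
        t\<^sub>1 = 1 \<and> (\<exists>p\<^sub>2 q\<^sub>2 w\<^sub>2 t\<^sub>2. (p\<^sub>2, q\<^sub>2, w\<^sub>2, t\<^sub>2, y\<^sub>1) \<in> set es \<and> t\<^sub>2 > 1 \<and>
        x = p * m + q\<^sub>2 \<and> y = p * m + p\<^sub>1 \<and> z = q\<^sub>1 * m + p\<^sub>2 \<and> c = w\<^sub>1 + w\<^sub>2)"
      for p\<^sub>1 q\<^sub>1 w\<^sub>1 t\<^sub>1 y\<^sub>1
    proof -
      consider "t\<^sub>1 \<le> 0" | "t\<^sub>1 = 1" | "t\<^sub>1 \<ge> 2" by linarith
      then show ?thesis
        unfolding call[of p p\<^sub>1 q\<^sub>1 w\<^sub>1 t\<^sub>1 y\<^sub>1, symmetric] using that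
        by cases (simp_all only: edge_rules.simps, simp_all)
    qed
    have "(x, y, z, c) \<in> set (concat (map (edge_rules m es p) es)) \<longleftrightarrow>
      (\<exists>p\<^sub>1 q\<^sub>1 w\<^sub>1 t\<^sub>1 y\<^sub>1. (p\<^sub>1, q\<^sub>1, w\<^sub>1, t\<^sub>1, y\<^sub>1) \<in> set es \<and>
        (x, y, z, c) \<in> set (edge_rules m es p (p\<^sub>1, q\<^sub>1, w\<^sub>1, t\<^sub>1, y\<^sub>1)))"
      by (rule set_concat_map_edges)
    then show ?thesis
      unfolding inner by blast
  qed
  have "?l \<longleftrightarrow> (\<exists>p \<le> m. (x, y, z, c) \<in> set (row_rules m st es p))"
    unfolding all_rules_def by (auto simp: less_Suc_eq_le simp del: upt_Suc)
  also have "\<dots> \<longleftrightarrow> (\<exists>p \<le> m. ?A p \<or> (x, y, z, c) \<in> set (concat (map (edge_rules m es p) es)))"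
    by (auto simp: row_rules_def simp del: set_concat)
  also have "\<dots> \<longleftrightarrow> (\<exists>p \<le> m. ?A p \<or> ?B p \<or> ?C p)"
    by (rule ex_cong1, rule conj_cong[OF refl]) (simp only: edge)
  finally show ?thesis .
qed

lemma length_takeWhile_less_mem: "x \<in> set xs \<Longrightarrow> length (takeWhile (\<lambda>y. y \<noteq> x) xs) < length xs"
  by (induction xs) auto

lemma set_concat_map_upt: "r \<in> set (concat (map f [0..<n])) \<longleftrightarrow> (\<exists>v<n. r \<in> set (f v))"
  by auto

locale coded_automaton =
  fixes A :: "('s, 'g) c1pvass" and ss :: "'s list" and gs :: "'g list"
  assumes A: "is_c1pvass A" and ss: "enumerates ss (states A)" and gs: "enumerates gs (alphabet A)"
begin

definition idx :: "'s \<Rightarrow> nat" where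
  "idx s = length (takeWhile (\<lambda>y. y \<noteq> s) ss)"

abbreviation n :: nat where "n \<equiv> length ss"
definition m :: nat where "m = 4 * n"
abbreviation eps :: nat where "eps \<equiv> m * m + m"

definition entry :: "nat \<Rightarrow> nat \<Rightarrow> int list" where
  "entry u v = encode_entry gs (trans A (ss ! u, ss ! v))"

definition es :: "coded_edge list" where
  "es = concat (map (\<lambda>u. concat (map (\<lambda>v. entry_edges u v (entry u v)) [0..<n])) [0..<n])"

definition rs :: "rule list" where
  "rs = all_rules m (4 * idx (init_state A)) es"

lemma ss_simps: "distinct ss" "set ss = states A" and gs_simps: "distinct gs" "set gs = alphabet A"
  using ss gs by (auto simp: enumerates_def)

lemma idx:
  assumes "s \<in> states A"
  shows "idx s < n" "ss ! idx s = s"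
proof -
  have "s \<in> set ss" using assms ss_simps by simp
  then show "idx s < n"
    unfolding idx_def by (rule length_takeWhile_less_mem)
  then show "ss ! idx s = s"
    using nth_length_takeWhile[of "\<lambda>y. y \<noteq> s" ss] unfolding idx_def by simp
qed

lemma idx_nth: "u < n \<Longrightarrow> idx (ss ! u) = u"
proof -
  assume "u < n"
  then have "ss ! u \<in> states A"
    using nth_mem ss_simps by blast
  from nth_eq_iff_index_eq[OF ss_simps(1) idx(1)[OF this] \<open>u < n\<close>] idx(2)[OF this]
  show ?thesis by simp
qed

lemma n_pos: "n > 0"
proof -
  have "init_state A \<in> set ss"
    using A unfolding ss_simps(2) is_c1pvass_def by blast
  then show ?thesis by (rule length_pos_if_in_set)
qed

lemma position_inj:
  assumes "a \<in> alphabet A" "b \<in> alphabet A" "position gs a = position gs b"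
  shows "a = b"
proof -
  have "gs ! length (takeWhile (\<lambda>y. y \<noteq> c) gs) = c" if "c \<in> alphabet A" for c
  proof -
    have "c \<in> set gs" using that gs_simps by simp
    from nth_length_takeWhile[OF length_takeWhile_less_mem[OF this]] show ?thesis by simp
  qed
  from this[OF assms(1)] this[OF assms(2)] assms(3) show ?thesis
    unfolding position_def of_nat_eq_iff by metis
qed

fun code :: "'s \<times> nat \<Rightarrow> nat" where
  "code (s, i) = 4 * idx s + i"

lemma code_less: "p \<in> pstates A \<Longrightarrow> code p < m"
proof -
  assume *: "p \<in> pstates A"
  obtain s i where p: "p = (s, i)"
    by (cases p)
  have "s \<in> states A" "i < 4"
    using * by (simp_all add: p pstates_def)
  with idx(1)[OF this(1)] show ?thesis
    by (simp add: m_def p)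
qed

lemma code_inj:
  assumes "p \<in> pstates A" "q \<in> pstates A" "code p = code q"
  shows "p = q"
proof -
  have dec: "(ss ! (code p div 4), code p mod 4) = p" if "p \<in> pstates A" for p
  proof -
    obtain s i where p: "p = (s, i)"
      by (cases p)
    have *: "s \<in> states A" "i < 4"
      using that by (simp_all add: p pstates_def)
    then have "(4 * idx s + i) div 4 = idx s" "(4 * idx s + i) mod 4 = i"
      by simp_all
    then show ?thesis using idx(2)[OF *(1)] by (simp add: p)
  qed
  show ?thesis
    using dec[OF assms(1), unfolded assms(3)] dec[OF assms(2)] by (rule trans[OF sym])
qed

lemma code_surj: "k < m \<Longrightarrow> \<exists>p \<in> pstates A. code p = k"
proof -
  assume "k < m"
  then have "k div 4 < n" by (simp add: m_def)
  then have "ss ! (k div 4) \<in> states A"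
    unfolding ss_simps(2)[symmetric] by (rule nth_mem)
  with \<open>k div 4 < n\<close> show ?thesis
    by (intro bexI[of _ "(ss ! (k div 4), k mod 4)"]) (simp_all add: idx_nth pstates_def)
qed

lemma set_es:
  "(p, q, w, t, y) \<in> set es \<longleftrightarrow>
     (\<exists>P Q stop. edge A P Q w stop \<and> p = code P \<and> q = code Q \<and> encode_stack_op gs stop = [t, y])"
proof -
  have entry: "entry u v ! 0 > 0 \<longleftrightarrow> (\<exists>z stop. trans A (ss ! u, ss ! v) = Some (z, stop) \<and>
      encode_stack_op gs stop = [entry u v ! 2, entry u v ! 3] \<and> entry u v ! 1 = z)" for u v
  proof (cases "trans A (ss ! u, ss ! v)")
    case None
    then show ?thesis by (simp add: entry_def)
  next
    case (Some zs)
    then show ?thesis by (cases zs; cases "snd zs") (auto simp: entry_def)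
  qed
  show ?thesis
  proof
    assume "(p, q, w, t, y) \<in> set es"
    then obtain u v where uv: "u < n" "v < n" "(p, q, w, t, y) \<in> set (entry_edges u v (entry u v))"
      unfolding es_def set_concat_map_upt by blast
    then obtain i j where ij: "(i, j) \<in> set (modes (entry u v ! 1))" "entry u v ! 0 > 0"
      "p = 4 * u + i" "q = 4 * v + j" "w = max (entry u v ! 1) 0" "t = entry u v ! 2" "y = entry u v ! 3"
      by (auto simp: entry_edges_def split: if_splits)
    with entry[of u v] obtain stop where st: "trans A (ss ! u, ss ! v) = Some (entry u v ! 1, stop)"
      "encode_stack_op gs stop = [t, y]"
      by auto
    then have "edge A (ss ! u, i) (ss ! v, j) w stop"
      using ij by (simp add: edge_def)
    then show "\<exists>P Q stop. edge A P Q w stop \<and> p = code P \<and> q = code Q \<and> encode_stack_op gs stop = [t, y]"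
      using ij uv st(2) idx_nth
      by (intro exI[of _ "(ss ! u, i)"] exI[of _ "(ss ! v, j)"] exI[of _ stop]) simp
  next
    assume "\<exists>P Q stop. edge A P Q w stop \<and> p = code P \<and> q = code Q \<and> encode_stack_op gs stop = [t, y]"
    then obtain s i s' j stop where e: "edge A (s, i) (s', j) w stop" "p = 4 * idx s + i"
      "q = 4 * idx s' + j" "encode_stack_op gs stop = [t, y]"
      by auto
    then obtain z where z: "trans A (s, s') = Some (z, stop)" "(i, j) \<in> set (modes z)" "w = max z 0"
      by (auto simp: edge_def)
    have s: "s \<in> states A" "s' \<in> states A"
      using edge_pstates(1,2)[OF A e(1)] by (auto simp: pstates_def)
    then have ent: "entry (idx s) (idx s') = [1, z, t, y]"
      using z(1) idx e(4) by (simp add: entry_def)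
    have "(p, q, w, t, y) \<in> set (entry_edges (idx s) (idx s') (entry (idx s) (idx s')))"
      using z e(2,3) unfolding ent by (force simp: entry_edges_def)
    then show "(p, q, w, t, y) \<in> set es"
      using idx(1)[OF s(1)] idx(1)[OF s(2)] unfolding es_def set_concat_map_upt by blast
  qed
qed

lemma es_bounds: "(p, q, w, t, y) \<in> set es \<Longrightarrow> p < m \<and> q < m \<and> w \<ge> 0"
proof -
  assume "(p, q, w, t, y) \<in> set es"
  then obtain P Q stop where e: "edge A P Q w stop" "p = code P" "q = code Q"
    unfolding set_es by blast
  show ?thesis
    using code_less[OF edge_pstates(1)[OF A e(1)]] code_less[OF edge_pstates(2)[OF A e(1)]]
      edge_pstates(4)[OF A e(1)] e(2,3) by simp
qed

lemma init_pstates: "(init_state A, 0) \<in> pstates A"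
  using A by (simp add: is_c1pvass_def pstates_def)

lemma index_bound: "p \<le> m \<Longrightarrow> q < m \<Longrightarrow> p * m + q < eps"
  using mult_le_mono1[of p m m] by linarith

lemma index_inj:
  assumes "p * m + q = p' * m + q'" "q < m" "q' < m"
  shows "p = p' \<and> q = q'"
proof -
  have "m \<noteq> 0" using assms(2) by auto
  then   have "(p * m + q) div m = p" "(p' * m + q') div m = p'"
    using assms(2,3) by simp_all
  with assms(1) have "p = p'" by metis
  with assms(1) show ?thesis by simp
qed

lemma rs_cases:
  assumes "(x, y, z, c) \<in> set rs"
  obtains (eps) p where "p \<le> m" "x = p * m + (if p < m then p else 4 * idx (init_state A))"
      "y = eps" "z = eps" "c = 0"
  | (edge) p p\<^sub>1 q\<^sub>1 t\<^sub>1 y\<^sub>1 where "p \<le> m" "(p\<^sub>1, q\<^sub>1, c, t\<^sub>1, y\<^sub>1) \<in> set es"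
      "t\<^sub>1 \<le> 0 \<or> t\<^sub>1 = 1 \<and> p = m" "x = p * m + q\<^sub>1" "y = p * m + p\<^sub>1" "z = eps"
  | (call) p p\<^sub>1 q\<^sub>1 w\<^sub>1 t\<^sub>1 y\<^sub>1 p\<^sub>2 q\<^sub>2 w\<^sub>2 t\<^sub>2 where "p \<le> m" "(p\<^sub>1, q\<^sub>1, w\<^sub>1, t\<^sub>1, y\<^sub>1) \<in> set es"
      "(p\<^sub>2, q\<^sub>2, w\<^sub>2, t\<^sub>2, y\<^sub>1) \<in> set es" "t\<^sub>1 = 1" "t\<^sub>2 > 1"
      "x = p * m + q\<^sub>2" "y = p * m + p\<^sub>1" "z = q\<^sub>1 * m + p\<^sub>2" "c = w\<^sub>1 + w\<^sub>2"
  using assms unfolding rs_def set_all_rules by blast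

lemma rs_call:
  assumes "p \<le> m" "(p\<^sub>1, q\<^sub>1, w\<^sub>1, 1, y\<^sub>1) \<in> set es" "(p\<^sub>2, q\<^sub>2, w\<^sub>2, t\<^sub>2, y\<^sub>1) \<in> set es" "t\<^sub>2 > 1"
  shows "(p * m + q\<^sub>2, p * m + p\<^sub>1, q\<^sub>1 * m + p\<^sub>2, w\<^sub>1 + w\<^sub>2) \<in> set rs"
  unfolding rs_def set_all_rules using assms by blast

text \<open>The pairs fill the indices below \<open>eps\<close>, and the empty word takes the next
  one, which gives \<open>Suc eps\<close> nonterminals.\<close>

sublocale maxplus_grammar rs eps "Suc eps"
proof
  fix x y z c
  assume "(x, y, z, c) \<in> set rs"
  then show "x < Suc eps \<and> y < Suc eps \<and> z < Suc eps \<and> 0 \<le> c"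
  proof (cases rule: rs_cases)
    case (eps p)
    have "(if p < m then p else 4 * idx (init_state A)) < m"
      using code_less[OF init_pstates] by simp
    from index_bound[OF eps(1) this] eps show ?thesis by simp
  next
    case (edge p p\<^sub>1 q\<^sub>1 t\<^sub>1 y\<^sub>1)
    with es_bounds[OF edge(2)] index_bound[OF edge(1), of p\<^sub>1] index_bound[OF edge(1), of q\<^sub>1]
    show ?thesis by simp
  next
    case (call p p\<^sub>1 q\<^sub>1 w\<^sub>1 t\<^sub>1 y\<^sub>1 p\<^sub>2 q\<^sub>2 w\<^sub>2 t\<^sub>2)
    with es_bounds[OF call(2)] es_bounds[OF call(3)] index_bound[OF call(1), of p\<^sub>1]
      index_bound[OF call(1), of q\<^sub>2] index_bound[of q\<^sub>1 p\<^sub>2]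
    show ?thesis by simp
  qed
qed simp

fun row :: "('s \<times> nat) option \<Rightarrow> nat" where
  "row None = m"
| "row (Some p) = code p"

definition valid :: "('s \<times> nat) option \<Rightarrow> bool" where
  "valid x \<longleftrightarrow> (\<forall>p. x = Some p \<longrightarrow> p \<in> pstates A)"

lemma row_le: "valid x \<Longrightarrow> row x \<le> m"
  using code_less by (cases x) (auto simp: valid_def less_imp_le)

lemma row_inj:
  assumes "valid x" "valid y" "row x = row y"
  shows "x = y"
proof (cases x)
  case None
  show ?thesis
  proof (cases y)
    case (Some q)
    then show ?thesis using None assms code_less[of q] by (simp add: valid_def)
  qed (use None in simp)
next
  case (Some p)
  show ?thesis
  proof (cases y)
    case None
    then show ?thesis using Some assms code_less[of p] by (simp add: valid_def)
  next
    case (Some q)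
    then show ?thesis using \<open>x = Some p\<close> assms code_inj[of p q] by (simp add: valid_def)
  qed
qed

lemma row_surj: "k \<le> m \<Longrightarrow> \<exists>x. valid x \<and> row x = k"
proof (cases "k = m")
  case True
  then show ?thesis by (intro exI[of _ None]) (simp add: valid_def)
next
  case False
  assume "k \<le> m"
  with False have "k < m" by simp
  from code_surj[OF this] obtain p where "p \<in> pstates A" "code p = k" by blast
  then show ?thesis by (intro exI[of _ "Some p"]) (simp add: valid_def)
qed

definition nonterm :: "('s \<times> nat) option \<Rightarrow> 's \<times> nat \<Rightarrow> nat" where
  "nonterm x q = row x * m + code q"

lemma nonterm_inj:
  assumes "nonterm x q = nonterm x' q'" "valid x" "valid x'" "q \<in> pstates A" "q' \<in> pstates A"
  shows "x = x' \<and> q = q'"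
proof -
  have "row x = row x' \<and> code q = code q'"
    using index_inj[OF assms(1)[unfolded nonterm_def] code_less code_less] assms(4,5) .
  then show ?thesis
    using row_inj[OF assms(2,3)] code_inj[OF assms(4,5)] by simp
qed

lemma nonterm_eps: "valid x \<Longrightarrow> q \<in> pstates A \<Longrightarrow> nonterm x q \<noteq> eps"
  using index_bound[OF row_le code_less] unfolding nonterm_def by (metis nat_neq_iff)

lemma flow_valid: "flow A x q w \<Longrightarrow> valid x \<and> q \<in> pstates A"
  using flow_pstates[OF A] by (auto simp: valid_def)

lemma derives_step:
  assumes "derives (nonterm x r) (w + 1)" "(code r, code q, v, t, y) \<in> set es" "valid x"
    and "t \<le> 0 \<or> t = 1 \<and> x = None"
  shows "derives (nonterm x q) (w + v + 1)"
proof -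
  have "(nonterm x q, nonterm x r, eps, v) \<in> set rs"
    unfolding rs_def set_all_rules nonterm_def
    using assms(2,4) row_le[OF assms(3)] by (intro exI[of _ "row x"]) auto
  from der_rule[OF this assms(1) der_eps] show ?thesis by (simp add: algebra_simps)
qed

lemma derives_flow: "flow A x q w \<Longrightarrow> derives (nonterm x q) (w + 1)"
proof (induction rule: flow.induct)
  case (flow_refl p)
  have "(nonterm (Some p) p, eps, eps, 0) \<in> set rs"
    unfolding rs_def set_all_rules nonterm_def
    using code_less[OF flow_refl] by (intro exI[of _ "code p"]) auto
  from der_rule[OF this der_eps der_eps] show ?case by simp
next
  case flow_init
  have "(nonterm None (init_state A, 0), eps, eps, 0) \<in> set rs"
    unfolding rs_def set_all_rules nonterm_def by (intro exI[of _ m]) auto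
  from der_rule[OF this der_eps der_eps] show ?case by simp
next
  case (flow_noop x r w q v)
  then have "(code r, code q, v, 0, 0) \<in> set es"
    unfolding set_es by (intro exI[of _ r] exI[of _ q] exI[of _ NoOp]) simp
  from derives_step[OF flow_noop.IH this] flow_valid[OF flow_noop.hyps(1)] show ?case by simp
next
  case (flow_push r w q v a)
  then have "(code r, code q, v, 1, position gs a) \<in> set es"
    unfolding set_es by (intro exI[of _ r] exI[of _ q] exI[of _ "Push a"]) simp
  from derives_step[OF flow_push.IH this] show ?case by (simp add: valid_def)
next
  case (flow_call x r w r' v a q' w' q v')
  have e1: "(code r, code r', v, 1, position gs a) \<in> set es"
    unfolding set_es using flow_call.hyps(2)
    by (intro exI[of _ r] exI[of _ r'] exI[of _ "Push a"]) simp
  have e2: "(code q', code q, v', 2, position gs a) \<in> set es"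
    unfolding set_es using flow_call.hyps(4)
    by (intro exI[of _ q'] exI[of _ q] exI[of _ "Pop a"]) simp
  have "(nonterm x q, nonterm x r, nonterm (Some r') q', v + v') \<in> set rs"
    unfolding nonterm_def row.simps
    using rs_call[OF row_le e1 e2] flow_valid[OF flow_call.hyps(1)] by simp
  from der_rule[OF this flow_call.IH] show ?case by (simp add: algebra_simps)
qed

text \<open>The empty word heads no rule and has only value 1, so a rule with \<open>eps\<close> as
  second child just adds its weight. Each of the three kinds of rules becomes the matching
  constructors of \<open>flow\<close>.\<close>

lemma flow_derives:
  assumes "derives X v"
  shows "if X = eps then v = 1 else \<exists>x q. X = nonterm x q \<and> flow A x q (v - 1)"
  using assms
proof (induction rule: der.induct)
  case der_eps
  then show ?case by simp
next
  case (der_rule X Y Z c a b)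
  have edgeD: "\<exists>P Q stop. edge A P Q w stop \<and> P \<in> pstates A \<and> Q \<in> pstates A \<and> stop \<in> stack_ops A \<and>
      p = code P \<and> q = code Q \<and> encode_stack_op gs stop = [t, y]"
    if "(p, q, w, t, y) \<in> set es" for p q w t y
    using that edge_pstates[OF A] unfolding set_es by blast
  \<comment> \<open>The induction hypothesis names some pair for the nonterminal; injectivity of the
    coding identifies it with the pair named by the rule.\<close>
  have flowD: "flow A x q (v - 1)"
    if "if X = eps then v = 1 else \<exists>x q. X = nonterm x q \<and> flow A x q (v - 1)"
      "X = nonterm x q" "valid x" "q \<in> pstates A" for X v x q
  proof -
    have "X \<noteq> eps" using nonterm_eps that by simp
    with that(1) have "\<exists>x q. X = nonterm x q \<and> flow A x q (v - 1)"
      by (simp only: if_False)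
    then obtain x' q' where "X = nonterm x' q'" "flow A x' q' (v - 1)"
      by blast
    with nonterm_inj[of x q x' q'] that(2-) flow_valid show ?thesis by metis
  qed
  have goal: ?case if "X = nonterm x q" "flow A x q (a + b + c - 1 - 1)" for x q
  proof -
    have "X \<noteq> eps"
      using that(1) nonterm_eps[of x q] flow_valid[OF that(2)] by simp
    then show ?thesis
      using that by (simp only: if_False) blast
  qed
  from der_rule.hyps(1) show ?case
  proof (cases rule: rs_cases)
    case (eps p)
    then have "a = 1" "b = 1" using der_rule.IH by auto
    obtain x where x: "valid x" "row x = p"
      using row_surj[OF eps(1)] by blast
    show ?thesis
    proof (cases x)
      case None
      then show ?thesis
        using goal[of None "(init_state A, 0)"] eps x \<open>a = 1\<close> \<open>b = 1\<close> flow_init[of A]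
        by (simp add: nonterm_def)
    next
      case (Some P)
      then have "P \<in> pstates A" using x(1) by (simp add: valid_def)
      then show ?thesis
        using goal[of x P] Some eps x \<open>a = 1\<close> \<open>b = 1\<close> flow_refl[of P A] code_less[of P]
        by (auto simp: nonterm_def)
    qed
  next
    case (edge p p\<^sub>1 q\<^sub>1 t\<^sub>1 y\<^sub>1)
    obtain x where x: "valid x" "row x = p"
      using row_surj[OF edge(1)] by blast
    from edgeD[OF edge(2)] obtain P Q stop where e: "edge A P Q c stop" "P \<in> pstates A" "Q \<in> pstates A"
      "p\<^sub>1 = code P" "q\<^sub>1 = code Q" "encode_stack_op gs stop = [t\<^sub>1, y\<^sub>1]"
      by blast
    have "b = 1" using der_rule.IH(2) edge(6) by simp
    have fl: "flow A x P (a - 1)"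
      using flowD[OF der_rule.IH(1) _ x(1) e(2)] edge e x by (simp add: nonterm_def)
    have "flow A x Q (a - 1 + c)"
    proof (cases stop)
      case (Push g)
      then have "x = None"
        using edge(3) e(6) row_inj[OF x(1), of None] x(2) by (simp add: valid_def)
      then show ?thesis using flow_push fl e(1) Push by metis
    next
      case (Pop g)
      then show ?thesis using edge(3) e(6) by auto
    next
      case NoOp
      then show ?thesis using flow_noop[OF fl] e(1) by simp
    qed
    then show ?thesis
      using goal[of x Q] edge e x \<open>b = 1\<close> by (simp add: nonterm_def algebra_simps)
  next
    case (call p p\<^sub>1 q\<^sub>1 w\<^sub>1 t\<^sub>1 y\<^sub>1 p\<^sub>2 q\<^sub>2 w\<^sub>2 t\<^sub>2)
    obtain x where x: "valid x" "row x = p"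
      using row_surj[OF call(1)] by blast
    from edgeD[OF call(2)] obtain P Q stop where e: "edge A P Q w\<^sub>1 stop" "P \<in> pstates A" "Q \<in> pstates A"
      "p\<^sub>1 = code P" "q\<^sub>1 = code Q" "encode_stack_op gs stop = [t\<^sub>1, y\<^sub>1]" "stop \<in> stack_ops A"
      by blast
    from edgeD[OF call(3)] obtain P' Q' stop' where e': "edge A P' Q' w\<^sub>2 stop'" "P' \<in> pstates A"
      "Q' \<in> pstates A" "p\<^sub>2 = code P'" "q\<^sub>2 = code Q'" "encode_stack_op gs stop' = [t\<^sub>2, y\<^sub>1]"
      "stop' \<in> stack_ops A"
      by blast
    obtain g where g: "stop = Push g" "y\<^sub>1 = position gs g" "g \<in> alphabet A"
      using e(6,7) call(4) by (cases stop) (auto simp: stack_ops_def Let_def)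
    obtain h where h: "stop' = Pop h" "y\<^sub>1 = position gs h" "h \<in> alphabet A"
      using e'(6,7) call(5) by (cases stop') (auto simp: stack_ops_def Let_def)
    \<comment> \<open>The rule only compares positions; they determine the symbols because both lie
      in the alphabet. So the pop matches the push.\<close>
    have "g = h" using position_inj g h by simp
    have "flow A x P (a - 1)"
      using flowD[OF der_rule.IH(1) _ x(1) e(2)] call e x by (simp add: nonterm_def)
    moreover have "flow A (Some Q) P' (b - 1)"
      using flowD[OF der_rule.IH(2), of "Some Q" P'] call e e' by (simp add: nonterm_def valid_def)
    ultimately have "flow A x Q' (a - 1 + (b - 1) + (w\<^sub>1 + w\<^sub>2))"
      using flow_call e(1) e'(1) g(1) h(1) \<open>g = h\<close> by metis
    then show ?thesis
      using goal[of x Q'] call e' x by (simp add: nonterm_def algebra_simps)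
  qed
qed

theorem derives_iff_flow:
  assumes "valid x" "q \<in> pstates A"
  shows "derives (nonterm x q) v \<longleftrightarrow> flow A x q (v - 1)"
proof
  assume "derives (nonterm x q) v"
  from flow_derives[OF this] nonterm_eps[OF assms]
  have "\<exists>x' q'. nonterm x q = nonterm x' q' \<and> flow A x' q' (v - 1)"
    by (simp only: if_False)
  then obtain x' q' where "nonterm x q = nonterm x' q'" "flow A x' q' (v - 1)"
    by blast
  with nonterm_inj[of x q x' q'] assms flow_valid show "flow A x q (v - 1)" by metis
next
  assume "flow A x q (v - 1)"
  from derives_flow[OF this] show "derives (nonterm x q) v" by simp
qed

end

section \<open>The interval\<close>

definition max4 :: "(nat \<Rightarrow> int) \<Rightarrow> int" where
  "max4 V = max (V 0) (max (V 1) (max (V 2) (V 3)))"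

text \<open>The values in \<open>V\<close> are shifted by one: positivity means that the mode is
  reachable, and the right end is \<open>max4 V - 1\<close>. Modes 0 and 2 contribute the point 0;
  the right end is attained only in mode 1 or, if the set is \<open>{0}\<close>, in mode 0.\<close>

definition mk_desc :: "(nat \<Rightarrow> int) \<Rightarrow> int \<Rightarrow> interval_desc" where
  "mk_desc V b =
     (if max4 V > 0
      then Interval 0 (V 0 + V 2 > 0)
        (if max4 V \<ge> b then Unbounded else Bounded (of_int (max4 V - 1)) (V 0 = max4 V \<or> V 1 = max4 V))
      else EmptyInt)"

lemma encode_mk_desc:
  "encode_interval (mk_desc V b) =
     (if max4 V > 0
      then [1, 0, 1, of_bool (V 0 + V 2 > 0)] @
        (if max4 V \<ge> b then [0] else [1, max4 V - 1, 1, of_bool (V 0 = max4 V \<or> V 1 = max4 V)])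
      else [0])"
  by (simp add: mk_desc_def encode_rat_def del: of_int_diff)

lemma is_interval_describes: "describes I X \<Longrightarrow> is_interval X"
proof (cases I)
  case (Interval l lc r)
  moreover assume "describes I X"
  ultimately have X: "X = {x. left_ok l lc x \<and> right_ok r x}" by simp
  show ?thesis
    unfolding X is_interval_1 by (cases r) (auto split: if_splits)
qed simp

text \<open>A reachable mode other than 0 covers all points strictly between 0 and its sum. Only
  membership of 0 and of the right end needs separate care.\<close>

lemma describes_mk_desc:
  fixes V :: "nat \<Rightarrow> int" and R :: "nat \<Rightarrow> int \<Rightarrow> bool"
  assumes mode: "\<And>i S. R i S \<Longrightarrow> mode_ok i S"
    and nonneg: "\<And>i. V i \<ge> 0"
    and empty: "\<And>i S. V i = 0 \<Longrightarrow> \<not> R i S"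
    and attained: "\<And>i. 0 < V i \<Longrightarrow> V i < b \<Longrightarrow> R i (V i - 1)"
    and upper: "\<And>i S. V i < b \<Longrightarrow> R i S \<Longrightarrow> S < V i"
    and unbounded: "\<And>i a. V i \<ge> b \<Longrightarrow> \<exists>S > a. R i S"
  shows "describes (mk_desc V b) {c. \<exists>i S. R i S \<and> c \<in> vals i S}"
    (is "describes _ ?X")
proof -
  have le: "V i \<le> max4 V" if "i < 4" for i
    using less_4_cases[OF that] by (auto simp: max4_def)
  have "max4 V = V 0 \<or> max4 V = V 1 \<or> max4 V = V 2 \<or> max4 V = V 3"
    by (simp add: max4_def max_def)
  then obtain k where k: "k < 4" "V k = max4 V"
  proof (elim disjE)
  qed (use that[of 0] that[of 1] that[of 2] that[of 3] in simp_all)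
  have mode4: "i < 4" if "R i S" for i S
    using mode[OF that] by (simp add: mode_ok_def)
  have ex: "\<exists>S. R i S" if "V i > 0" for i
    using attained[of i] unbounded[of i 0] that by (cases "V i < b") auto
  have pos: "V i > 0" if "R i S" for i S
    using empty[of i S] nonneg[of i] that by (cases "V i = 0") auto
  have zero: "S = 0" if "R 0 S" for S
    using mode[OF that] by (simp add: mode_ok_def)
  have Spos: "S > 0" if "R i S" "i > 0" for i S
    using mode[OF that(1)] that(2) by (simp add: mode_ok_def)
  have zero_in: "0 \<in> ?X \<longleftrightarrow> V 0 + V 2 > 0"
  proof
    assume "0 \<in> ?X"
    then obtain i S where *: "R i S" "0 \<in> vals i S" by blast
    then have "i = 0 \<or> i = 2"
      by (auto simp: vals_def split: if_splits)
    then show "V 0 + V 2 > 0"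
      using pos[OF *(1)] nonneg[of 0] nonneg[of 2] by auto
  next
    assume "V 0 + V 2 > 0"
    then consider "V 0 > 0" | "V 2 > 0"
      using nonneg[of 0] nonneg[of 2] by linarith
    then show "0 \<in> ?X"
    proof cases
      case 1
      then obtain S where "R 0 S" using ex by blast
      moreover have "0 \<in> vals 0 S" by (simp add: vals_def)
      ultimately show ?thesis by blast
    next
      case 2
      then obtain S where "R 2 S" using ex by blast
      moreover from Spos[OF this] have "0 \<in> vals 2 S" by (simp add: vals_def)
      ultimately show ?thesis by blast
    qed
  qed
  have in_vals: "x \<in> vals i S" if "0 < x" "x < of_int S" "i > 0" for x i S
    using that by (simp add: vals_def)
  have le_S: "x \<le> of_int S" if "R i S" "x \<in> vals i S" for x i S
    using that zero[of S] by (auto simp: vals_def split: if_splits)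
  show ?thesis
  proof (cases "max4 V > 0")
    case False
    have "\<not> R i S" for i S
      using pos[of i S] le[of i] mode4[of i S] False by fastforce
    then show ?thesis using False by (simp add: mk_desc_def)
  next
    case True
    have ne: "?X \<noteq> {}"
    proof -
      obtain S where S: "R k S" using ex True k(2) by metis
      have "(if k = 0 then 0 else of_int S / 2) \<in> vals k S"
        using Spos[OF S] by (auto simp: vals_def)
      with S show ?thesis by blast
    qed
    have "x \<in> ?X \<longleftrightarrow> left_ok 0 (V 0 + V 2 > 0) x \<and> right_ok (if max4 V \<ge> b then Unbounded
        else Bounded (of_int (max4 V - 1)) (V 0 = max4 V \<or> V 1 = max4 V)) x" for x
    proof -
      consider "x < 0" | "x = 0" | "x > 0" by linarith
      then show ?thesis
      proof cases
        case 1
        then have "x \<notin> ?X" using vals_nonneg by force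
        with 1 show ?thesis by auto
      next
        case 2
        have "right_ok (if max4 V \<ge> b then Unbounded
          else Bounded (of_int (max4 V - 1)) (V 0 = max4 V \<or> V 1 = max4 V)) 0" if "V 0 + V 2 > 0"
        proof (cases "max4 V \<ge> b \<or> max4 V > 1")
          case True
          then show ?thesis by auto
        next
          case False
          \<comment> \<open>The right end is 0 here, so it must be marked as included. Mode 2 would
            need a positive sum, so the point 0 comes from mode 0, which attains the
            maximum.\<close>
          then have *: "max4 V = 1" using \<open>max4 V > 0\<close> by simp
          have "V 2 = 0"
          proof (rule ccontr)
            assume "V 2 \<noteq> 0"
            then obtain S where "R 2 S" using ex nonneg[of 2] by force
            then show False
              using Spos[of 2 S] upper[of 2 S] le[of 2] False * by force
          qed
          then have "V 0 = max4 V" using that * le[of 0] by simp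
          then show ?thesis using * by simp
        qed
        with zero_in 2 show ?thesis by auto
      next
        case 3
        show ?thesis
        proof (cases "max4 V \<ge> b")
          case True
          \<comment> \<open>Exceeding \<open>max 0\<close> as well as the ceiling forces a positive
            sum, which excludes mode 0.\<close>
          obtain S where S: "R k S" "S > max 0 \<lceil>x\<rceil>"
            using unbounded[of k "max 0 \<lceil>x\<rceil>"] True k(2) by auto
          have "k > 0"
            using zero[of S] S by (cases "k = 0") auto
          moreover have "x < of_int S"
            using S(2) by linarith
          ultimately have "x \<in> ?X"
            using in_vals[OF 3] S(1) by blast
          then show ?thesis using True 3 by auto
        next
          case False
          have Rk: "R k (max4 V - 1)"
            using attained[of k] k \<open>max4 V > 0\<close> False by simp
          have bound: "S \<le> max4 V - 1" if "R i S" for i S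
            using upper[of i S] le[OF mode4[OF that]] that False by force
          have iff: "x \<in> ?X \<longleftrightarrow> (if V 0 = max4 V \<or> V 1 = max4 V then x \<le> of_int (max4 V - 1)
              else x < of_int (max4 V - 1))"
          proof
            assume "x \<in> ?X"
            then obtain i S where *: "R i S" "x \<in> vals i S" by blast
            then have "x \<le> of_int S" using le_S by blast
            moreover have "real_of_int S \<le> of_int (max4 V - 1)"
              using bound[OF *(1)] by (simp only: of_int_le_iff)
            moreover have "x < of_int S \<or> i = 1"
              using *(2) 3 by (auto simp: vals_def split: if_splits)
            \<comment> \<open>A path whose sum equals the right end must belong to a maximising
              mode. As only mode 1 includes its own upper end at a positive \<open>x\<close>, this
              decides the inclusion flag.\<close>
            moreover have "S < max4 V - 1 \<or> V i = max4 V"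
              using upper[of i S] le[OF mode4[OF *(1)]] *(1) False bound[OF *(1)] by force
            ultimately show "if V 0 = max4 V \<or> V 1 = max4 V then x \<le> of_int (max4 V - 1)
              else x < of_int (max4 V - 1)"
              by (auto simp del: of_int_diff)
          next
            assume *: "if V 0 = max4 V \<or> V 1 = max4 V then x \<le> of_int (max4 V - 1)
              else x < of_int (max4 V - 1)"
            then have "0 < (of_int (max4 V - 1) :: real)"
              using 3 by (auto split: if_splits)
            then have M: "max4 V - 1 > 0"
              by (simp only: of_int_0_less_iff)
            have no0: "\<not> R 0 (max4 V - 1)"
              using zero[of "max4 V - 1"] M by auto
            show "x \<in> ?X"
            proof (cases "x < of_int (max4 V - 1)")
              case True
              have "k > 0" using Rk no0 by (cases "k = 0") auto
              then show ?thesis using in_vals[OF 3 True] Rk by blast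
            next
              case False
              then have "V 0 = max4 V \<or> V 1 = max4 V" "x = of_int (max4 V - 1)"
                using * by (auto split: if_splits)
              \<comment> \<open>Mode 0 admits only the sum 0, whereas the right end is positive
                here.\<close>
              moreover have "V 0 \<noteq> max4 V"
                using attained[of 0] no0 \<open>max4 V > 0\<close> \<open>\<not> b \<le> max4 V\<close> by auto
              ultimately have "R 1 (max4 V - 1)" "x \<in> vals 1 (max4 V - 1)"
                using attained[of 1] \<open>max4 V > 0\<close> \<open>\<not> b \<le> max4 V\<close> 3 by (auto simp: vals_def)
              then show ?thesis by blast
            qed
          qed
          show ?thesis unfolding iff using 3 False by (simp del: of_int_diff)
        qed
      qed
    qed
    then have "?X = {x. left_ok 0 (V 0 + V 2 > 0) x \<and> right_ok (if max4 V \<ge> b then Unbounded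
        else Bounded (of_int (max4 V - 1)) (V 0 = max4 V \<or> V 1 = max4 V)) x}"
      by blast
    with ne True show ?thesis
      unfolding mk_desc_def by (simp only: if_True describes.simps simp_thms)
  qed
qed

context coded_automaton
begin

text \<open>The vector of \<open>maxplus\<close> for \<open>Suc eps\<close> nonterminals, which
  explains the two round counts.\<close>

definition final :: "nat \<Rightarrow> int" where
  "final = (bump_round rs B ^^ Suc (Suc eps)) ((bump_round rs 0 ^^ Suc eps) D0)"

definition result :: "nat \<Rightarrow> int" where
  "result i = (if i < 4 then final (m * m + (4 * idx (acc_state A) + i)) else 0)"

theorem describes_result: "describes (mk_desc result B) (reach_values A)"
proof -
  define R where "R i S \<longleftrightarrow> flow A None (acc_state A, i) S" for i S
  have R_mode: "mode_ok i S" if "R i S" for i S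
    using flow_mode_ok[OF A] that by (simp add: R_def)
  have R4: "i < 4" if "R i S" for i S
    using R_mode[OF that] by (simp add: mode_ok_def)
  have res: "result i = final (nonterm None (acc_state A, i))" if "i < 4" for i
    using that by (simp add: result_def nonterm_def)
  have R: "derives (nonterm None (acc_state A, i)) v \<longleftrightarrow> R i (v - 1)" if "i < 4" for i v
    unfolding R_def using A that
    by (intro derives_iff_flow) (auto simp: valid_def pstates_def is_c1pvass_def)
  note mp = maxplus[folded final_def]
  show ?thesis
    unfolding reach_values_flow[OF A] R_def[symmetric]
  proof (rule describes_mk_desc)
    show "R i S \<Longrightarrow> mode_ok i S" for i S
      by (rule R_mode)
    show "0 \<le> result i" for i
      using mp(1) by (simp add: result_def)
    show "\<not> R i S" if "result i = 0" for i S
    proof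
      assume "R i S"
      from R4[OF this] have "\<not> derives (nonterm None (acc_state A, i)) (S + 1)"
        using mp(2) res that by simp
      then show False using R[OF R4[OF \<open>R i S\<close>]] \<open>R i S\<close> by simp
    qed
    show "R i (result i - 1)" if "0 < result i" "result i < B" for i
    proof -
      have i: "i < 4" using that(1) by (simp add: result_def split: if_splits)
      show ?thesis
        using mp(3)[of "nonterm None (acc_state A, i)"] that unfolding res[OF i] R[OF i] .
    qed
    show "S < result i" if "result i < B" "R i S" for i S
    proof -
      have i: "i < 4" using R4[OF that(2)] .
      have "derives (nonterm None (acc_state A, i)) (S + 1)"
        using R[OF i] that(2) by simp
      from mp(4)[OF _ this] show ?thesis using that(1) res[OF i] by simp
    qed
    show "\<exists>S > a. R i S" if "B \<le> result i" for i a
    proof -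
      have i: "i < 4" using that B_pos by (simp add: result_def split: if_splits)
      from mp(5)[of "nonterm None (acc_state A, i)" "a + 1"] that res[OF i] obtain v
        where "v > a + 1" "derives (nonterm None (acc_state A, i)) v" by auto
      then show ?thesis using R[OF i] by (intro exI[of _ "v - 1"]) simp
    qed
  qed
qed

end

section \<open>The program\<close>

text \<open>
  Variables: \<open>vN, vS, vF, vG\<close> are the four input parameters; \<open>vU, vW\<close> the current pair of states;
  \<open>vH, vZ, vO, vY\<close> the current table entry, at the end the four final values, with maximum \<open>vT\<close>;
  \<open>vE\<close> and \<open>vQ\<close> the numbers of edges and rules; \<open>vM\<close> is \<open>m\<close>; \<open>vP, vR\<close> are the current \<open>p\<close> and
  \<open>p * m\<close>; \<open>vI, vJ, vX\<close> loop indices; \<open>vK\<close> is the index of the empty word; \<open>vB\<close> the mark for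
  infinity, summed up in \<open>vA\<close>. Arrays: \<open>aEP, \<dots>, aEY\<close> hold the edges, \<open>aX, \<dots>, aC\<close> the rules, \<open>aRow\<close>
  the multiples of \<open>m\<close>, and \<open>aD, aD'\<close> the values before and after the current round.
\<close>

abbreviation (input) "vN \<equiv> (0::nat)"
abbreviation (input) "vS \<equiv> (1::nat)"
abbreviation (input) "vF \<equiv> (2::nat)"
abbreviation (input) "vG \<equiv> (3::nat)"
abbreviation (input) "vU \<equiv> (4::nat)"
abbreviation (input) "vW \<equiv> (5::nat)"
abbreviation (input) "vH \<equiv> (6::nat)"
abbreviation (input) "vZ \<equiv> (7::nat)"
abbreviation (input) "vO \<equiv> (8::nat)"
abbreviation (input) "vY \<equiv> (9::nat)"
abbreviation (input) "vE \<equiv> (10::nat)"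
abbreviation (input) "vM \<equiv> (11::nat)"
abbreviation (input) "vP \<equiv> (12::nat)"
abbreviation (input) "vR \<equiv> (13::nat)"
abbreviation (input) "vI \<equiv> (14::nat)"
abbreviation (input) "vJ \<equiv> (15::nat)"
abbreviation (input) "vQ \<equiv> (16::nat)"
abbreviation (input) "vK \<equiv> (17::nat)"
abbreviation (input) "vX \<equiv> (18::nat)"
abbreviation (input) "vT \<equiv> (19::nat)"
abbreviation (input) "vB \<equiv> (20::nat)"
abbreviation (input) "vA \<equiv> (21::nat)"

abbreviation (input) "aEP \<equiv> (2::nat)"
abbreviation (input) "aEQ \<equiv> (3::nat)"
abbreviation (input) "aEW \<equiv> (4::nat)"
abbreviation (input) "aET \<equiv> (5::nat)"
abbreviation (input) "aEY \<equiv> (6::nat)"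
abbreviation (input) "aRow \<equiv> (7::nat)"
abbreviation (input) "aX \<equiv> (8::nat)"
abbreviation (input) "aY \<equiv> (9::nat)"
abbreviation (input) "aZ \<equiv> (10::nat)"
abbreviation (input) "aC \<equiv> (11::nat)"
abbreviation (input) "aD \<equiv> (12::nat)"
abbreviation (input) "aD' \<equiv> (13::nat)"

abbreviation (input) incr :: "nat \<Rightarrow> com" where
  "incr v \<equiv> Assign v (Plus (Var v) (Const 1))"

abbreviation (input) times4 :: "aexp \<Rightarrow> aexp" where
  "times4 e \<equiv> Plus (Plus e e) (Plus e e)"

text \<open>Keeping \<open>ok\<close> is part of the frame, so each execution lemma also certifies
  that its loops stay within \<open>L\<close> and that the input suffices. The remaining input is
  left out, since reading changes it.\<close>

definition frame :: "nat set \<Rightarrow> nat set \<Rightarrow> state \<Rightarrow> state \<Rightarrow> bool" where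
  "frame W K s s' \<longleftrightarrow> (\<forall>v. v \<notin> W \<longrightarrow> mem s' 0 v = mem s 0 v) \<and>
     (\<forall>k. k \<noteq> 0 \<longrightarrow> k \<notin> K \<longrightarrow> mem s' k = mem s k) \<and> out s' = out s \<and> ok s' = ok s"

lemma frame_refl [simp]: "frame W K s s"
  by (simp add: frame_def)

lemma frame_trans: "frame W K s s' \<Longrightarrow> frame W K s' s'' \<Longrightarrow> frame W K s s''"
  by (simp add: frame_def)

lemma frame_mono: "frame W K s s' \<Longrightarrow> W \<subseteq> W' \<Longrightarrow> K \<subseteq> K' \<Longrightarrow> frame W' K' s s'"
  unfolding frame_def by blast

lemma frame_var: "frame W K s s' \<Longrightarrow> v \<notin> W \<Longrightarrow> mem s' 0 v = mem s 0 v"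
  by (simp add: frame_def)

lemma upd_apply [simp]: "upd k i x M k' i' = (if k' = k \<and> i' = i then x else M k' i')"
  by (simp add: upd_def)

lemma upd_other [simp]: "k' \<noteq> k \<Longrightarrow> upd k i x M k' = M k'"
  by (simp add: upd_def)

lemma exec_Loop:
  assumes "aval e (mem s) = int n" "n \<le> L"
  shows "exec L (Loop e c) s = (exec L c ^^ n) s"
  using assms by simp

lemma funpow_inv:
  assumes "I 0 s" "\<And>i s. i < n \<Longrightarrow> I i s \<Longrightarrow> I (Suc i) (f s)"
  shows "I n ((f ^^ n) s)"
proof -
  have "i \<le> n \<Longrightarrow> I i ((f ^^ i) s)" for i
    by (induction i) (auto simp: assms)
  then show ?thesis by simp
qed

declare exec.simps(8) [simp del]

section \<open>Reading the transition table into an edge list\<close>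

definition edges_in :: "(nat \<Rightarrow> nat \<Rightarrow> int) \<Rightarrow> coded_edge list \<Rightarrow> bool" where
  "edges_in M es \<longleftrightarrow> M 0 vE = int (length es) \<and>
     (\<forall>k < length es. es ! k = (nat (M aEP k), nat (M aEQ k), M aEW k, M aET k, M aEY k) \<and>
        M aEP k \<ge> 0 \<and> M aEQ k \<ge> 0)"

definition emit_edge :: "nat \<times> nat \<Rightarrow> com" where
  "emit_edge ij =
     Store aEP (Var vE) (Plus (times4 (Var vU)) (Const (int (fst ij)))) ;;
     Store aEQ (Var vE) (Plus (times4 (Var vW)) (Const (int (snd ij)))) ;;
     Store aEW (Var vE) (Var vT) ;;
     Store aET (Var vE) (Var vO) ;;
     Store aEY (Var vE) (Var vY) ;;
     incr vE"

lemma exec_emit_edge: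
  assumes "edges_in (mem s) es" "mem s 0 vU = int u" "mem s 0 vW = int v"
    and s'_def: "s' = exec L (emit_edge ij) s"
  shows "edges_in (mem s')
      (es @ [(4 * u + fst ij, 4 * v + snd ij, mem s 0 vT, mem s 0 vO, mem s 0 vY)])"
    and "frame {vE} {2..6} s s'" and "inp s' = inp s"
  using assms(1-3) unfolding s'_def edges_in_def
  by (auto simp: emit_edge_def frame_def nth_append less_Suc_eq nat_add_distrib nat_eq_iff)

fun emit_edges :: "(nat \<times> nat) list \<Rightarrow> com" where
  "emit_edges [] = Skip"
| "emit_edges (ij # ijs) = emit_edge ij ;; emit_edges ijs"

lemma exec_emit_edges:
  assumes "edges_in (mem s) es" "mem s 0 vU = int u" "mem s 0 vW = int v"
    and s'_def: "s' = exec L (emit_edges ijs) s"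
  shows "edges_in (mem s')
      (es @ map (\<lambda>(i, j). (4 * u + i, 4 * v + j, mem s 0 vT, mem s 0 vO, mem s 0 vY)) ijs) \<and>
    frame {vE} {2..6} s s' \<and> inp s' = inp s"
  using assms(1-3) unfolding s'_def
proof (induction ijs arbitrary: s es)
  case Nil
  then show ?case by simp
next
  case (Cons ij ijs)
  note 1 = exec_emit_edge[OF Cons.prems refl, of L ij]
  note fr = frame_var[OF 1(2)]
  have "mem (exec L (emit_edge ij) s) 0 vU = int u" "mem (exec L (emit_edge ij) s) 0 vW = int v"
    using Cons.prems fr by simp_all
  note 2 = Cons.IH[OF 1(1) this]
  show ?case
    using 1 2 fr frame_trans[OF 1(2)] by (simp add: case_prod_unfold)
qed

text \<open>The table \<open>modes\<close> is expanded into the program text, with one branch per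
  sign of the update; \<open>vT\<close> holds the positive part of the update.\<close>

definition read_entry :: com where
  "read_entry =
     Read vH ;; Read vZ ;; Read vO ;; Read vY ;;
     IfPos (Var vH)
       (IfPos (Var vZ) (Assign vT (Var vZ) ;; emit_edges [(0, 1), (1, 1), (2, 3), (3, 3)])
         (Assign vT (Const 0) ;;
          IfPos (Minus (Const 0) (Var vZ)) (emit_edges [(1, 2), (2, 2), (3, 2)])
            (emit_edges [(0, 0), (1, 1), (2, 2), (3, 3)])))
       Skip ;;
     incr vW"

lemma exec_read_entry:
  assumes "edges_in (mem s) es" "mem s 0 vU = int u" "mem s 0 vW = int v"
    and "inp s = xs @ I" "length xs = 4"
    and s'_def: "s' = exec L read_entry s"
  shows "edges_in (mem s') (es @ entry_edges u v xs) \<and> inp s' = I \<and>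
    mem s' 0 vW = int (Suc v) \<and> frame {vW, vH, vZ, vO, vY, vT, vE} {2..6} s s'"
proof -
  obtain h z t y where xs: "xs = [h, z, t, y]"
    using assms(5) by (auto simp: numeral_eq_Suc length_Suc_conv)
  define s1 where "s1 = exec L (Read vH ;; Read vZ ;; Read vO ;; Read vY) s"
  have s1: "mem s1 0 vH = h" "mem s1 0 vZ = z" "mem s1 0 vO = t" "mem s1 0 vY = y" "inp s1 = I"
    "frame {vH, vZ, vO, vY} {} s s1"
    using assms(4) by (simp_all add: s1_def xs frame_def)
  have s1': "edges_in (mem s1) es" "mem s1 0 vU = int u" "mem s1 0 vW = int v"
    using assms(1-3) s1(6) by (auto simp: frame_def edges_in_def)
  define c where "c = IfPos (Var vH)
       (IfPos (Var vZ) (Assign vT (Var vZ) ;; emit_edges [(0, 1), (1, 1), (2, 3), (3, 3)])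
         (Assign vT (Const 0) ;;
          IfPos (Minus (Const 0) (Var vZ)) (emit_edges [(1, 2), (2, 2), (3, 2)])
            (emit_edges [(0, 0), (1, 1), (2, 2), (3, 3)])))
       Skip"
  define s2 where "s2 = exec L c s1"
  have emit: "edges_in (mem s2) (es @ map (\<lambda>(i, j). (4 * u + i, 4 * v + j, w, t, y)) ijs) \<and>
      inp s2 = I \<and> frame {vE, vT} {2..6} s1 s2"
    if "s2 = exec L (emit_edges ijs) (exec L (Assign vT (Const w)) s1)" for w ijs
  proof -
    let ?s = "exec L (Assign vT (Const w)) s1"
    have pre: "edges_in (mem ?s) es" "mem ?s 0 vU = int u" "mem ?s 0 vW = int v"
      using s1' by (simp_all add: edges_in_def)
    have fr: "frame {vE, vT} {2..6} s1 ?s"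
      by (simp add: frame_def)
    from exec_emit_edges[OF pre refl, of L ijs] frame_trans[OF fr] s1(3,4,5) show ?thesis
      unfolding that by (auto intro: frame_mono)
  qed
  have 2: "edges_in (mem s2) (es @ entry_edges u v xs) \<and> inp s2 = I \<and> frame {vE, vT} {2..6} s1 s2"
  proof (cases "h > 0")
    case False
    then show ?thesis
      using s1 s1' by (simp add: s2_def c_def entry_edges_def xs)
  next
    case h: True
    consider "z > 0" | "z < 0" | "z = 0" by linarith
    then show ?thesis
    proof cases
      case 1
      with emit[of "[(0, 1), (1, 1), (2, 3), (3, 3)]" z] h show ?thesis
        by (simp add: s2_def c_def s1 entry_edges_def xs modes_def del: emit_edges.simps)
    next
      case 2
      with emit[of "[(1, 2), (2, 2), (3, 2)]" 0] h show ?thesis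
        by (simp add: s2_def c_def s1 entry_edges_def xs modes_def del: emit_edges.simps)
    next
      case 3
      with emit[of "[(0, 0), (1, 1), (2, 2), (3, 3)]" 0] h show ?thesis
        by (simp add: s2_def c_def s1 entry_edges_def xs modes_def del: emit_edges.simps)
    qed
  qed
  have "s' = exec L (incr vW) s2"
    by (simp add: s'_def read_entry_def s2_def c_def s1_def)
  with 2 s1(6) s1'(3) show ?thesis
    by (auto simp: frame_def edges_in_def)
qed

definition read_edges :: com where
  "read_edges = Loop (Var vN) (Assign vW (Const 0) ;; Loop (Var vN) read_entry ;; incr vU)"

lemma exec_read_edges:
  assumes "edges_in (mem s) []" "mem s 0 vU = 0" "mem s 0 vN = int n" "n \<le> L"
    and "inp s = concat (map (\<lambda>u. concat (map (\<lambda>v. xs u v) [0..<n])) [0..<n])"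
    and len: "\<And>u v. length (xs u v) = 4"
    and s'_def: "s' = exec L read_edges s"
  shows "edges_in (mem s')
      (concat (map (\<lambda>u. concat (map (\<lambda>v. entry_edges u v (xs u v)) [0..<n])) [0..<n])) \<and>
    frame {vU, vW, vH, vZ, vO, vY, vT, vE} {2..6} s s'"
proof -
  \<comment> \<open>Unread and processed parts of a row; the loop invariants equate the remaining
    input with the unread part.\<close>
  define rowx where "rowx u k = concat (map (\<lambda>v. xs u v) [k..<n])" for u k
  define rowe where "rowe u k = concat (map (\<lambda>v. entry_edges u v (xs u v)) [0..<k])" for u k
  let ?W = "{vU, vW, vH, vZ, vO, vY, vT, vE}"
  define body where "body = (Assign vW (Const 0) ;; Loop (Var vN) read_entry ;; incr vU)"
  have inner: "edges_in (mem t') (es @ rowe u n) \<and> inp t' = I \<and> mem t' 0 vU = int (Suc u) \<and>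
      frame ?W {2..6} t t'"
    if t: "edges_in (mem t) es" "mem t 0 vU = int u" "mem t 0 vN = int n" "inp t = rowx u 0 @ I"
      and t': "t' = exec L body t" for t t' es u I
  proof -
    define t1 where "t1 = exec L (Assign vW (Const 0)) t"
    have t1: "edges_in (mem t1) es" "mem t1 0 vU = int u" "mem t1 0 vN = int n" "mem t1 0 vW = 0"
      "inp t1 = rowx u 0 @ I" "frame ?W {2..6} t t1"
      using t by (simp_all add: t1_def edges_in_def frame_def)
    define t2 where "t2 = (exec L read_entry ^^ n) t1"
    define inv where "inv v t2 \<longleftrightarrow> edges_in (mem t2) (es @ rowe u v) \<and> mem t2 0 vU = int u \<and>
      mem t2 0 vW = int v \<and> inp t2 = rowx u v @ I \<and> frame ?W {2..6} t t2" for v t2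
    have "inv n t2"
      unfolding t2_def
    proof (rule funpow_inv)
      show "inv 0 t1"
        using t1 by (simp add: inv_def rowe_def)
      show "inv (Suc v) (exec L read_entry t2)" if "v < n" "inv v t2" for v t2
      proof -
        have "rowx u v = xs u v @ rowx u (Suc v)"
          using \<open>v < n\<close> by (simp add: rowx_def upt_conv_Cons)
        then have "inp t2 = xs u v @ (rowx u (Suc v) @ I)"
          using \<open>inv v t2\<close> by (simp add: inv_def)
        from exec_read_entry[OF _ _ _ this len refl, of "es @ rowe u v" u v L] \<open>inv v t2\<close>
        have 1: "edges_in (mem (exec L read_entry t2)) (es @ rowe u (Suc v))"
            "inp (exec L read_entry t2) = rowx u (Suc v) @ I"
            "mem (exec L read_entry t2) 0 vW = int (Suc v)"
            "frame {vW, vH, vZ, vO, vY, vT, vE} {2..6} t2 (exec L read_entry t2)"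
          by (auto simp: inv_def rowe_def)
        have "frame ?W {2..6} t (exec L read_entry t2)"
          by (rule frame_trans[OF _ frame_mono[OF 1(4)]]) (use \<open>inv v t2\<close> in \<open>auto simp: inv_def\<close>)
        moreover have "mem (exec L read_entry t2) 0 vU = int u"
          using frame_var[OF 1(4), of vU] \<open>inv v t2\<close> by (simp add: inv_def)
        ultimately show ?thesis
          using 1 by (simp add: inv_def)
      qed
    qed
    moreover have "t' = exec L (incr vU) t2"
      using exec_Loop[of "Var vN" t1 n L read_entry] t1(3) \<open>n \<le> L\<close> unfolding t' body_def
      by (simp add: t2_def t1_def)
    ultimately show ?thesis
      by (auto simp: inv_def frame_def edges_in_def rowx_def)
  qed
  define tail where "tail k = concat (map (\<lambda>u. rowx u 0) [k..<n])" for k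
  define inv where "inv u t \<longleftrightarrow> edges_in (mem t) (concat (map (\<lambda>u. rowe u n) [0..<u])) \<and>
    mem t 0 vU = int u \<and> mem t 0 vN = int n \<and> inp t = tail u \<and> frame ?W {2..6} s t" for u t
  have "inv n ((exec L body ^^ n) s)"
  proof (rule funpow_inv)
    show "inv 0 s"
      using assms by (simp add: inv_def tail_def rowx_def)
    show "inv (Suc u) (exec L body t)" if "u < n" "inv u t" for u t
    proof -
      have "tail u = rowx u 0 @ tail (Suc u)"
        using \<open>u < n\<close> by (simp add: tail_def upt_conv_Cons)
      with \<open>inv u t\<close> inner[of t "concat (map (\<lambda>u. rowe u n) [0..<u])" u "tail (Suc u)"]
      have 1: "edges_in (mem (exec L body t)) (concat (map (\<lambda>u. rowe u n) [0..<Suc u]))"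
        "inp (exec L body t) = tail (Suc u)" "mem (exec L body t) 0 vU = int (Suc u)"
        "frame ?W {2..6} t (exec L body t)"
        by (auto simp: inv_def)
      then show ?thesis
        using \<open>inv u t\<close> frame_trans frame_var[OF 1(4), of vN] unfolding inv_def by auto
    qed
  qed
  moreover have "s' = (exec L body ^^ n) s"
    using exec_Loop[of "Var vN" s n L] assms(3,4) by (simp add: s'_def read_edges_def body_def)
  ultimately show ?thesis
    by (simp add: inv_def rowe_def)
qed

section \<open>Generating the grammar rules\<close>

definition rules_in :: "(nat \<Rightarrow> nat \<Rightarrow> int) \<Rightarrow> rule list \<Rightarrow> bool" where
  "rules_in M rs \<longleftrightarrow> M 0 vQ = int (length rs) \<and>
     (\<forall>k < length rs. rs ! k = (nat (M aX k), nat (M aY k), nat (M aZ k), M aC k) \<and>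
        M aX k \<ge> 0 \<and> M aY k \<ge> 0 \<and> M aZ k \<ge> 0)"

definition emit_rule :: "aexp \<Rightarrow> aexp \<Rightarrow> aexp \<Rightarrow> aexp \<Rightarrow> com" where
  "emit_rule a b c d =
     Store aX (Var vQ) a ;; Store aY (Var vQ) b ;; Store aZ (Var vQ) c ;; Store aC (Var vQ) d ;; incr vQ"

text \<open>The expressions are evaluated between stores to arrays 8 to 11. They are therefore
  required to have the right value in every memory that agrees with the initial one on the lower
  arrays.\<close>

lemma exec_emit_rule:
  assumes "rules_in (mem s) rs"
    and "\<And>M. (\<forall>k < 8. M k = mem s k) \<Longrightarrow>
      aval a M = int x \<and> aval b M = int y \<and> aval c M = int z \<and> aval d M = w"
  shows "rules_in (mem (exec L (emit_rule a b c d) s)) (rs @ [(x, y, z, w)]) \<and>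
    frame {vQ} {8..11} s (exec L (emit_rule a b c d) s)"
proof -
  define q where "q = length rs"
  have q: "mem s 0 vQ = int q"
    using assms(1) by (simp add: rules_in_def q_def)
  have "aval a (mem s) = int x" "aval b (upd aX q (int x) (mem s)) = int y"
    "aval c (upd aY q (int y) (upd aX q (int x) (mem s))) = int z"
    "aval d (upd aZ q (int z) (upd aY q (int y) (upd aX q (int x) (mem s)))) = w"
    using assms(2) by simp_all
  then have "exec L (emit_rule a b c d) s =
    s\<lparr>mem := upd 0 vQ (int q + 1) (upd aC q w (upd aZ q (int z) (upd aY q (int y) (upd aX q (int x) (mem s)))))\<rparr>"
    using q by (simp add: emit_rule_def)
  then show ?thesis
    using assms(1) unfolding rules_in_def q_def
    by (simp add: frame_def nth_append less_Suc_eq all_conj_distrib) (auto simp: fun_eq_iff)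
qed

text \<open>Products \<open>p * m\<close> are tabulated by repeated addition, since the machine has
  no multiplication.\<close>

definition make_rows :: com where
  "make_rows =
     Assign vM (times4 (Var vN)) ;; Assign vX (Const 0) ;; Assign vT (Const 0) ;;
     Loop (Plus (Var vM) (Const 1))
       (Store aRow (Var vX) (Var vT) ;; Assign vT (Plus (Var vT) (Var vM)) ;; incr vX) ;;
     Assign vK (Plus (Rd aRow (Var vM)) (Var vM))"

lemma exec_make_rows:
  assumes "mem s 0 vN = int n" "m = 4 * n" "Suc m \<le> L"
    and s'_def: "s' = exec L make_rows s"
  shows "mem s' 0 vM = int m \<and> (\<forall>p \<le> m. mem s' aRow p = int (p * m)) \<and>
    mem s' 0 vK = int (m * m + m) \<and> frame {vM, vX, vT, vK} {aRow} s s'"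
proof -
  define s1 where "s1 = exec L (Assign vM (times4 (Var vN)) ;; Assign vX (Const 0) ;; Assign vT (Const 0)) s"
  define c where "c = (Store aRow (Var vX) (Var vT) ;; Assign vT (Plus (Var vT) (Var vM)) ;; incr vX)"
  have s1: "mem s1 0 vM = int m" "mem s1 0 vX = 0" "mem s1 0 vT = 0" "frame {vM, vX, vT, vK} {aRow} s s1"
    using assms(1,2) by (simp_all add: s1_def frame_def)
  define inv where "inv k t \<longleftrightarrow> mem t 0 vM = int m \<and> mem t 0 vX = int k \<and> mem t 0 vT = int (k * m) \<and>
    (\<forall>p < k. mem t aRow p = int (p * m)) \<and> frame {vM, vX, vT, vK} {aRow} s t" for k t
  have "inv (Suc m) ((exec L c ^^ Suc m) s1)"
  proof (rule funpow_inv)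
    show "inv 0 s1"
      using s1 by (simp add: inv_def)
    show "inv (Suc k) (exec L c t)" if "inv k t" for k t
      using that by (auto simp: inv_def c_def frame_def less_Suc_eq algebra_simps)
  qed
  moreover have "exec L (Loop (Plus (Var vM) (Const 1)) c) s1 = (exec L c ^^ Suc m) s1"
    using s1(1) assms(3) by (intro exec_Loop) auto
  ultimately have inv: "inv (Suc m) (exec L (Loop (Plus (Var vM) (Const 1)) c) s1)"
    by simp
  have "s' = exec L (Assign vK (Plus (Rd aRow (Var vM)) (Var vM))) (exec L (Loop (Plus (Var vM) (Const 1)) c) s1)"
    by (simp add: s'_def make_rows_def c_def s1_def)
  with inv show ?thesis
    by (simp add: inv_def frame_def less_Suc_eq_le)
qed

definition env :: "nat \<Rightarrow> nat \<Rightarrow> coded_edge list \<Rightarrow> state \<Rightarrow> bool" where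
  "env m st es s \<longleftrightarrow> edges_in (mem s) es \<and> mem s 0 vM = int m \<and>
     (\<forall>p \<le> m. mem s aRow p = int (p * m)) \<and> mem s 0 vK = int (m * m + m) \<and> mem s 0 vS = int st"

lemma env_frame:
  "env m st es s \<Longrightarrow> frame {vQ, vJ, vI, vP, vR} {8..11} s s' \<Longrightarrow> env m st es s'"
  by (simp add: env_def edges_in_def frame_def)

text \<open>Equality of the stack symbols is tested by finding neither difference positive.\<close>

definition call_body :: com where
  "call_body =
     IfPos (Minus (Rd aET (Var vJ)) (Const 1))
       (IfPos (Minus (Rd aEY (Var vI)) (Rd aEY (Var vJ))) Skip
         (IfPos (Minus (Rd aEY (Var vJ)) (Rd aEY (Var vI))) Skip
           (emit_rule (Plus (Var vR) (Rd aEQ (Var vJ))) (Plus (Var vR) (Rd aEP (Var vI)))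
             (Plus (Rd aRow (Rd aEQ (Var vI))) (Rd aEP (Var vJ)))
             (Plus (Rd aEW (Var vI)) (Rd aEW (Var vJ))))))
       Skip ;;
     incr vJ"

lemma exec_call_body:
  assumes env: "env m st es s" and R: "mem s 0 vR = int (p * m)"
    and i: "mem s 0 vI = int i" "i < length es" and j: "mem s 0 vJ = int j" "j < length es"
    and rs: "rules_in (mem s) rs" and q: "\<And>p q w t y. (p, q, w, t, y) \<in> set es \<Longrightarrow> q < m"
    and s'_def: "s' = exec L call_body s"
  shows "rules_in (mem s') (rs @ call_rules m p (es ! i) (es ! j)) \<and> mem s' 0 vJ = int (Suc j) \<and>
    frame {vQ, vJ} {8..11} s s'"
proof -
  obtain p1 q1 w1 t1 y1 where e1: "es ! i = (p1, q1, w1, t1, y1)" by (cases "es ! i")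
  obtain p2 q2 w2 t2 y2 where e2: "es ! j = (p2, q2, w2, t2, y2)" by (cases "es ! j")
  have m1: "mem s aEP i = int p1" "mem s aEQ i = int q1" "mem s aEW i = w1" "mem s aET i = t1" "mem s aEY i = y1"
    using env i e1 by (auto simp: env_def edges_in_def)
  have m2: "mem s aEP j = int p2" "mem s aEQ j = int q2" "mem s aEW j = w2" "mem s aET j = t2" "mem s aEY j = y2"
    using env j e2 by (auto simp: env_def edges_in_def)
  have "q1 < m"
    using q nth_mem[OF i(2)] unfolding e1 by blast
  then have row: "mem s aRow q1 = int (q1 * m)"
    using env by (simp add: env_def)
  let ?c = "emit_rule (Plus (Var vR) (Rd aEQ (Var vJ))) (Plus (Var vR) (Rd aEP (Var vI)))
             (Plus (Rd aRow (Rd aEQ (Var vI))) (Rd aEP (Var vJ)))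
             (Plus (Rd aEW (Var vI)) (Rd aEW (Var vJ)))"
  have *: "rules_in (mem (exec L ?c s)) (rs @ [(p * m + q2, p * m + p1, q1 * m + p2, w1 + w2)]) \<and>
    frame {vQ} {8..11} s (exec L ?c s)"
    by (rule exec_emit_rule[OF rs]) (simp add: i j m1 m2 R row)
  define s1 where "s1 = (if t2 > 1 \<and> y1 = y2 then exec L ?c s else s)"
  have "rules_in (mem s1) (rs @ call_rules m p (es ! i) (es ! j)) \<and> frame {vQ} {8..11} s s1"
    using * rs by (simp add: s1_def e1 e2)
  moreover have "s' = exec L (incr vJ) s1"
    unfolding s'_def call_body_def s1_def using i j m1 m2 by simp
  ultimately show ?thesis
    using j by (auto simp: frame_def rules_in_def)
qed

definition edge_body :: com where
  "edge_body =
     IfPos (Rd aET (Var vI))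
       (IfPos (Minus (Const 2) (Rd aET (Var vI)))
         (IfPos (Minus (Var vM) (Var vP)) Skip
           (emit_rule (Plus (Var vR) (Rd aEQ (Var vI))) (Plus (Var vR) (Rd aEP (Var vI))) (Var vK) (Rd aEW (Var vI))) ;;
          Assign vJ (Const 0) ;; Loop (Var vE) call_body)
         Skip)
       (emit_rule (Plus (Var vR) (Rd aEQ (Var vI))) (Plus (Var vR) (Rd aEP (Var vI))) (Var vK) (Rd aEW (Var vI))) ;;
     incr vI"

lemma exec_call_loop:
  assumes env: "env m st es s" and R: "mem s 0 vR = int (p * m)"
    and i: "mem s 0 vI = int i" "i < length es" and L: "length es \<le> L"
    and rs: "rules_in (mem s) rs" and q: "\<And>p q w t y. (p, q, w, t, y) \<in> set es \<Longrightarrow> q < m"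
    and s'_def: "s' = exec L (Assign vJ (Const 0) ;; Loop (Var vE) call_body) s"
  shows "rules_in (mem s') (rs @ concat (map (call_rules m p (es ! i)) es)) \<and> frame {vQ, vJ} {8..11} s s'"
proof -
  define s1 where "s1 = exec L (Assign vJ (Const 0)) s"
  define inv where "inv j t \<longleftrightarrow> rules_in (mem t) (rs @ concat (map (call_rules m p (es ! i)) (take j es))) \<and>
    mem t 0 vJ = int j \<and> frame {vQ, vJ} {8..11} s t" for j t
  have "inv (length es) ((exec L call_body ^^ length es) s1)"
  proof (rule funpow_inv)
    show "inv 0 s1"
      using rs by (simp add: inv_def s1_def rules_in_def frame_def)
    show "inv (Suc j) (exec L call_body t)" if "j < length es" "inv j t" for j t
    proof -
      have fr: "frame {vQ, vJ} {8..11} s t"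
        using that(2) by (simp add: inv_def)
      have "env m st es t"
        by (rule env_frame[OF env frame_mono[OF fr]]) auto
      moreover have "mem t 0 vR = int (p * m)" "mem t 0 vI = int i"
        using R i frame_var[OF fr] by simp_all
      ultimately have 1: "rules_in (mem (exec L call_body t))
          ((rs @ concat (map (call_rules m p (es ! i)) (take j es))) @ call_rules m p (es ! i) (es ! j)) \<and>
        mem (exec L call_body t) 0 vJ = int (Suc j) \<and> frame {vQ, vJ} {8..11} t (exec L call_body t)"
        using that i(2) q by (intro exec_call_body) (auto simp: inv_def)
      then show ?thesis
        using frame_trans[OF fr] that(1) by (simp add: inv_def take_Suc_conv_app_nth)
    qed
  qed
  moreover have "s' = (exec L call_body ^^ length es) s1"
    using exec_Loop[of "Var vE" s1 "length es" L call_body] env L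
    by (simp add: s'_def s1_def env_def edges_in_def)
  ultimately show ?thesis by (simp add: inv_def)
qed

lemma exec_edge_body:
  assumes env: "env m st es s" and R: "mem s 0 vR = int (p * m)" "mem s 0 vP = int p" "p \<le> m"
    and i: "mem s 0 vI = int i" "i < length es" and L: "length es \<le> L"
    and rs: "rules_in (mem s) rs" and q: "\<And>p q w t y. (p, q, w, t, y) \<in> set es \<Longrightarrow> q < m"
    and s'_def: "s' = exec L edge_body s"
  shows "rules_in (mem s') (rs @ edge_rules m es p (es ! i)) \<and> mem s' 0 vI = int (Suc i) \<and>
    frame {vQ, vJ, vI} {8..11} s s'"
proof -
  obtain p1 q1 w1 t1 y1 where e1: "es ! i = (p1, q1, w1, t1, y1)" by (cases "es ! i")
  have m1: "mem s aEP i = int p1" "mem s aEQ i = int q1" "mem s aEW i = w1" "mem s aET i = t1" "mem s aEY i = y1"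
    using env i e1 by (auto simp: env_def edges_in_def)
  define c where "c = emit_rule (Plus (Var vR) (Rd aEQ (Var vI))) (Plus (Var vR) (Rd aEP (Var vI))) (Var vK) (Rd aEW (Var vI))"
  have c: "rules_in (mem (exec L c s)) (rs @ [(p * m + q1, p * m + p1, m * m + m, w1)]) \<and>
    frame {vQ} {8..11} s (exec L c s)"
    unfolding c_def using env by (intro exec_emit_rule[OF rs]) (simp add: i m1 R env_def)
  define b where "b = (Assign vJ (Const 0) ;; Loop (Var vE) call_body)"
  define s1 where "s1 = exec L (IfPos (Minus (Var vM) (Var vP)) Skip c) s"
  have s1: "rules_in (mem s1) (rs @ (if p < m then [] else [(p * m + q1, p * m + p1, m * m + m, w1)])) \<and>
    frame {vQ} {8..11} s s1"
    using c rs env R by (auto simp: s1_def env_def)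
  have fr: "frame {vQ} {8..11} s s1" using s1 by simp
  have "rules_in (mem (exec L b s1)) ((rs @ (if p < m then [] else [(p * m + q1, p * m + p1, m * m + m, w1)])) @
      concat (map (call_rules m p (es ! i)) es)) \<and> frame {vQ, vJ} {8..11} s1 (exec L b s1)"
  proof (rule exec_call_loop)
    show "env m st es s1"
      by (rule env_frame[OF env frame_mono[OF fr]]) auto
    show "mem s1 0 vR = int (p * m)" "mem s1 0 vI = int i"
      using R i frame_var[OF fr] by simp_all
  qed (use s1 i L q in \<open>auto simp: b_def\<close>)
  then have call: "rules_in (mem (exec L b s1)) ((rs @ (if p < m then [] else [(p * m + q1, p * m + p1, m * m + m, w1)])) @
      concat (map (call_rules m p (es ! i)) es)) \<and> frame {vQ, vJ} {8..11} s (exec L b s1)"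
    using frame_trans[OF frame_mono[OF fr]] by auto
  define s2 where "s2 = (if t1 > 0 then if t1 < 2 then exec L b s1 else s else exec L c s)"
  have "rules_in (mem s2) (rs @ edge_rules m es p (es ! i)) \<and> frame {vQ, vJ} {8..11} s s2"
  proof -
    consider "t1 \<le> 0" | "t1 > 0" "t1 < 2" | "t1 \<ge> 2" by linarith
    then show ?thesis
    proof cases
      case 1
      then show ?thesis using c frame_mono[of "{vQ}" "{8..11}"] by (auto simp: s2_def e1)
    next
      case 2
      then show ?thesis using call by (simp add: s2_def e1)
    next
      case 3
      then show ?thesis using rs by (simp add: s2_def e1)
    qed
  qed
  moreover have "s' = exec L (incr vI) s2"
    using i m1 unfolding s'_def edge_body_def c_def[symmetric] s2_def s1_def b_def by simp
  ultimately show ?thesis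
    using i by (auto simp: frame_def rules_in_def)
qed

definition row_body :: com where
  "row_body =
     Assign vR (Rd aRow (Var vP)) ;;
     IfPos (Minus (Var vM) (Var vP))
       (emit_rule (Plus (Var vR) (Var vP)) (Var vK) (Var vK) (Const 0))
       (emit_rule (Plus (Var vR) (times4 (Var vS))) (Var vK) (Var vK) (Const 0)) ;;
     Assign vI (Const 0) ;; Loop (Var vE) edge_body ;; incr vP"

lemma exec_row_body:
  assumes env: "env m st es s" and p: "mem s 0 vP = int p" "p \<le> m" and L: "length es \<le> L"
    and rs: "rules_in (mem s) rs" and q: "\<And>p q w t y. (p, q, w, t, y) \<in> set es \<Longrightarrow> q < m"
    and s'_def: "s' = exec L row_body s"
  shows "rules_in (mem s') (rs @ row_rules m (4 * st) es p) \<and> mem s' 0 vP = int (Suc p) \<and>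
    frame {vQ, vJ, vI, vP, vR} {8..11} s s'"
proof -
  let ?W = "{vQ, vJ, vI, vP, vR}"
  define s1 where "s1 = exec L (Assign vR (Rd aRow (Var vP))) s"
  have s1: "mem s1 0 vR = int (p * m)" "mem s1 0 vP = int p" "rules_in (mem s1) rs" "frame ?W {8..11} s s1"
    using env p rs by (simp_all add: s1_def env_def rules_in_def frame_def)
  have env1: "env m st es s1"
    by (rule env_frame[OF env s1(4)])
  define c where "c = IfPos (Minus (Var vM) (Var vP))
       (emit_rule (Plus (Var vR) (Var vP)) (Var vK) (Var vK) (Const 0))
       (emit_rule (Plus (Var vR) (times4 (Var vS))) (Var vK) (Var vK) (Const 0))"
  define r where "r = (p * m + (if p < m then p else 4 * st), m * m + m, m * m + m, 0::int)"
  define s2 where "s2 = exec L c s1"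
  have s2: "rules_in (mem s2) (rs @ [r]) \<and> frame {vQ} {8..11} s1 s2"
  proof (cases "p < m")
    case True
    then have "s2 = exec L (emit_rule (Plus (Var vR) (Var vP)) (Var vK) (Var vK) (Const 0)) s1"
      using env1 s1 by (simp add: s2_def c_def env_def)
    then show ?thesis
      using True env1 unfolding r_def
      by (simp del: exec.simps) (rule exec_emit_rule[OF s1(3)], simp add: s1 env_def)
  next
    case False
    then have "s2 = exec L (emit_rule (Plus (Var vR) (times4 (Var vS))) (Var vK) (Var vK) (Const 0)) s1"
      using env1 s1 p by (simp add: s2_def c_def env_def)
    then show ?thesis
      using False env1 unfolding r_def
      by (simp del: exec.simps) (rule exec_emit_rule[OF s1(3)], simp add: s1 env_def)
  qed
  define s3 where "s3 = exec L (Assign vI (Const 0)) s2"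
  have fr2: "frame ?W {8..11} s s2"
    by (rule frame_trans[OF s1(4) frame_mono[OF conjunct2[OF s2]]]) auto
  have fr3: "frame ?W {8..11} s s3"
    by (rule frame_trans[OF fr2]) (simp add: s3_def frame_def)
  have s3: "rules_in (mem s3) (rs @ [r])" "mem s3 0 vI = 0" "mem s3 0 vR = int (p * m)" "mem s3 0 vP = int p"
    using s2 s1 by (auto simp: s3_def rules_in_def frame_def)
  define inv where "inv i t \<longleftrightarrow> rules_in (mem t) (rs @ r # concat (map (edge_rules m es p) (take i es))) \<and>
    mem t 0 vI = int i \<and> mem t 0 vR = int (p * m) \<and> mem t 0 vP = int p \<and> frame ?W {8..11} s t" for i t
  have "inv (length es) ((exec L edge_body ^^ length es) s3)"
  proof (rule funpow_inv)
    show "inv 0 s3"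
      using s3 fr3 by (simp add: inv_def)
    show "inv (Suc i) (exec L edge_body t)" if "i < length es" "inv i t" for i t
    proof -
      have fr: "frame ?W {8..11} s t"
        using that(2) by (simp add: inv_def)
      have 1: "rules_in (mem (exec L edge_body t))
          ((rs @ r # concat (map (edge_rules m es p) (take i es))) @ edge_rules m es p (es ! i)) \<and>
        mem (exec L edge_body t) 0 vI = int (Suc i) \<and> frame {vQ, vJ, vI} {8..11} t (exec L edge_body t)"
        using that env_frame[OF env fr] q L p(2) by (intro exec_edge_body) (auto simp: inv_def)
      then have fr': "frame {vQ, vJ, vI} {8..11} t (exec L edge_body t)" by simp
      have "frame ?W {8..11} s (exec L edge_body t)"
        by (rule frame_trans[OF fr frame_mono[OF fr']]) auto
      then show ?thesis
        using 1 that frame_var[OF fr', of vR] frame_var[OF fr', of vP]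
        by (simp add: inv_def take_Suc_conv_app_nth)
    qed
  qed
  moreover have "mem s3 0 vE = int (length es)"
    using env_frame[OF env fr3] by (simp add: env_def edges_in_def)
  then have "s' = exec L (incr vP) ((exec L edge_body ^^ length es) s3)"
    using exec_Loop[of "Var vE" s3 "length es" L edge_body] L
    unfolding s'_def row_body_def c_def[symmetric] by (simp add: s1_def s2_def s3_def)
  ultimately show ?thesis
    by (auto simp: inv_def row_rules_def r_def frame_def rules_in_def)
qed

definition make_rules :: com where
  "make_rules = Assign vP (Const 0) ;; Loop (Plus (Var vM) (Const 1)) row_body"

lemma exec_make_rules:
  assumes env: "env m st es s" and L: "length es \<le> L" "Suc m \<le> L"
    and rs: "rules_in (mem s) []" and q: "\<And>p q w t y. (p, q, w, t, y) \<in> set es \<Longrightarrow> q < m"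
    and s'_def: "s' = exec L make_rules s"
  shows "rules_in (mem s') (all_rules m (4 * st) es) \<and> frame {vQ, vJ, vI, vP, vR} {8..11} s s'"
proof -
  let ?W = "{vQ, vJ, vI, vP, vR}"
  define s1 where "s1 = exec L (Assign vP (Const 0)) s"
  define inv where "inv p t \<longleftrightarrow> rules_in (mem t) (concat (map (row_rules m (4 * st) es) [0..<p])) \<and>
    mem t 0 vP = int p \<and> frame ?W {8..11} s t" for p t
  have "inv (Suc m) ((exec L row_body ^^ Suc m) s1)"
  proof (rule funpow_inv)
    show "inv 0 s1"
      using rs by (simp add: inv_def s1_def frame_def rules_in_def)
    show "inv (Suc p) (exec L row_body t)" if "p < Suc m" "inv p t" for p t
    proof -
      have fr: "frame ?W {8..11} s t"
        using that(2) by (simp add: inv_def)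
      have 1: "rules_in (mem (exec L row_body t))
          (concat (map (row_rules m (4 * st) es) [0..<p]) @ row_rules m (4 * st) es p) \<and>
        mem (exec L row_body t) 0 vP = int (Suc p) \<and> frame ?W {8..11} t (exec L row_body t)"
        using that env_frame[OF env fr] q L by (intro exec_row_body) (auto simp: inv_def)
      then show ?thesis
        using frame_trans[OF fr] by (simp add: inv_def)
    qed
  qed
  moreover have "mem s1 0 vM = int m"
    using env by (simp add: env_def s1_def)
  then have "s' = (exec L row_body ^^ Suc m) s1"
    using exec_Loop[of "Plus (Var vM) (Const 1)" s1 "Suc m" L row_body] L
    by (simp add: s'_def make_rules_def s1_def del: funpow.simps)
  ultimately show ?thesis
    by (simp add: inv_def all_rules_def)
qed

section \<open>Iterating the rules\<close>

definition relax_body :: com where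
  "relax_body =
     IfPos (Rd aD (Rd aY (Var vX)))
       (IfPos (Rd aD (Rd aZ (Var vX)))
         (Assign vT (Minus (Plus (Plus (Rd aD (Rd aY (Var vX))) (Rd aD (Rd aZ (Var vX)))) (Rd aC (Var vX))) (Const 1)) ;;
          IfPos (Minus (Var vT) (Rd aD' (Rd aX (Var vX)))) (Store aD' (Rd aX (Var vX)) (Var vT)) Skip)
         Skip)
       Skip ;;
     incr vX"

lemma exec_relax_body:
  assumes rs: "rules_in (mem s) rs" and i: "mem s 0 vX = int i" "i < length rs"
    and D: "mem s aD = D"
    and s'_def: "s' = exec L relax_body s"
  shows "mem s' aD' = relax D (rs ! i) (mem s aD') \<and> mem s' 0 vX = int (Suc i) \<and>
    frame {vX, vT} {aD'} s s'"
proof -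
  obtain x y z c where r: "rs ! i = (x, y, z, c)" by (cases "rs ! i")
  have m: "mem s aX i = int x" "mem s aY i = int y" "mem s aZ i = int z" "mem s aC i = c"
    using rs i r by (auto simp: rules_in_def)
  consider "D y > 0" "D z > 0" "D y + D z + c - 1 > mem s aD' x"
    | "D y > 0" "D z > 0" "D y + D z + c - 1 \<le> mem s aD' x"
    | "D y \<le> 0" | "D z \<le> 0"
    by linarith
  then show ?thesis
    by cases (use i m D r in \<open>auto simp: s'_def relax_body_def frame_def upd_def\<close>)
qed

definition bump_body :: com where
  "bump_body =
     IfPos (Minus (Rd aD' (Var vX)) (Rd aD (Var vX)))
       (Store aD' (Var vX) (Plus (Rd aD' (Var vX)) (Var vB)) ;; Store aD (Var vX) (Rd aD' (Var vX)))
       Skip ;;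
     incr vX"

definition round_com :: com where
  "round_com =
     Assign vX (Const 0) ;; Loop (Var vQ) relax_body ;;
     Assign vX (Const 0) ;; Loop (Plus (Var vK) (Const 1)) bump_body"

text \<open>Both value arrays agree before and after a round, which saves copying: relaxation starts
  from equal arrays, and the marking loop synchronises the entries that changed.\<close>

lemma exec_round_com:
  assumes rs: "rules_in (mem s) rs" and K: "mem s 0 vK = int K" and D: "mem s aD = D" "mem s aD' = D"
    and b: "mem s 0 vB = b" and L: "length rs \<le> L" "Suc K \<le> L"
    and bound: "\<forall>r \<in> set rs. fst r \<le> K"
    and s'_def: "s' = exec L round_com s"
  shows "mem s' aD = bump_round rs b D \<and> mem s' aD' = bump_round rs b D \<and> frame {vX, vT} {aD, aD'} s s'"
proof -
  define s1 where "s1 = exec L (Assign vX (Const 0)) s"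
  define s2 where "s2 = exec L (Loop (Var vQ) relax_body) s1"
  define inv where "inv i t \<longleftrightarrow> mem t aD' = fold (relax D) (take i rs) D \<and> mem t aD = D \<and>
    mem t 0 vX = int i \<and> rules_in (mem t) rs \<and> frame {vX, vT} {aD, aD'} s t" for i t
  have s2_eq: "s2 = (exec L relax_body ^^ length rs) s1"
    using exec_Loop[of "Var vQ" s1 "length rs" L relax_body] rs L
    by (simp add: s2_def s1_def rules_in_def)
  have inv2: "inv (length rs) s2"
    unfolding s2_eq
  proof (rule funpow_inv)
    show "inv 0 s1"
      using rs D by (simp add: inv_def s1_def rules_in_def frame_def)
    show "inv (Suc i) (exec L relax_body t)" if "i < length rs" "inv i t" for i t
    proof -
      have t: "rules_in (mem t) rs" "mem t 0 vX = int i" "mem t aD = D" "frame {vX, vT} {aD, aD'} s t"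
        using that(2) by (simp_all add: inv_def)
      have 1: "mem (exec L relax_body t) aD' = relax D (rs ! i) (mem t aD') \<and>
          mem (exec L relax_body t) 0 vX = int (Suc i) \<and> frame {vX, vT} {aD'} t (exec L relax_body t)"
        by (rule exec_relax_body[OF t(1,2) that(1) t(3) refl])
      then have fr: "frame {vX, vT} {aD'} t (exec L relax_body t)" by simp
      have "frame {vX, vT} {aD, aD'} s (exec L relax_body t)"
        by (rule frame_trans[OF t(4) frame_mono[OF fr]]) auto
      moreover have "rules_in (mem (exec L relax_body t)) rs"
        using t(1) fr by (simp add: rules_in_def frame_def)
      moreover have "mem (exec L relax_body t) aD = D"
        using t(3) fr by (simp add: frame_def)
      ultimately show ?thesis
        using 1 that by (simp add: inv_def take_Suc_conv_app_nth)
    qed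
  qed
  define D2 where "D2 = kleene rs D"
  define s3 where "s3 = exec L (Assign vX (Const 0)) s2"
  have s3: "mem s3 aD' = D2" "mem s3 aD = D" "mem s3 0 vX = 0" "frame {vX, vT} {aD, aD'} s s3"
    using inv2 by (simp_all add: s3_def inv_def D2_def kleene_def frame_def)
  define inv' where "inv' i t \<longleftrightarrow> mem t 0 vX = int i \<and>
    (\<forall>x. mem t aD x = (if x < i then bump b D D2 x else D x)) \<and>
    (\<forall>x. mem t aD' x = (if x < i then bump b D D2 x else D2 x)) \<and>
    frame {vX, vT} {aD, aD'} s t" for i t
  have D2_ge: "D x \<le> D2 x" for x
    by (simp add: D2_def kleene_ge)
  have inv3: "inv' (Suc K) ((exec L bump_body ^^ Suc K) s3)"
  proof (rule funpow_inv)
    show "inv' 0 s3"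
      using s3 by (simp add: inv'_def)
    show "inv' (Suc i) (exec L bump_body t)" if "inv' i t" for i t
    proof -
      have "mem t 0 vX = int i" "mem t aD i = D i" "mem t aD' i = D2 i" "mem t 0 vB = b"
        using that b by (auto simp: inv'_def frame_def)
      then have "exec L bump_body t =
        (if D2 i > D i
         then t\<lparr>mem := upd 0 vX (int i + 1) (upd aD i (D2 i + b) (upd aD' i (D2 i + b) (mem t)))\<rparr>
         else t\<lparr>mem := upd 0 vX (int i + 1) (mem t)\<rparr>)"
        by (simp add: bump_body_def)
      then show ?thesis
        using that D2_ge[of i] unfolding inv'_def frame_def
        by (cases "D2 i > D i") (auto simp: bump_def less_Suc_eq)
    qed
  qed
  have "mem s3 0 vK = int K"
    using s3(4) K by (simp add: frame_def)
  then have s'_eq: "s' = (exec L bump_body ^^ Suc K) s3"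
    using exec_Loop[of "Plus (Var vK) (Const 1)" s3 "Suc K" L bump_body] L
    by (simp add: s'_def round_com_def s1_def s2_def s3_def del: funpow.simps)
  \<comment> \<open>Indices beyond \<open>K\<close> head no rule, so the loop over \<open>0\<close>
    to \<open>K\<close> misses nothing.\<close>
  have outside: "bump b D D2 x = D x" "D2 x = D x" if "\<not> x < Suc K" for x
  proof -
    have "\<not> D2 x > D x"
    proof
      assume "D2 x > D x"
      then obtain y z c where "(x, y, z, c) \<in> set rs"
        unfolding D2_def by (rule kleene_cases)
      with bound that show False by fastforce
    qed
    then show "bump b D D2 x = D x" "D2 x = D x"
      using D2_ge[of x] by (auto simp: bump_def)
  qed
  have "mem s' aD x = bump b D D2 x \<and> mem s' aD' x = bump b D D2 x" for x
    using inv3[folded s'_eq] outside by (cases "x < Suc K") (simp_all add: inv'_def)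
  then show ?thesis
    using inv3[folded s'_eq] by (simp add: bump_round_def D2_def inv'_def fun_eq_iff)
qed

lemma exec_rounds:
  assumes rs: "rules_in (mem s) rs" and K: "mem s 0 vK = int K" and D: "mem s aD = D" "mem s aD' = D"
    and b: "mem s 0 vB = b" and L: "length rs \<le> L" "Suc K \<le> L" "n \<le> L"
    and bound: "\<forall>r \<in> set rs. fst r \<le> K"
    and e: "aval e (mem s) = int n"
    and s'_def: "s' = exec L (Loop e round_com) s"
  shows "mem s' aD = (bump_round rs b ^^ n) D \<and> mem s' aD' = (bump_round rs b ^^ n) D \<and>
    frame {vX, vT} {aD, aD'} s s'"
proof -
  have "s' = (exec L round_com ^^ n) s"
    unfolding s'_def by (rule exec_Loop[OF e L(3)])
  moreover define inv where "inv i t \<longleftrightarrow> mem t aD = (bump_round rs b ^^ i) D \<and> mem t aD' = (bump_round rs b ^^ i) D \<and>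
    frame {vX, vT} {aD, aD'} s t" for i t
  have "inv n ((exec L round_com ^^ n) s)"
  proof (rule funpow_inv)
    show "inv 0 s"
      using D by (simp add: inv_def)
    show "inv (Suc i) (exec L round_com t)" if "inv i t" for i t
    proof -
      have t: "mem t aD = (bump_round rs b ^^ i) D" "mem t aD' = (bump_round rs b ^^ i) D"
        "frame {vX, vT} {aD, aD'} s t"
        using that by (simp_all add: inv_def)
      have "rules_in (mem t) rs" "mem t 0 vK = int K" "mem t 0 vB = b"
        using rs K b t(3) by (simp_all add: rules_in_def frame_def)
      from exec_round_com[OF this(1,2) t(1,2) this(3) L(1,2) bound refl]
      have "mem (exec L round_com t) aD = bump_round rs b ((bump_round rs b ^^ i) D)"
        "mem (exec L round_com t) aD' = bump_round rs b ((bump_round rs b ^^ i) D)"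
        "frame {vX, vT} {aD, aD'} t (exec L round_com t)"
        by blast+
      then show ?thesis
        using frame_trans[OF t(3)] by (simp add: inv_def)
    qed
  qed
  ultimately show ?thesis by (simp add: inv_def)
qed

text \<open>The first loop runs with \<open>vB = 0\<close> and is plain Kleene iteration. The sum in
  \<open>vA\<close> then becomes the mark for the second loop; with \<open>K + 1\<close>
  nonterminals, \<open>K + 1\<close> and \<open>K + 2\<close> rounds are due.\<close>

definition solve :: com where
  "solve =
     Store aD (Var vK) (Const 1) ;; Store aD' (Var vK) (Const 1) ;; Assign vB (Const 0) ;;
     Loop (Plus (Var vK) (Const 1)) round_com ;;
     Assign vA (Const 1) ;; Assign vX (Const 0) ;;
     Loop (Plus (Var vK) (Const 1)) (Assign vA (Plus (Var vA) (Rd aD (Var vX))) ;; incr vX) ;;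
     Assign vB (Var vA) ;;
     Loop (Plus (Var vK) (Const 2)) round_com"

lemma exec_solve:
  fixes rs K
  defines "D\<^sub>1 \<equiv> (bump_round rs 0 ^^ Suc K) ((\<lambda>_. 0)(K := 1))"
  defines "b \<equiv> 1 + (\<Sum>x<Suc K. D\<^sub>1 x)"
  assumes rs: "rules_in (mem s) rs" and K: "mem s 0 vK = int K"
    and D: "mem s aD = (\<lambda>_. 0)" "mem s aD' = (\<lambda>_. 0)"
    and L: "length rs \<le> L" "Suc (Suc K) \<le> L"
    and bound: "\<forall>r \<in> set rs. fst r \<le> K"
    and s'_def: "s' = exec L solve s"
  shows "mem s' aD = (bump_round rs b ^^ Suc (Suc K)) D\<^sub>1 \<and> mem s' 0 vB = b \<and>
    frame {vX, vT, vB, vA} {aD, aD'} s s'"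
proof -
  let ?W = "{vX, vT, vB, vA}" and ?K = "{aD, aD'}"
  let ?D0 = "(\<lambda>_. 0)(K := 1) :: nat \<Rightarrow> int"
  define s1 where "s1 = exec L (Store aD (Var vK) (Const 1) ;; Store aD' (Var vK) (Const 1) ;; Assign vB (Const 0)) s"
  have s1: "mem s1 aD = ?D0" "mem s1 aD' = ?D0" "mem s1 0 vB = 0" "mem s1 0 vK = int K"
    "rules_in (mem s1) rs" "frame ?W ?K s s1"
    using rs K D by (simp_all add: s1_def rules_in_def frame_def upd_def)
  define s2 where "s2 = exec L (Loop (Plus (Var vK) (Const 1)) round_com) s1"
  have 2: "mem s2 aD = D\<^sub>1 \<and> mem s2 aD' = D\<^sub>1 \<and> frame {vX, vT} ?K s1 s2"
    unfolding D\<^sub>1_def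
    by (rule exec_rounds[OF s1(5,4,1,2,3) L(1) _ _ bound _ s2_def]) (use L s1(4) in auto)
  have fr2: "frame ?W ?K s s2"
    by (rule frame_trans[OF s1(6) frame_mono[OF conjunct2[OF conjunct2[OF 2]]]]) auto
  define s3 where "s3 = exec L (Assign vA (Const 1) ;; Assign vX (Const 0)) s2"
  define c where "c = (Assign vA (Plus (Var vA) (Rd aD (Var vX))) ;; incr vX)"
  define s4 where "s4 = exec L (Loop (Plus (Var vK) (Const 1)) c) s3"
  have s3: "mem s3 aD = D\<^sub>1" "mem s3 aD' = D\<^sub>1" "mem s3 0 vA = 1" "mem s3 0 vX = 0" "frame ?W ?K s s3"
    using 2 fr2 by (simp_all add: s3_def frame_def)
  have "mem s3 0 vK = int K"
    using s3(5) K by (simp add: frame_def)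
  then have s4_eq: "s4 = (exec L c ^^ Suc K) s3"
    unfolding s4_def using L by (intro exec_Loop) auto
  define inv where "inv i t \<longleftrightarrow> mem t aD = D\<^sub>1 \<and> mem t aD' = D\<^sub>1 \<and> mem t 0 vX = int i \<and>
    mem t 0 vA = 1 + (\<Sum>x<i. D\<^sub>1 x) \<and> frame ?W ?K s t" for i t
  have 4: "inv (Suc K) s4"
    unfolding s4_eq
  proof (rule funpow_inv)
    show "inv 0 s3"
      using s3 by (simp add: inv_def)
    show "inv (Suc i) (exec L c t)" if "inv i t" for i t
      using that by (simp add: inv_def c_def frame_def)
  qed
  define s5 where "s5 = exec L (Assign vB (Var vA)) s4"
  have s5: "mem s5 aD = D\<^sub>1" "mem s5 aD' = D\<^sub>1" "mem s5 0 vB = b" "frame ?W ?K s s5"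
    using 4 by (simp_all add: s5_def inv_def b_def frame_def)
  have s5': "rules_in (mem s5) rs" "mem s5 0 vK = int K"
    using s5(4) rs K by (simp_all add: rules_in_def frame_def)
  have s': "s' = exec L (Loop (Plus (Var vK) (Const 2)) round_com) s5"
    by (simp add: s'_def solve_def s1_def s2_def s3_def s4_def s5_def c_def)
  have 6: "mem s' aD = (bump_round rs b ^^ Suc (Suc K)) D\<^sub>1 \<and> mem s' aD' = (bump_round rs b ^^ Suc (Suc K)) D\<^sub>1 \<and>
    frame {vX, vT} ?K s5 s'"
    by (rule exec_rounds[OF s5'(1,2) s5(1,2,3) L(1) _ _ bound _ s']) (use L s5'(2) in auto)
  have "frame ?W ?K s s'"
    by (rule frame_trans[OF s5(4) frame_mono[OF conjunct2[OF conjunct2[OF 6]]]]) auto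
  moreover have "mem s' 0 vB = b"
    using 6 s5(3) by (simp add: frame_def)
  ultimately show ?thesis using 6 by blast
qed

section \<open>Extracting and printing the interval\<close>

abbreviation (input) value_exp :: "int \<Rightarrow> aexp" where
  "value_exp i \<equiv> Rd aD (Plus (Rd aRow (Var vM)) (Plus (times4 (Var vF)) (Const i)))"

definition load_values :: com where
  "load_values =
     Assign vH (value_exp 0) ;; Assign vZ (value_exp 1) ;;
     Assign vO (value_exp 2) ;; Assign vY (value_exp 3) ;;
     Assign vT (Var vY) ;;
     IfPos (Minus (Var vO) (Var vT)) (Assign vT (Var vO)) Skip ;;
     IfPos (Minus (Var vZ) (Var vT)) (Assign vT (Var vZ)) Skip ;;
     IfPos (Minus (Var vH) (Var vT)) (Assign vT (Var vH)) Skip"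

text \<open>Over the integers \<open>vT \<ge> vB\<close> is positivity of
  \<open>vT - vB + 1\<close>. As \<open>vT\<close> is the maximum, a difference that is not positive
  means equality.\<close>

definition print_interval :: com where
  "print_interval =
     IfPos (Var vT)
       (Print (Const 1) ;; Print (Const 0) ;; Print (Const 1) ;;
        IfPos (Plus (Var vH) (Var vO)) (Print (Const 1)) (Print (Const 0)) ;;
        IfPos (Plus (Minus (Var vT) (Var vB)) (Const 1)) (Print (Const 0))
          (Print (Const 1) ;; Print (Minus (Var vT) (Const 1)) ;; Print (Const 1) ;;
           IfPos (Minus (Var vT) (Var vH)) (IfPos (Minus (Var vT) (Var vZ)) (Print (Const 0)) (Print (Const 1))) (Print (Const 1))))
       (Print (Const 0))"

lemma exec_load_values:
  fixes F :: "nat \<Rightarrow> int"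
  assumes "mem s aRow m = int (m * m)" "mem s 0 vM = int m" "mem s 0 vF = int f"
    and F: "\<And>i. i < 4 \<Longrightarrow> mem s aD (m * m + (4 * f + i)) = F i"
    and s'_def: "s' = exec L load_values s"
  shows "mem s' 0 vH = F 0 \<and> mem s' 0 vZ = F 1 \<and> mem s' 0 vO = F 2 \<and> mem s' 0 vT = max4 F \<and>
    frame {vH, vZ, vO, vY, vT} {} s s'"
proof -
  define s1 where "s1 = exec L (Assign vH (value_exp 0) ;; Assign vZ (value_exp 1) ;;
     Assign vO (value_exp 2) ;; Assign vY (value_exp 3)) s"
  have idx: "nat (int m * int m + (4 * int f + int i)) = m * m + (4 * f + i)" for i
    by (metis nat_int of_nat_add of_nat_mult of_nat_numeral)
  have val: "aval (value_exp (int i)) M = F i"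
    if "i < 4" "\<And>k. k > 0 \<Longrightarrow> M k = mem s k" "M 0 vM = int m" "M 0 vF = int f" for i M
    using F[OF that(1)] that assms(1) idx[of i] by (simp add: algebra_simps)
  have s1: "mem s1 0 vH = F 0" "mem s1 0 vZ = F 1" "mem s1 0 vO = F 2" "mem s1 0 vY = F 3"
    "frame {vH, vZ, vO, vY, vT} {} s s1"
    using val[of 0] val[of 1] val[of 2] val[of 3] assms(2,3)
    by (simp_all add: s1_def frame_def del: aval.simps)
  have "s' = exec L (Assign vT (Var vY) ;;
     IfPos (Minus (Var vO) (Var vT)) (Assign vT (Var vO)) Skip ;;
     IfPos (Minus (Var vZ) (Var vT)) (Assign vT (Var vZ)) Skip ;;
     IfPos (Minus (Var vH) (Var vT)) (Assign vT (Var vH)) Skip) s1"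
    by (simp add: s'_def load_values_def s1_def)
  with s1 show ?thesis
    by (simp add: frame_def max4_def max_def)
qed

lemma exec_print_interval:
  fixes F :: "nat \<Rightarrow> int"
  assumes "mem s 0 vH = F 0" "mem s 0 vZ = F 1" "mem s 0 vO = F 2" "mem s 0 vT = max4 F"
    and "mem s 0 vB = b" "out s = []"
  shows "out (exec L print_interval s) = encode_interval (mk_desc F b)"
    and "ok (exec L print_interval s) = ok s"
proof -
  have le: "F 0 \<le> max4 F" "F 1 \<le> max4 F"
    by (simp_all add: max4_def)
  show "out (exec L print_interval s) = encode_interval (mk_desc F b)"
    using assms le unfolding encode_mk_desc by (auto simp: print_interval_def)
  show "ok (exec L print_interval s) = ok s"
    using assms by (simp add: print_interval_def)
qed

definition program :: com where
  "program =
     Read vN ;; Read vS ;; Read vF ;; Read vG ;; Loop (Var vG) (Read vH) ;;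
     read_edges ;; make_rows ;; make_rules ;; solve ;; load_values ;; print_interval"

lemma wf_emit_edges: "wf_com (emit_edges ijs)"
  by (induction ijs) (simp_all add: emit_edge_def)

lemma wf_program: "wf_com program"
  by (simp add: program_def read_edges_def read_entry_def make_rows_def make_rules_def row_body_def
      edge_body_def call_body_def emit_rule_def solve_def round_com_def relax_body_def bump_body_def
      load_values_def print_interval_def wf_emit_edges del: emit_edges.simps)

lemma exec_skip_input:
  assumes "mem s 0 vG = int (length xs)" "length xs \<le> L" "inp s = xs @ I"
    and s'_def: "s' = exec L (Loop (Var vG) (Read vH)) s"
  shows "inp s' = I \<and> frame {vH} {} s s'"
proof -
  have "inp ((exec L (Read vH) ^^ length xs) s) = I \<and> frame {vH} {} s ((exec L (Read vH) ^^ length xs) s)"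
    using assms(3)
  proof (induction xs arbitrary: s)
    case Nil
    then show ?case by simp
  next
    case (Cons x xs)
    have 1: "inp (exec L (Read vH) s) = xs @ I" "frame {vH} {} s (exec L (Read vH) s)"
      using Cons.prems by (simp_all add: frame_def)
    from Cons.IH[OF 1(1)] frame_trans[OF 1(2)] show ?case
      by (simp only: funpow_Suc_right length_Cons o_apply)
  qed
  then show ?thesis
    unfolding s'_def using exec_Loop[of "Var vG" s "length xs" L "Read vH"] assms(1,2) by simp
qed

section \<open>Polynomial bounds on the numbers of edges, rules and rounds\<close>

lemma length_concat_map_le:
  "(\<And>x. x \<in> set xs \<Longrightarrow> length (f x) \<le> k) \<Longrightarrow> length (concat (map f xs)) \<le> length xs * k"
  by (induction xs) (auto intro: add_mono)

lemma length_input_size: "length xs \<le> input_size xs"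
proof (induction xs)
  case (Cons x xs)
  then show ?case
    using bit_length_pos[of x] unfolding input_size_def by simp
qed simp

lemma length_call_rules: "length (call_rules m p e\<^sub>1 e\<^sub>2) \<le> 1"
  by (cases e\<^sub>1; cases e\<^sub>2) simp

lemma length_edge_rules: "length (edge_rules m es p e) \<le> 1 + length es"
proof (cases e)
  case (fields p\<^sub>1 q\<^sub>1 w\<^sub>1 t\<^sub>1 y\<^sub>1)
  have "length (concat (map (call_rules m p e) es)) \<le> length es * 1"
    by (rule length_concat_map_le) (rule length_call_rules)
  then show ?thesis unfolding fields by (simp del: length_concat)
qed

text \<open>With \<open>E\<close> edges a row has at most \<open>1 + E * (1 + E)\<close> rules: one
  for the empty word, and per edge one plus a possible partner for each edge. Since
  \<open>1 + E\<close> is at most \<open>(m + 2) ^ 2\<close>, a row costs a fourth power, and the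
  \<open>m + 1\<close> rows raise it to a fifth.\<close>

lemma length_all_rules:
  assumes "length es \<le> m * m"
  shows "length (all_rules m st es) \<le> (m + 2) ^ 5"
proof -
  let ?z = "m + 2"
  have es: "1 + length es \<le> ?z ^ 2"
    using assms by (simp add: power2_eq_square)
  have "length (row_rules m st es p) \<le> ?z ^ 4" for p
  proof -
    have "length (concat (map (edge_rules m es p) es)) \<le> length es * (1 + length es)"
      by (rule length_concat_map_le) (rule length_edge_rules)
    then have "length (row_rules m st es p) \<le> 1 + length es * (1 + length es)"
      by (simp add: row_rules_def del: length_concat)
    also have "\<dots> \<le> (1 + length es) * (1 + length es)"
      by simp
    also have "\<dots> \<le> ?z ^ 2 * ?z ^ 2"
      by (intro mult_mono es) auto
    finally show ?thesis by (simp add: power_add[symmetric])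
  qed
  then have "length (all_rules m st es) \<le> length [0..<Suc m] * ?z ^ 4"
    unfolding all_rules_def by (intro length_concat_map_le)
  also have "\<dots> \<le> ?z * ?z ^ 4"
    by (intro mult_right_mono) auto
  also have "\<dots> = ?z ^ 5"
    by (simp add: numeral_eq_Suc)
  finally show ?thesis .
qed

context coded_automaton
begin

abbreviation "input \<equiv> encode_c1pvass ss gs A"

lemma length_entry: "length (entry u v) = 4"
proof (cases "trans A (ss ! u, ss ! v)")
  case (Some zs)
  then show ?thesis by (cases zs; cases "snd zs") (auto simp: entry_def)
qed (simp add: entry_def)

lemma position_idx: "position ss s = int (idx s)"
  by (simp add: position_def idx_def)

lemma input_eq:
  "input = int n # int (idx (init_state A)) # int (idx (acc_state A)) # int (length gs) #
     map (\<lambda>g. of_bool (g = stack_bottom A)) gs @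
     concat (map (\<lambda>u. concat (map (\<lambda>v. entry u v) [0..<n])) [0..<n])"
proof -
  have nth: "map f ss = map (\<lambda>u. f (ss ! u)) [0..<n]" for f :: "'s \<Rightarrow> int list"
    by (rule nth_equalityI) simp_all
  show ?thesis
    unfolding encode_c1pvass_def nth entry_def position_idx by simp
qed

text \<open>A table entry yields at most four edges, and \<open>4 * n * n\<close> is below the
  square of \<open>m = 4 * n\<close>.\<close>

lemma length_es: "length es \<le> m * m"
proof -
  have e: "length (entry_edges u v xs) \<le> 4" for u v xs
    by (simp add: entry_edges_def modes_def)
  have "length (concat (map (\<lambda>v. entry_edges u v (entry u v)) [0..<n])) \<le> length [0..<n] * 4" for u
    by (rule length_concat_map_le) (rule e)
  then have "length es \<le> length [0..<n] * (length [0..<n] * 4)"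
    unfolding es_def by (rule length_concat_map_le)
  then show ?thesis by (simp add: m_def)
qed

text \<open>The transition table is written out in full and every number counts at least one bit, so
  the state count is bounded by the input size even without any transitions.\<close>

lemma input_size_bounds: "n \<le> input_size input" "length gs \<le> input_size input"
proof -
  have "length (concat (map f xs)) = length xs * k" if "\<And>x. length (f x) = k" for f :: "nat \<Rightarrow> int list" and xs k
    using that by (induction xs) auto
  from this[of "\<lambda>u. concat (map (\<lambda>v. entry u v) [0..<n])" "n * 4" "[0..<n]"]
    this[of "\<lambda>v. entry _ v" 4 "[0..<n]", OF length_entry]
  have "length (concat (map (\<lambda>u. concat (map (\<lambda>v. entry u v) [0..<n])) [0..<n])) = n * (n * 4)"
    by (simp del: length_concat)
  then have "length input = 4 + length gs + n * (n * 4)"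
    unfolding input_eq by (simp del: length_concat)
  moreover have "n * 1 \<le> n * (n * 4)"
    using n_pos by (intro mult_left_mono) linarith+
  ultimately show "n \<le> input_size input" "length gs \<le> input_size input"
    using length_input_size[of input] by linarith+
qed

text \<open>The rule loop is the longest one: there are at most \<open>(m + 2) ^ 5\<close> rules,
  and \<open>m = 4 * n\<close> is at most four times the input size. The chosen \<open>L\<close>
  therefore covers every loop of the program.\<close>

lemma exec_program:
  assumes L: "L = (4 * input_size input + 2) ^ 5"
  defines "s \<equiv> exec L program (start input)"
  shows "ok s \<and> out s = encode_interval (mk_desc result B)"
proof -
  let ?z = "4 * input_size input + 2"
  have z_pow: "?z ^ k \<le> L" if "k \<le> 5" for k
    unfolding L using that by (intro power_increasing) auto
  have mz: "m + 2 \<le> ?z"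
    using input_size_bounds by (simp add: m_def)
  have "?z \<le> L" using z_pow[of 1] by simp
  then have Ln: "n \<le> L" "length gs \<le> L" "Suc m \<le> L"
    using input_size_bounds mz by simp_all
  have "m * m \<le> ?z ^ 2"
    using mult_mono[of m ?z m ?z] mz by (simp add: power2_eq_square)
  then have Les: "length es \<le> L"
    using length_es z_pow[of 2] by simp
  have "(m + 2) ^ 2 \<le> ?z ^ 2" "(m + 2) ^ 5 \<le> ?z ^ 5"
    using mz by (intro power_mono; simp)+
  then have pow: "(m + 2) ^ 2 \<le> L" "(m + 2) ^ 5 \<le> L"
    using z_pow[of 2] z_pow[of 5] by linarith+
  have Lrs: "length rs \<le> L"
    unfolding rs_def by (rule le_trans[OF length_all_rules[OF length_es] pow(2)])
  have LK: "Suc (Suc eps) \<le> L"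
    using pow(1) by (simp add: power2_eq_square)
  define s1 where "s1 = exec L (Read vN ;; Read vS ;; Read vF ;; Read vG) (start input)"
  have s1: "mem s1 0 vN = int n" "mem s1 0 vS = int (idx (init_state A))"
    "mem s1 0 vF = int (idx (acc_state A))" "mem s1 0 vG = int (length gs)"
    "mem s1 0 vU = 0" "mem s1 0 vE = 0" "mem s1 0 vQ = 0" "\<And>k. k \<noteq> 0 \<Longrightarrow> mem s1 k = (\<lambda>_. 0)"
    "inp s1 = map (\<lambda>g. of_bool (g = stack_bottom A)) gs @
       concat (map (\<lambda>u. concat (map (\<lambda>v. entry u v) [0..<n])) [0..<n])"
    "out s1 = []" "ok s1"
    by (simp_all add: s1_def input_eq start_def)
  define s2 where "s2 = exec L (Loop (Var vG) (Read vH)) s1"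
  have 2: "inp s2 = concat (map (\<lambda>u. concat (map (\<lambda>v. entry u v) [0..<n])) [0..<n]) \<and>
      frame {vH} {} s1 s2"
    by (rule exec_skip_input[OF _ _ s1(9) s2_def]) (use s1(4) Ln in simp_all)
  define s3 where "s3 = exec L read_edges s2"
  have 3: "edges_in (mem s3) es \<and> frame {vU, vW, vH, vZ, vO, vY, vT, vE} {2..6} s2 s3"
    unfolding es_def
    by (rule exec_read_edges[OF _ _ _ Ln(1) conjunct1[OF 2] length_entry s3_def])
      (use 2 s1 in \<open>simp_all add: frame_def edges_in_def\<close>)
  define s4 where "s4 = exec L make_rows s3"
  have 4: "mem s4 0 vM = int m \<and> (\<forall>p \<le> m. mem s4 aRow p = int (p * m)) \<and>
      mem s4 0 vK = int eps \<and> frame {vM, vX, vT, vK} {aRow} s3 s4"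
    by (rule exec_make_rows[OF _ m_def Ln(3) s4_def]) (use 2 3 s1 in \<open>simp add: frame_def\<close>)
  have env: "env m (idx (init_state A)) es s4"
    using 2 3 4 s1 by (simp add: env_def edges_in_def frame_def)
  define s5 where "s5 = exec L make_rules s4"
  have 5: "rules_in (mem s5) rs \<and> frame {vQ, vJ, vI, vP, vR} {8..11} s4 s5"
    unfolding rs_def
    by (rule exec_make_rules[OF env Les Ln(3) _ _ s5_def])
      (use 2 3 4 s1 es_bounds in \<open>auto simp: rules_in_def frame_def\<close>)
  define s6 where "s6 = exec L solve s5"
  have "\<forall>r \<in> set rs. fst r \<le> eps"
    using rules by (auto simp: less_Suc_eq_le)
  then have 6: "mem s6 aD = final \<and> mem s6 0 vB = B \<and> frame {vX, vT, vB, vA} {aD, aD'} s5 s6"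
    unfolding final_def B_def D_def D0_def
    by (intro exec_solve[OF _ _ _ _ Lrs LK _ s6_def])
      (use 2 3 4 5 s1 in \<open>simp_all add: frame_def\<close>)
  define s7 where "s7 = exec L load_values s6"
  have 7: "mem s7 0 vH = result 0 \<and> mem s7 0 vZ = result 1 \<and> mem s7 0 vO = result 2 \<and>
      mem s7 0 vT = max4 result \<and> frame {vH, vZ, vO, vY, vT} {} s6 s7"
  proof (rule exec_load_values[OF _ _ _ _ s7_def])
    show "mem s6 aRow m = int (m * m)" "mem s6 0 vM = int m" "mem s6 0 vF = int (idx (acc_state A))"
      using 2 3 4 5 6 s1 by (simp_all add: frame_def)
    show "mem s6 aD (m * m + (4 * idx (acc_state A) + i)) = result i" if "i < 4" for i
      using 6 that by (simp add: result_def)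
  qed
  have "mem s7 0 vB = B" "out s7 = []" "ok s7"
    using 2 3 4 5 6 7 s1 by (simp_all add: frame_def)
  moreover have "s = exec L print_interval s7"
    by (simp add: s_def program_def s1_def s2_def s3_def s4_def s5_def s6_def s7_def)
  ultimately show ?thesis
    using exec_print_interval[of s7 result B L] 7 by simp
qed

end

theorem theorem3p12:
  shows "(\<forall>A :: ('s, 'g) c1pvass. is_c1pvass A \<longrightarrow> is_interval (reach_values A)) \<and>
    (\<exists>(P :: ram_instr list) (p :: nat poly).
       \<forall>(A :: ('s, 'g) c1pvass) ss gs.
         is_c1pvass A \<and> enumerates ss (states A) \<and> enumerates gs (alphabet A) \<longrightarrow>
         (\<exists>I t. describes I (reach_values A) \<and>
            ram_computes P (encode_c1pvass ss gs A) (encode_interval I) t \<and>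
            t \<le> poly p (input_size (encode_c1pvass ss gs A))))"
proof
  show "\<forall>A :: ('s, 'g) c1pvass. is_c1pvass A \<longrightarrow> is_interval (reach_values A)"
  proof (intro allI impI)
    fix A :: "('s, 'g) c1pvass"
    assume A: "is_c1pvass A"
    then have "finite (states A)" "finite (alphabet A)"
      by (simp_all add: is_c1pvass_def)
    \<comment> \<open>The interval property is also read off the computed description, for which any
      enumeration of states and symbols will do.\<close>
    then obtain ss gs where "enumerates ss (states A)" "enumerates gs (alphabet A)"
      unfolding enumerates_def by (metis finite_distinct_list)
    then interpret coded_automaton A ss gs
      using A by unfold_locales
    show "is_interval (reach_values A)"
      using describes_result by (rule is_interval_describes)
  qed
  obtain P p where run: "\<And>L xs. ok (exec L program (start xs)) \<Longrightarrow>
      \<exists>t. ram_computes P xs (out (exec L program (start xs))) t \<and> t \<le> poly p (L + input_size xs)"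
    using ram_computes_com[OF wf_program] by blast
  \<comment> \<open>The machine bound evaluated at \<open>L\<close> plus the input size, with
    \<open>L\<close> as in \<open>exec_program\<close>.\<close>
  define q where "q = pcompose p ([:2, 4:] ^ 5 + [:0, 1:])"
  show "\<exists>(P :: ram_instr list) (p :: nat poly).
       \<forall>(A :: ('s, 'g) c1pvass) ss gs.
         is_c1pvass A \<and> enumerates ss (states A) \<and> enumerates gs (alphabet A) \<longrightarrow>
         (\<exists>I t. describes I (reach_values A) \<and>
            ram_computes P (encode_c1pvass ss gs A) (encode_interval I) t \<and>
            t \<le> poly p (input_size (encode_c1pvass ss gs A)))"
  proof (intro exI[of _ P] exI[of _ q] allI impI)
    fix A :: "('s, 'g) c1pvass" and ss gs
    assume "is_c1pvass A \<and> enumerates ss (states A) \<and> enumerates gs (alphabet A)"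
    then interpret coded_automaton A ss gs
      by unfold_locales auto
    from exec_program[OF refl] run obtain t where
      "ram_computes P input (encode_interval (mk_desc result B)) t"
      "t \<le> poly p ((4 * input_size input + 2) ^ 5 + input_size input)"
      by metis
    then show "\<exists>I t. describes I (reach_values A) \<and> ram_computes P input (encode_interval I) t \<and>
        t \<le> poly q (input_size input)"
      using describes_result
      by (intro exI[of _ "mk_desc result B"] exI[of _ t]) (simp add: q_def poly_pcompose algebra_simps)
  qed
qed

end
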